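(* Let $d\ge2$ be an integer, $\alpha>\frac{j_{d/2-1,1}}{\pi}$, and let $\mathcal{X}=\{x_k\}_{k=1}^s\subseteq[-\frac12,\frac12)^d$ be a set of $s$ distinct points. Suppose $m\ge 4s\sqrt d$ (real) and there is $0<\tau\le\frac{1}{4\sqrt d}$ such that $\frac{2\alpha\nu}{\tau}\le m$, where $\nu:=\nu_2(\tau,\mathcal{X})$. Then $$\sigma_{\min}(\mathcal{F}_{B_m,\mathcal{X}})\ge\frac{1}{\sqrt{2^{\nu-1}s}}\Big(\frac{c(\alpha)}{|B_1|}\Big)^{\nu/2}\Big(\frac{|B_{\alpha/\tau}|}{|B_{\alpha/\tau}|_*}\Big)^{\nu/2}\sqrt{|B_{m/(2\nu)}|}\ \min_{1\le k\le s}\Bigg\{\prod_{0<|x_j-x_k|_2\le\frac{\nu}{m}}\frac{m}{\nu}|x_j-x_k|_2\Bigg\},$$ $$\sigma_{\min}(\Phi_{B_m,\mathcal{X}})\ge\frac{1}{\sqrt{2^{\nu-1}s}}\Big(\frac{c(\alpha)}{|B_1|}\Big)^{\nu/2}\Big(\frac{|B_{\alpha/\tau}|}{|B_{\alpha/\tau}|_*}\Big)^{\nu/2}\sqrt{|B_{m/(2\nu)}|_*}\ \min_{1\le k\le s}\Bigg\{\prod_{0<|x_j-x_k|_2\le\frac{\nu}{m}}\frac{m}{\nu}|x_j-x_k|_2\Bigg\},$$ where the products run over indices $j$ satisfying the displayed condition (an empty product equals $1$).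
   Context: $B_m=\{x\in\mathbb{R}^d:|x|_2\le m\}$. For compact $\Omega\subset\mathbb{R}^d$, $|\Omega|$ is its Lebesgue measure and $|\Omega|_*=|\Omega\cap\mathbb{Z}^d|$ is the number of integer points in $\Omega$. $\mathcal{F}_{\Omega,\mathcal{X}}:\mathbb{C}^s\to L^2(\Omega)$ is $(\mathcal{F}_{\Omega,\mathcal{X}}u)(\omega)=\sum_{k=1}^s u_ke^{-2\pi i\omega\cdot x_k}$, and $\Phi_{\Omega,\mathcal{X}}=[e^{-2\pi i\omega\cdot x}]_{\omega\in\Omega\cap\mathbb{Z}^d,\,x\in\mathcal{X}}$. $\sigma_{\min}$ denotes the minimum of $\|\mathcal{F}_{\Omega,\mathcal{X}}u\|_{L^2(\Omega)}$ (respectively $|\Phi_{\Omega,\mathcal{X}}u|_2$) over $u\in\mathbb{C}^s$ with $|u|_2=1$. Local sparsity: $\nu_p(\tau,\mathcal{X})=\max_{x\in\mathcal{X}}|\mathcal{N}_p(x,\tau,\mathcal{X})|$, where $\mathcal{N}_p(x,\tau,\mathcal{X})=\{x'\in\mathcal{X}:|x'-x|_p\le\tau\}$. $J_\nu$ is the Bessel function of the first kind of order $\nu$, and $j_{\nu,k}$ is its $k$-th positive zero. $|\mathbb{S}^{d-1}|$ is the surface measure of the unit sphere in $\mathbb{R}^d$. For $\alpha\in(\frac{j_{d/2-1,1}}{\pi},\frac{j_{d/2,1}}{\pi})$, $$c(\alpha)=\frac{1}{|\mathbb{S}^{d-1}|}\Big(\frac{2}{\alpha}\Big)^d\frac{\gamma(\alpha)}{1+\gamma(\alpha)/d},\qquad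 \gamma(\alpha)=\frac{-\pi\alpha J_{d/2-1}(\pi\alpha)}{J_{d/2}(\pi\alpha)},$$ and for $\alpha\ge\frac{j_{d/2,1}}{\pi}$, $c(\alpha)=\frac{1}{|\mathbb{S}^{d-1}|}\big(\frac{2\pi}{j_{d/2,1}}\big)^d$. Convention on metrics: in statements about $\mathcal{F}_{\Omega,\mathcal{X}}$, $|\cdot|_p$ is the usual $\ell^p$ norm on $\mathbb{R}^d$; in statements about $\Phi_{\Omega,\mathcal{X}}$, $\mathcal{X}$ is regarded as a subset of the torus $\mathbb{T}^d=(\mathbb{R}/\mathbb{Z})^d\cong[-\frac12,\frac12)^d$ and $|x|_p$ means $\min_{n\in\mathbb{Z}^d}|x+n|_p$. Hypotheses (including $\nu$) and conclusion are read in the metric corresponding to the operator. *)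

theory Defs
  imports "HOL-Analysis.Analysis"
begin

text \<open>
  The dimension \<open>d\<close> is \<open>CARD('n)\<close>, the number \<open>s\<close> of points is \<open>CARD('s)\<close>,
  and the point set is the range of an injective family \<open>x :: 's \<Rightarrow> real ^ 'n\<close>.
\<close>

definition integer_points :: "(real ^ 'n) set" where
  "integer_points = {w. \<forall>i. w $ i \<in> \<int>}"

definition vol :: "(real ^ 'n) set \<Rightarrow> real" where
  "vol \<Omega> = measure lebesgue \<Omega>"

definition vol_star :: "(real ^ 'n) set \<Rightarrow> real" where
  "vol_star \<Omega> = real (card (\<Omega> \<inter> integer_points))"

definition fourier_op :: "('s::finite \<Rightarrow> real ^ 'n) \<Rightarrow> complex ^ 's \<Rightarrow> real ^ 'n \<Rightarrow> complex" where
  "fourier_op x u \<omega> = (\<Sum>k\<in>UNIV. u $ k * exp (- 2 * of_real pi * \<i> * of_real (\<omega> \<bullet> x k)))"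

definition L2_norm_on :: "(real ^ 'n) set \<Rightarrow> (real ^ 'n \<Rightarrow> complex) \<Rightarrow> real" where
  "L2_norm_on \<Omega> f = sqrt (LINT \<omega>:\<Omega>|lebesgue. (cmod (f \<omega>))\<^sup>2)"

text \<open>
  The entry of the matrix \<open>\<Phi>\<close> in row \<open>\<omega>\<close> and column \<open>x k\<close>. The row index set
  \<open>\<Omega> \<inter> integer_points\<close> is finite for bounded \<open>\<Omega>\<close>, so it is kept as an explicit set.
\<close>
definition Phi :: "('s::finite \<Rightarrow> real ^ 'n) \<Rightarrow> real ^ 'n \<Rightarrow> 's \<Rightarrow> complex" where
  "Phi x \<omega> k = exp (- 2 * of_real pi * \<i> * of_real (\<omega> \<bullet> x k))"

definition Phi_norm :: "(real ^ 'n) set \<Rightarrow> ('s::finite \<Rightarrow> real ^ 'n) \<Rightarrow> complex ^ 's \<Rightarrow> real" where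
  "Phi_norm \<Omega> x u =
     sqrt (\<Sum>\<omega>\<in>\<Omega> \<inter> integer_points. (cmod (\<Sum>k\<in>UNIV. Phi x \<omega> k * u $ k))\<^sup>2)"

text \<open>
  The infima below are minima: the unit sphere of \<open>complex ^ 's\<close> is compact and the two
  functions of \<open>u\<close> are continuous for bounded measurable \<open>\<Omega>\<close>.
\<close>
definition sigma_min_F :: "(real ^ 'n) set \<Rightarrow> ('s::finite \<Rightarrow> real ^ 'n) \<Rightarrow> real" where
  "sigma_min_F \<Omega> x = (INF u\<in>{u :: complex ^ 's. norm u = 1}. L2_norm_on \<Omega> (fourier_op x u))"

definition sigma_min_Phi :: "(real ^ 'n) set \<Rightarrow> ('s::finite \<Rightarrow> real ^ 'n) \<Rightarrow> real" where
  "sigma_min_Phi \<Omega> x = (INF u\<in>{u :: complex ^ 's. norm u = 1}. Phi_norm \<Omega> x u)"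

text \<open>The infimum is attained, since \<open>integer_points\<close> is closed and discrete.\<close>
definition torus_norm :: "real ^ 'n \<Rightarrow> real" where
  "torus_norm x = (INF n\<in>integer_points. norm (x + n))"

text \<open>
  The argument \<open>N\<close> is the length function: \<open>norm\<close> for Euclidean space, \<open>torus_norm\<close> for the torus.
\<close>
definition neighbourhood ::
    "(real ^ 'n \<Rightarrow> real) \<Rightarrow> real ^ 'n \<Rightarrow> real \<Rightarrow> (real ^ 'n) set \<Rightarrow> (real ^ 'n) set" where
  "neighbourhood N x \<tau> X = {x'\<in>X. N (x' - x) \<le> \<tau>}"

definition local_sparsity ::
    "(real ^ 'n \<Rightarrow> real) \<Rightarrow> real \<Rightarrow> (real ^ 'n) set \<Rightarrow> nat" where
  "local_sparsity N \<tau> X = (MAX x\<in>X. card (neighbourhood N x \<tau> X))"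

text \<open>The usual power series; it gives the Bessel function of the first kind for \<open>x > 0\<close> only.\<close>
definition bessel_J :: "real \<Rightarrow> real \<Rightarrow> real" where
  "bessel_J \<nu> x =
     (\<Sum>k. (- 1) ^ k * rGamma (real k + \<nu> + 1) / fact k * (x / 2) powr (2 * real k + \<nu>))"

definition bessel_zero :: "real \<Rightarrow> nat \<Rightarrow> real" where
  "bessel_zero \<nu> k =
     (THE x. 0 < x \<and> bessel_J \<nu> x = 0 \<and> card {y. 0 < y \<and> y \<le> x \<and> bessel_J \<nu> y = 0} = k)"

text \<open>
  Surface measure on the unit sphere as the measure appearing in polar coordinates:
  \<open>d\<close> times the Lebesgue measure of the cone over \<open>A\<close>.
\<close>
definition surface_measure :: "(real ^ 'n) set \<Rightarrow> real" where
  "surface_measure A =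
     real CARD('n) * measure lebesgue {r *\<^sub>R x | r x. 0 < r \<and> r \<le> 1 \<and> x \<in> A \<inter> sphere 0 1}"

definition gamma_const :: "nat \<Rightarrow> real \<Rightarrow> real" where
  "gamma_const d \<alpha> =
     - pi * \<alpha> * bessel_J (real d / 2 - 1) (pi * \<alpha>) / bessel_J (real d / 2) (pi * \<alpha>)"

text \<open>Only meaningful for \<open>\<alpha> > bessel_zero (d / 2 - 1) 1 / pi\<close>.\<close>
definition c_const :: "'n::finite itself \<Rightarrow> real \<Rightarrow> real" where
  "c_const _ \<alpha> =
     (let d = CARD('n);
          S = surface_measure (sphere 0 1 :: (real ^ 'n) set);
          j = bessel_zero (real d / 2) 1
      in if \<alpha> < j / pi
         then 1 / S * (2 / \<alpha>) ^ d * (gamma_const d \<alpha> / (1 + gamma_const d \<alpha> / real d))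
         else 1 / S * (2 * pi / j) ^ d)"

end

theory Submission
  imports Defs
begin

text \<open>
  A lower bound for a smallest singular value comes from interpolating functions. Write
  \<open>e(t) = exp (2 \<pi> i t)\<close> and \<open>A(w) = \<Sum>j. u\<^sub>j e(- w \<bullet> x\<^sub>j)\<close>, and suppose that a trigonometric polynomial
  \<open>f = \<Sum>a. c\<^sub>a e(a \<bullet> _)\<close> satisfies \<open>f(x\<^sub>j) = \<delta>\<^sub>j\<^sub>k\<close> and \<open>\<bar>f\<bar> \<le> M\<close>, with integer frequencies \<open>\<bar>a\<bar> \<le> m - r\<close>.
  Then \<open>\<Sum>a. c\<^sub>a A(w - a)\<close> equals \<open>u\<^sub>k\<close> up to a phase, for every \<open>w\<close>. Convolution with the coefficients of \<open>f\<close>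
  has norm at most \<open>M\<close> on square summable sequences, so summing over \<open>\<bar>w\<bar> \<le> r\<close> bounds \<open>\<bar>u\<^sub>k\<bar>\<^sup>2\<close> times the
  number of lattice points in the ball of radius \<open>r\<close> by \<open>M\<^sup>2\<close> times the sum of \<open>\<bar>A\<bar>\<^sup>2\<close> over the ball
  of radius \<open>m\<close> (\<open>band_limited_sampling_bound\<close>). Here \<open>r = m / (2 \<nu>)\<close>.

  The function \<open>f\<close> is a product (\<open>lagrange_function\<close>). Put \<open>R = \<alpha> / \<tau> \<le> r\<close>. At most \<open>\<nu> - 1\<close> other
  points are within \<open>\<tau>\<close> of \<open>x\<^sub>k\<close>; each of them is killed by a factor with two frequencies, of length at most
  \<open>r\<close>, whose size is governed by the distance to \<open>x\<^sub>k\<close>. These factors produce the powers of 2 and the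
  product in the bound. The remaining points fall into \<open>\<nu>\<close> classes such that each class together with
  \<open>x\<^sub>k\<close> is \<open>\<tau>\<close>-separated; each class is killed by one factor with frequencies of length at most \<open>R\<close>. The total length
  \<open>\<nu> R + (\<nu> - 1) r\<close> is at most \<open>m - r\<close>.

  The factor of a separated class is dual to the frame inequality
  \<open>c(\<alpha>) R\<^sup>d \<bar>u\<bar>\<^sup>2 \<le> \<Sum>\<bar>n\<bar>\<le>R. (1 - \<bar>n\<bar>\<^sup>2/R\<^sup>2) \<bar>A(n)\<bar>\<^sup>2\<close> (\<open>c_const_pos_and_frame_bound\<close>). Attach to every point
  the same radial bump \<open>v\<close>, with disjoint supports. Parseval for the superposition \<open>W\<close>, completeness included, and
  the Bessel inequality for its gradient give
  \<open>\<Sum>\<bar>n\<bar>\<le>R. (1 - \<bar>n\<bar>\<^sup>2/R\<^sup>2) \<bar>W^(n)\<bar>\<^sup>2 \<ge> \<bar>u\<bar>\<^sup>2 (\<integral>v\<^sup>2 - \<integral>\<bar>\<nabla>v\<bar>\<^sup>2 / (2 \<pi> R)\<^sup>2)\<close>, while \<open>\<bar>W^(n)\<bar> \<le> \<bar>A(n)\<bar> \<integral>v\<close>. The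
  best \<open>v\<close> solves \<open>v + \<Delta>v / (2 \<pi> R)\<^sup>2 = 1\<close> with zero boundary values. It is
  \<open>1 - L(2 \<pi> R \<bar>x\<bar>) / L(2 \<pi> R \<rho>)\<close> with \<open>L(t) = t\<^sup>-\<^sup>\<mu> J\<^sub>\<mu>(t)\<close>, \<open>\<mu> = d/2 - 1\<close>. For it the difference in brackets equals
  \<open>\<integral>v\<close>. If \<open>\<pi> \<alpha>\<close> lies between the first zeros of \<open>J\<^sub>\<mu>\<close> and \<open>J\<^sub>\<mu>\<^sub>+\<^sub>1\<close>, the radius with \<open>2 \<pi> R \<rho> = \<pi> \<alpha>\<close> gives
  \<open>1 / \<integral>v = c(\<alpha>) R\<^sup>d\<close>; for larger \<open>\<alpha>\<close> the radius for which \<open>2 \<pi> R \<rho>\<close> is the first zero of \<open>J\<^sub>\<mu>\<^sub>+\<^sub>1\<close> gives even more than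
  \<open>c(\<alpha>) R\<^sup>d\<close>. In both cases \<open>v\<close> is nonnegative, because \<open>L\<close> decreases
  up to the first zero of \<open>J\<^sub>\<mu>\<^sub>+\<^sub>1\<close> and is negative between the two zeros.

  For the continuous operator the discrete estimate is proved on every shifted lattice
  \<open>\<theta> + \<int>\<^sup>d\<close> and integrated over \<open>\<theta>\<close> in a unit cell, which turns sums into integrals. Halving the points makes
  their torus distance equal to half their Euclidean distance. The price is a lattice sum over the ball of radius
  \<open>2 R\<close>, to be compared with \<open>2\<^sup>d\<close> times the number of lattice points in the ball of radius \<open>R\<close>. The mean of the
  weight \<open>1 - \<bar>x\<bar>\<^sup>2/R\<^sup>2\<close> over its ball is \<open>2/(d+2)\<close>, and this gain outweighs the difference between
  volumes and lattice counts (\<open>half_lattice_weight_le\<close>).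
\<close>

section \<open>Bessel functions and their first zeros\<close>

definition bessel_coeff :: "real \<Rightarrow> nat \<Rightarrow> real" where
  "bessel_coeff \<nu> k = (- 1) ^ k * rGamma (real k + \<nu> + 1) / (fact k * 2 powr (2 * real k + \<nu>))"

text \<open>
  The entire function of \<open>s = t\<^sup>2\<close> given by \<open>t\<^sup>-\<^sup>\<nu> J\<^sub>\<nu>(t)\<close>. In the variable \<open>t\<close> it has the same positive zeros
  as \<open>J\<^sub>\<nu>\<close>; it is smooth at the origin, and composed with \<open>s = \<bar>x\<bar>\<^sup>2\<close> it is a smooth radial function of several variables.
\<close>
definition bessel_entire :: "real \<Rightarrow> real \<Rightarrow> real" where
  "bessel_entire \<nu> s = (\<Sum>k. bessel_coeff \<nu> k * s ^ k)"

lemma bessel_coeff_Suc: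
  "4 * real (Suc k) * (real k + \<nu> + 1) * bessel_coeff \<nu> (Suc k) = - bessel_coeff \<nu> k"
proof -
  have g: "rGamma (real k + \<nu> + 1) = (real k + \<nu> + 1) * rGamma (real k + \<nu> + 1 + 1)"
    using rGamma_plus1[of "real k + \<nu> + 1"] by simp
  have e: "real (Suc k) + \<nu> + 1 = real k + \<nu> + 1 + 1" by simp
  have p: "2 powr (2 * real (Suc k) + \<nu>) = 4 * 2 powr (2 * real k + \<nu>)"
  proof -
    have "2 powr (2 * real (Suc k) + \<nu>) = 2 powr (2 + (2 * real k + \<nu>))" by (simp add: algebra_simps)
    also have "\<dots> = 4 * 2 powr (2 * real k + \<nu>)" by (subst powr_add) simp
    finally show ?thesis .
  qed
  show ?thesis
  proof -
    have "4 * S * A * ((- 1 * e) * G / (S * F * (4 * P))) = - (e * (A * G) / (F * P))"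
      if "S \<noteq> 0" for S A e G F P :: real using that by simp
    from this[of "real (Suc k)" "real k + \<nu> + 1" "(- 1) ^ k" "rGamma (real k + \<nu> + 1 + 1)" "fact k" "2 powr (2 * real k + \<nu>)"]
    show ?thesis unfolding bessel_coeff_def p e g fact_Suc power_Suc by simp
  qed
qed

lemma bessel_coeff_shift:
  "2 * real (Suc k) * bessel_coeff \<nu> (Suc k) = - bessel_coeff (\<nu> + 1) k"
proof -
  have e: "real (Suc k) + \<nu> + 1 = real k + (\<nu> + 1) + 1" by simp
  have p: "2 powr (2 * real (Suc k) + \<nu>) = 2 * 2 powr (2 * real k + (\<nu> + 1))"
  proof -
    have "2 powr (2 * real (Suc k) + \<nu>) = 2 powr (1 + (2 * real k + (\<nu> + 1)))" by (simp add: algebra_simps)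
    also have "\<dots> = 2 * 2 powr (2 * real k + (\<nu> + 1))" by (subst powr_add) simp
    finally show ?thesis .
  qed
  show ?thesis
  proof -
    have "2 * S * ((- 1 * e) * G / (S * F * (2 * P))) = - (e * G / (F * P))"
      if "S \<noteq> 0" for S e G F P :: real using that by simp
    from this[of "real (Suc k)" "(- 1) ^ k" "rGamma (real k + (\<nu> + 1) + 1)" "fact k" "2 powr (2 * real k + (\<nu> + 1))"]
    show ?thesis unfolding bessel_coeff_def p e fact_Suc power_Suc by simp
  qed
qed

lemma bessel_coeff_step:
  "bessel_coeff \<nu> k = 2 * (\<nu> + 1 + real k) * bessel_coeff (\<nu> + 1) k"
proof -
  have "bessel_coeff \<nu> k = - (2 * (real k + \<nu> + 1) * (2 * real (Suc k) * bessel_coeff \<nu> (Suc k)))"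
  proof -
    have "4 * a * b * c = 2 * b * (2 * a * c)" for a b c :: real by simp
    with bessel_coeff_Suc[of k \<nu>] show ?thesis by (metis minus_minus)
  qed
  then show ?thesis unfolding bessel_coeff_shift by (simp add: algebra_simps)
qed

lemma summable_bessel_entire:
  assumes "\<nu> \<ge> 0"
  shows "summable (\<lambda>k. bessel_coeff \<nu> k * s ^ k)"
proof (rule summable_ratio_test[of "1/2" "nat \<lceil>\<bar>s\<bar>\<rceil>"])
  fix k assume "nat \<lceil>\<bar>s\<bar>\<rceil> \<le> k"
  then have ks: "\<bar>s\<bar> \<le> real k" by linarith
  let ?D = "4 * real (Suc k) * (real k + \<nu> + 1)"
  have D: "?D > 0" using assms by simp
  have eq: "bessel_coeff \<nu> (Suc k) = - bessel_coeff \<nu> k / ?D"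
    using bessel_coeff_Suc[of k \<nu>] D by (metis mult.commute nonzero_mult_div_cancel_right less_irrefl)
  have "2 * \<bar>s\<bar> \<le> ?D"
  proof -
    have "2 * \<bar>s\<bar> \<le> 4 * real (Suc k)" using ks by simp
    also have "\<dots> \<le> 4 * real (Suc k) * (real k + \<nu> + 1)" using assms
      by (simp add: mult_le_cancel_left1)
    finally show ?thesis .
  qed
  then have "\<bar>s\<bar> / ?D \<le> 1/2" using D by (simp add: divide_le_eq)
  then have "norm (bessel_coeff \<nu> k * s ^ k) * (\<bar>s\<bar> / ?D) \<le> norm (bessel_coeff \<nu> k * s ^ k) * (1/2)"
    by (rule mult_left_mono) simp
  moreover have "norm (bessel_coeff \<nu> (Suc k) * s ^ Suc k) = norm (bessel_coeff \<nu> k * s ^ k) * (\<bar>s\<bar> / ?D)"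
    unfolding eq using assms by (simp add: abs_mult)
  ultimately show "norm (bessel_coeff \<nu> (Suc k) * s ^ Suc k) \<le> 1/2 * norm (bessel_coeff \<nu> k * s ^ k)"
    by simp
qed simp

text \<open>
  In the variable \<open>t\<close> this is the classical \<open>(t\<^sup>-\<^sup>\<nu> J\<^sub>\<nu>)' = - t\<^sup>-\<^sup>\<nu> J\<^sub>\<nu>\<^sub>+\<^sub>1\<close>.
\<close>
lemma bessel_entire_deriv:
  assumes "\<nu> \<ge> 0"
  shows "(bessel_entire \<nu> has_real_derivative - bessel_entire (\<nu> + 1) s / 2) (at s)"
proof -
  have "((\<lambda>x. \<Sum>n. bessel_coeff \<nu> n * x ^ n) has_real_derivative
      (\<Sum>n. diffs (bessel_coeff \<nu>) n * s ^ n)) (at s)"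
    by (rule termdiffs_strong_converges_everywhere) (rule summable_bessel_entire[OF assms])
  moreover have "diffs (bessel_coeff \<nu>) n * s ^ n = (- 1 / 2) * (bessel_coeff (\<nu> + 1) n * s ^ n)" for n
  proof -
    have "diffs (bessel_coeff \<nu>) n = - 1 / 2 * bessel_coeff (\<nu> + 1) n"
      using bessel_coeff_shift[of n \<nu>] unfolding diffs_def by linarith
    then show ?thesis by simp
  qed
  moreover have "(\<Sum>n. (- 1 / 2) * (bessel_coeff (\<nu> + 1) n * s ^ n)) = (- 1 / 2) * bessel_entire (\<nu> + 1) s"
    unfolding bessel_entire_def by (rule suminf_mult) (use assms in \<open>simp add: summable_bessel_entire\<close>)
  ultimately show ?thesis by (simp add: bessel_entire_def[abs_def])
qed

lemma bessel_entire_recurrence: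
  assumes "\<nu> \<ge> 0"
  shows "bessel_entire \<nu> s = (2 * \<nu> + 2) * bessel_entire (\<nu> + 1) s - s * bessel_entire (\<nu> + 2) s"
proof -
  let ?a = "bessel_coeff (\<nu> + 1)"
  have sa: "summable (\<lambda>n. ?a n * s ^ n)"
    using assms by (simp add: summable_bessel_entire)
  have sb: "summable (\<lambda>n. bessel_coeff (\<nu> + 2) n * s ^ n)"
    using assms by (simp add: summable_bessel_entire)
  have D: "2 * s * (\<Sum>n. diffs ?a n * s ^ n) = (\<Sum>n. 2 * (real n * ?a n * s ^ n))"
       and sD: "summable (\<lambda>n. 2 * (real n * ?a n * s ^ n))"
  proof -
    have sd: "summable (\<lambda>n. diffs ?a n * s ^ n)"
      by (rule termdiff_converges_all) (use assms in \<open>simp add: summable_bessel_entire\<close>)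
    have "(\<lambda>n. real n * ?a n * s ^ (n - Suc 0)) sums (\<Sum>n. diffs ?a n * s ^ n)"
      by (rule diffs_equiv[OF sd])
    from sums_mult[OF this, of "2 * s"]
    have "(\<lambda>n. 2 * s * (real n * ?a n * s ^ (n - Suc 0))) sums (2 * s * (\<Sum>n. diffs ?a n * s ^ n))" .
    moreover have "2 * s * (real n * ?a n * s ^ (n - Suc 0)) = 2 * (real n * ?a n * s ^ n)" for n
      by (cases n) auto
    ultimately have "(\<lambda>n. 2 * (real n * ?a n * s ^ n)) sums (2 * s * (\<Sum>n. diffs ?a n * s ^ n))" by simp
    then show "2 * s * (\<Sum>n. diffs ?a n * s ^ n) = (\<Sum>n. 2 * (real n * ?a n * s ^ n))"
      "summable (\<lambda>n. 2 * (real n * ?a n * s ^ n))" by (auto simp: sums_iff)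
  qed
  have "diffs ?a n * s ^ n = (- 1 / 2) * (bessel_coeff (\<nu> + 2) n * s ^ n)" for n
  proof -
    have "diffs ?a n = - 1 / 2 * bessel_coeff (\<nu> + 1 + 1) n"
      using bessel_coeff_shift[of n "\<nu> + 1"] unfolding diffs_def by linarith
    then show ?thesis by (simp add: add.assoc)
  qed
  then have "(\<Sum>n. diffs ?a n * s ^ n) = (- 1 / 2) * bessel_entire (\<nu> + 2) s"
    unfolding bessel_entire_def using suminf_mult[OF sb, of "- 1 / 2"] by simp
  then have "- s * bessel_entire (\<nu> + 2) s = (\<Sum>n. 2 * (real n * ?a n * s ^ n))" using D by simp
  moreover have "(2 * \<nu> + 2) * bessel_entire (\<nu> + 1) s = (\<Sum>n. (2 * \<nu> + 2) * (?a n * s ^ n))"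
    unfolding bessel_entire_def using suminf_mult[OF sa] by simp
  ultimately have "(2 * \<nu> + 2) * bessel_entire (\<nu> + 1) s - s * bessel_entire (\<nu> + 2) s =
     (\<Sum>n. (2 * \<nu> + 2) * (?a n * s ^ n) + 2 * (real n * ?a n * s ^ n))"
    using suminf_add[OF summable_mult[OF sa, of "2 * \<nu> + 2"] sD] by linarith
  also have "(\<lambda>n. (2 * \<nu> + 2) * (?a n * s ^ n) + 2 * (real n * ?a n * s ^ n)) = (\<lambda>n. bessel_coeff \<nu> n * s ^ n)"
    by (rule ext, subst (3) bessel_coeff_step) (simp add: algebra_simps)
  finally show ?thesis by (simp add: bessel_entire_def)
qed

lemma bessel_J_entire:
  assumes "x > 0" "\<nu> \<ge> 0"
  shows "bessel_J \<nu> x = x powr \<nu> * bessel_entire \<nu> (x\<^sup>2)"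
proof -
  have "(- 1) ^ k * rGamma (real k + \<nu> + 1) / fact k * (x / 2) powr (2 * real k + \<nu>)
     = x powr \<nu> * (bessel_coeff \<nu> k * (x\<^sup>2) ^ k)" for k
  proof -
    have "x powr (2 * real k + \<nu>) = x powr \<nu> * (x\<^sup>2) ^ k"
    proof -
      have "(x\<^sup>2) ^ k = x powr (2 * real k)"
        using powr_realpow[OF assms(1), of "2 * k"] by (simp add: power_mult)
      then show ?thesis by (simp add: powr_add)
    qed
    then show ?thesis using assms by (simp add: powr_divide bessel_coeff_def)
  qed
  then show ?thesis
    unfolding bessel_J_def bessel_entire_def using suminf_mult[OF summable_bessel_entire[OF assms(2)]] by simp
qed

lemma bessel_entire_0: "\<nu> \<ge> 0 \<Longrightarrow> bessel_entire \<nu> 0 > 0"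
  unfolding bessel_entire_def
  by (subst powser_zero) (simp add: bessel_coeff_def rGamma_inverse_Gamma Gamma_real_pos)

lemma bessel_entire_continuous [continuous_intros]:
  assumes "\<nu> \<ge> 0" "continuous_on A f"
  shows "continuous_on A (\<lambda>t. bessel_entire \<nu> (f t))"
proof -
  have "continuous_on UNIV (bessel_entire \<nu>)"
    by (rule continuous_at_imp_continuous_on) (use bessel_entire_deriv[OF assms(1)] DERIV_isCont in blast)
  from continuous_on_compose2[OF this assms(2)] show ?thesis by simp
qed

lemma bessel_entire_deriv_chain [derivative_intros]:
  assumes "\<nu> \<ge> 0" "(f has_real_derivative f') (at t within S)"
  shows "((\<lambda>t. bessel_entire \<nu> (f t)) has_real_derivative (- bessel_entire (\<nu> + 1) (f t) / 2 * f')) (at t within S)"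
  using DERIV_chain2[OF bessel_entire_deriv[OF assms(1), of "f t"] assms(2)] .

text \<open>
  The quotient \<open>q = J\<^sub>\<nu>\<^sub>+\<^sub>1 / J\<^sub>\<nu>\<close> solves the Riccati equation \<open>q' = 1 + q\<^sup>2 - (2 \<nu> + 1) q / t\<close>. If \<open>J\<^sub>\<nu>\<close> had no
  positive zero, then \<open>q\<close> would be defined on the whole half line, and \<open>arctan q\<close> would increase at rate at least
  \<open>1/2\<close> beyond \<open>t = 2 \<nu> + 1\<close>, although it is bounded.
\<close>
lemma bessel_entire_has_zero:
  assumes "\<nu> \<ge> 0"
  shows "\<exists>t>0. bessel_entire \<nu> (t\<^sup>2) = 0"
proof (rule ccontr)
  assume "\<not> ?thesis"
  then have nz: "bessel_entire \<nu> (t\<^sup>2) \<noteq> 0" if "t > 0" for t using that by blast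
  define q where "q t = t * bessel_entire (\<nu> + 1) (t\<^sup>2) / bessel_entire \<nu> (t\<^sup>2)" for t
  define F where "F t = arctan (q t) - t / 2" for t
  have dq: "(q has_real_derivative (1 - (2 * \<nu> + 1) * q t / t + (q t)\<^sup>2)) (at t)" if "t > 0" for t
  proof -
    have r: "bessel_entire \<nu> (t\<^sup>2) = (2 * \<nu> + 2) * bessel_entire (\<nu> + 1) (t\<^sup>2) - t\<^sup>2 * bessel_entire (\<nu> + 1 + 1) (t\<^sup>2)"
      using bessel_entire_recurrence[OF assms, of "t\<^sup>2"] by (simp add: add.assoc)
    let ?a = "bessel_entire \<nu> (t\<^sup>2)" and ?b = "bessel_entire (\<nu> + 1) (t\<^sup>2)" and ?c = "bessel_entire (\<nu> + 1 + 1) (t\<^sup>2)"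
    have sq: "((\<lambda>t. t\<^sup>2) has_real_derivative 2 * t) (at t)"
      by (auto intro!: derivative_eq_intros)
    have da: "((\<lambda>t. bessel_entire \<nu> (t\<^sup>2)) has_real_derivative - ?b / 2 * (2 * t)) (at t)"
      by (rule bessel_entire_deriv_chain[OF assms sq])
    have db: "((\<lambda>t. bessel_entire (\<nu> + 1) (t\<^sup>2)) has_real_derivative - ?c / 2 * (2 * t)) (at t)"
      by (rule bessel_entire_deriv_chain[OF _ sq]) (use assms in simp)
    have "(q has_real_derivative ((1 * ?b + - ?c / 2 * (2 * t) * t) * ?a - (t * ?b) * (- ?b / 2 * (2 * t))) / (?a * ?a)) (at t)"
      unfolding q_def[abs_def] by (rule DERIV_divide[OF DERIV_mult[OF DERIV_ident db] da nz[OF that]])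
    also have "((1 * ?b + - ?c / 2 * (2 * t) * t) * ?a - (t * ?b) * (- ?b / 2 * (2 * t))) / (?a * ?a)
        = (?b - t\<^sup>2 * ?c) / ?a + (t * ?b / ?a)\<^sup>2"
      using nz[OF that] by (simp add: power2_eq_square add_divide_distrib diff_divide_distrib ac_simps)
    also have "?b - t\<^sup>2 * ?c = ?a - (2 * \<nu> + 1) * ?b" unfolding r by (simp add: algebra_simps)
    also have "(?a - (2 * \<nu> + 1) * ?b) / ?a = 1 - (2 * \<nu> + 1) * q t / t"
      using nz[OF that] that by (simp add: diff_divide_distrib q_def)
    also have "(t * ?b / ?a)\<^sup>2 = (q t)\<^sup>2" by (simp add: q_def)
    finally show ?thesis .
  qed
  let ?T = "2 * \<nu> + 1"
  \<comment> \<open>Over an interval of length \<open>8\<close> the arctangent would grow by at least \<open>4 > \<pi>\<close>.\<close>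
  have "F ?T \<le> F (?T + 8)"
  proof (rule DERIV_nonneg_imp_nondecreasing[where f = F])
    fix t assume t: "?T \<le> t" "t \<le> ?T + 8"
    then have tp: "t > 0" using assms by linarith
    have d: "(F has_real_derivative (1 - ?T * q t / t + (q t)\<^sup>2) / (1 + (q t)\<^sup>2) - 1 / 2) (at t)"
    proof -
      have "((\<lambda>t. arctan (q t)) has_real_derivative (1 - ?T * q t / t + (q t)\<^sup>2) / (1 + (q t)\<^sup>2)) (at t)"
        using DERIV_chain2[OF DERIV_arctan dq[OF tp]] by (simp add: divide_inverse mult.commute)
      from DERIV_diff[OF this DERIV_cdivide[OF DERIV_ident, of 2]]
      show ?thesis unfolding F_def[abs_def] .
    qed
    have "?T * q t / t \<le> \<bar>q t\<bar>"
    proof -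
      have "?T * q t \<le> ?T * \<bar>q t\<bar>" using assms by (intro mult_left_mono) auto
      also have "\<dots> \<le> t * \<bar>q t\<bar>" using t by (intro mult_right_mono) auto
      finally show ?thesis using tp by (simp add: divide_le_eq mult.commute)
    qed
    moreover have "2 * \<bar>q t\<bar> \<le> 1 + (q t)\<^sup>2"
      using zero_le_power2[of "\<bar>q t\<bar> - 1"] by (simp add: power2_diff)
    moreover have "(1 + b) / 2 \<le> 1 - X + b" if "X \<le> y" "2 * y \<le> 1 + b" for X y b :: real
      using that by (simp add: divide_le_eq)
    ultimately have "1 - ?T * q t / t + (q t)\<^sup>2 \<ge> (1 + (q t)\<^sup>2) / 2" by blast
    then have "(1 - ?T * q t / t + (q t)\<^sup>2) / (1 + (q t)\<^sup>2) - 1 / 2 \<ge> 0"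
      by (simp add: le_divide_eq add_pos_nonneg)
    with d show "\<exists>y. (F has_real_derivative y) (at t) \<and> 0 \<le> y" by blast
  qed simp
  then have "arctan (q (?T + 8)) - arctan (q ?T) \<ge> 4"
    by (simp add: F_def add_divide_distrib)
  moreover have "arctan (q (?T + 8)) < pi / 2" "arctan (q ?T) > - (pi / 2)"
    using arctan_bounded by auto
  ultimately show False using pi_less_4 by linarith
qed

text \<open>
  Since a positive zero exists and \<open>t\<^sup>-\<^sup>\<nu> J\<^sub>\<nu>\<close> is continuous and positive at \<open>0\<close>, the infimum of the zeros is a zero.
  It is the only candidate for a zero that is the first in the counting of \<open>bessel_zero\<close>, so the definite
  description denotes it.
\<close>
lemma bessel_zero_first:
  assumes "\<nu> \<ge> 0"
  defines "j \<equiv> bessel_zero \<nu> 1"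
  shows "j > 0" "bessel_entire \<nu> (j\<^sup>2) = 0" "\<And>t. 0 \<le> t \<Longrightarrow> t < j \<Longrightarrow> bessel_entire \<nu> (t\<^sup>2) > 0"
proof -
  define Z where "Z = {t. 0 \<le> t \<and> bessel_entire \<nu> (t\<^sup>2) = 0}"
  have c: "continuous_on UNIV (\<lambda>t. bessel_entire \<nu> (t\<^sup>2))"
    using assms(1) by (intro continuous_intros)
  have "closed Z" unfolding Z_def
    by (intro closed_Collect_conj closed_Collect_le closed_Collect_eq c continuous_intros)
  moreover have "Z \<noteq> {}" using bessel_entire_has_zero[OF assms(1)] by (force simp: Z_def)
  moreover have bdd: "bdd_below Z" by (rule bdd_belowI[of _ 0]) (simp add: Z_def)
  ultimately have InfZ: "Inf Z \<in> Z" by (simp add: closed_contains_Inf)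
  define i where "i = Inf Z"
  have i0: "bessel_entire \<nu> (i\<^sup>2) = 0" "i \<ge> 0" using InfZ by (auto simp: Z_def i_def)
  have ip: "i > 0" using i0 bessel_entire_0[OF assms(1)] by (cases "i = 0") auto
  have nz: "bessel_entire \<nu> (t\<^sup>2) \<noteq> 0" if "0 \<le> t" "t < i" for t
    using cInf_lower[OF _ bdd, of t] that by (force simp: Z_def i_def)
  have pos: "bessel_entire \<nu> (t\<^sup>2) > 0" if t: "0 \<le> t" "t < i" for t
  proof (rule ccontr)
    assume "\<not> ?thesis"
    then have le: "bessel_entire \<nu> (t\<^sup>2) \<le> 0" by simp
    have "\<exists>x. 0 \<le> x \<and> x \<le> t \<and> bessel_entire \<nu> (x\<^sup>2) = 0"
      by (rule IVT2') (use le t bessel_entire_0[OF assms(1)] continuous_on_subset[OF c] in auto)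
    then show False using nz t by force
  qed
  have J: "bessel_J \<nu> y = 0 \<longleftrightarrow> bessel_entire \<nu> (y\<^sup>2) = 0" if "y > 0" for y
    using that by (simp add: bessel_J_entire assms(1))
  have "bessel_zero \<nu> 1 = i" unfolding bessel_zero_def
  proof (rule the_equality)
    have "{y. 0 < y \<and> y \<le> i \<and> bessel_J \<nu> y = 0} = {i}"
    proof (intro set_eqI iffI)
      fix y assume "y \<in> {y. 0 < y \<and> y \<le> i \<and> bessel_J \<nu> y = 0}"
      then have "0 < y" "y \<le> i" "bessel_entire \<nu> (y\<^sup>2) = 0" using J[of y] by auto
      then show "y \<in> {i}" using nz[of y] by (cases "y < i") auto
    qed (use J[OF ip] ip i0 in auto)
    then show "0 < i \<and> bessel_J \<nu> i = 0 \<and> card {y. 0 < y \<and> y \<le> i \<and> bessel_J \<nu> y = 0} = 1"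
      using J[OF ip] ip i0 by simp
  next
    fix x assume x: "0 < x \<and> bessel_J \<nu> x = 0 \<and> card {y. 0 < y \<and> y \<le> x \<and> bessel_J \<nu> y = 0} = 1"
    then obtain z where z: "{y. 0 < y \<and> y \<le> x \<and> bessel_J \<nu> y = 0} = {z}" by (auto simp: card_1_singleton_iff)
    have "x \<in> {z}" using x unfolding z[symmetric] by simp
    moreover have "i \<le> x" using x J[of x] nz[of x] by (cases "x < i") auto
    then have "i \<in> {z}" using ip i0 J[OF ip] unfolding z[symmetric] by simp
    ultimately show "x = i" by simp
  qed
  then show "j > 0" "bessel_entire \<nu> (j\<^sup>2) = 0" "\<And>t. 0 \<le> t \<Longrightarrow> t < j \<Longrightarrow> bessel_entire \<nu> (t\<^sup>2) > 0"
    using ip i0 pos by (auto simp: j_def)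
qed

text \<open>
  This is \<open>(t\<^sup>\<nu>\<^sup>+\<^sup>1 J\<^sub>\<nu>\<^sub>+\<^sub>1)' = t\<^sup>\<nu>\<^sup>+\<^sup>1 J\<^sub>\<nu>\<close> for \<open>\<nu> = d/2 - 1\<close>. It also is the radial form of the Helmholtz equation:
  up to a constant factor, the flux of a radial eigenfunction of the Laplacian through the sphere of radius \<open>r\<close> is a
  primitive of \<open>r\<^sup>d\<^sup>-\<^sup>1\<close> times the eigenfunction.
\<close>
lemma bessel_entire_mono_deriv:
  assumes "d \<ge> 2"
  shows "((\<lambda>r. r ^ d * bessel_entire (real d / 2) ((c * r)\<^sup>2)) has_real_derivative
     r ^ (d - 1) * bessel_entire (real d / 2 - 1) ((c * r)\<^sup>2)) (at r within A)"
proof -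
  let ?s = "(c * r)\<^sup>2"
  have rec: "bessel_entire (real d / 2 - 1) ?s = real d * bessel_entire (real d / 2) ?s - ?s * bessel_entire (real d / 2 + 1) ?s"
    using bessel_entire_recurrence[of "real d / 2 - 1" ?s] assms by (simp add: algebra_simps)
  have sq: "((\<lambda>r. (c * r)\<^sup>2) has_real_derivative 2 * c\<^sup>2 * r) (at r within A)"
    by (auto intro!: derivative_eq_intros simp: power2_eq_square)
  have "((\<lambda>r. r ^ d * bessel_entire (real d / 2) ((c * r)\<^sup>2)) has_real_derivative
     real d * r ^ (d - 1) * bessel_entire (real d / 2) ?s
     + - bessel_entire (real d / 2 + 1) ?s / 2 * (2 * c\<^sup>2 * r) * r ^ d) (at r within A)"
    by (rule DERIV_mult[OF _ bessel_entire_deriv_chain[OF _ sq]])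
       (auto intro!: derivative_eq_intros)
  moreover have "r ^ d = r * r ^ (d - 1)" using assms by (cases d) auto
  then have "real d * r ^ (d - 1) * bessel_entire (real d / 2) ?s
     + - bessel_entire (real d / 2 + 1) ?s / 2 * (2 * c\<^sup>2 * r) * r ^ d
     = r ^ (d - 1) * bessel_entire (real d / 2 - 1) ?s"
    unfolding rec by (simp add: power2_eq_square algebra_simps)
  ultimately show ?thesis by simp
qed

text \<open>
  As long as the function of order \<open>d/2 - 1\<close> is positive, \<open>t\<^sup>d\<close> times the function of order \<open>d/2\<close> increases from the
  value \<open>0\<close>.
\<close>
lemma bessel_entire_upper_pos:
  assumes "d \<ge> 2" "0 \<le> t" "t \<le> bessel_zero (real d / 2 - 1) 1"
  shows "bessel_entire (real d / 2) (t\<^sup>2) > 0"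
proof (cases "t = 0")
  case True
  then show ?thesis using bessel_entire_0[of "real d / 2"] by simp
next
  case False
  then have tp: "t > 0" using assms by simp
  have nn: "real d / 2 - 1 \<ge> 0" using assms by simp
  have "0 ^ d * bessel_entire (real d / 2) (0\<^sup>2) < t ^ d * bessel_entire (real d / 2) (t\<^sup>2)"
  proof (rule DERIV_pos_imp_increasing_open[OF tp])
    fix r assume r: "0 < r" "r < t"
    have "bessel_entire (real d / 2 - 1) (r\<^sup>2) > 0"
      using bessel_zero_first(3)[OF nn, of r] r assms by simp
    then show "\<exists>y. ((\<lambda>r. r ^ d * bessel_entire (real d / 2) (r\<^sup>2)) has_real_derivative y) (at r) \<and> 0 < y"
      using bessel_entire_mono_deriv[OF assms(1), of 1 r UNIV] r by (intro exI) auto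
  qed (intro continuous_intros, simp)
  then show ?thesis using assms tp by (simp add: zero_less_mult_iff power_0_left)
qed

lemma bessel_zero_interlace:
  assumes "d \<ge> 2"
  shows "bessel_zero (real d / 2 - 1) 1 < bessel_zero (real d / 2) 1"
proof (rule ccontr)
  assume "\<not> ?thesis"
  then show False
    using bessel_entire_upper_pos[OF assms, of "bessel_zero (real d / 2) 1"]
      bessel_zero_first(1,2)[of "real d / 2"] by simp
qed

text \<open>
  The derivative is a negative multiple of the function of order \<open>d/2\<close>, which is positive up to its own first zero.
\<close>
lemma bessel_entire_decreasing:
  assumes "d \<ge> 2" "0 \<le> a" "a < b" "b \<le> bessel_zero (real d / 2) 1"
  shows "bessel_entire (real d / 2 - 1) (b\<^sup>2) < bessel_entire (real d / 2 - 1) (a\<^sup>2)"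
proof (rule DERIV_neg_imp_decreasing_open[OF assms(3)])
  fix r assume r: "a < r" "r < b"
  have nn: "real d / 2 - 1 \<ge> 0" using assms by simp
  have sq: "((\<lambda>t. t\<^sup>2) has_real_derivative 2 * r) (at r)"
    by (auto intro!: derivative_eq_intros)
  have "bessel_entire (real d / 2) (r\<^sup>2) > 0"
    using bessel_zero_first(3)[of "real d / 2" r] r assms by simp
  then have "- bessel_entire (real d / 2 - 1 + 1) (r\<^sup>2) / 2 * (2 * r) < 0"
    using r assms by simp
  with bessel_entire_deriv_chain[OF nn sq]
  show "\<exists>y. ((\<lambda>r. bessel_entire (real d / 2 - 1) (r\<^sup>2)) has_real_derivative y) (at r) \<and> y < 0" by blast
qed (intro continuous_intros, use assms in auto)

lemma bessel_entire_neg: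
  assumes "d \<ge> 2" "bessel_zero (real d / 2 - 1) 1 < t" "t \<le> bessel_zero (real d / 2) 1"
  shows "bessel_entire (real d / 2 - 1) (t\<^sup>2) < 0"
  using bessel_entire_decreasing[OF assms(1) _ assms(2,3)] bessel_zero_first(1,2)[of "real d / 2 - 1"] assms(1)
  by simp

text \<open>
  With \<open>f\<^sub>0, f\<^sub>1\<close> the entire functions of orders \<open>d/2 - 1\<close> and \<open>d/2\<close>: since \<open>f\<^sub>0 \<le> f\<^sub>0(0)\<close> up to the zero, integrating
  \<open>(t\<^sup>d f\<^sub>1)' = t\<^sup>d\<^sup>-\<^sup>1 f\<^sub>0\<close> gives \<open>f\<^sub>1 \<le> f\<^sub>0(0) / d\<close>, and integrating \<open>f\<^sub>0' = - t f\<^sub>1\<close> gives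
  \<open>f\<^sub>0 \<ge> f\<^sub>0(0) (1 - t\<^sup>2 / (2 d))\<close>. This bound is the good one in low dimension.
\<close>
lemma bessel_zero_lower_sqrt:
  assumes "d \<ge> 2"
  shows "(bessel_zero (real d / 2 - 1) 1)\<^sup>2 \<ge> 2 * real d"
proof -
  let ?\<nu> = "real d / 2 - 1"
  define j where "j = bessel_zero ?\<nu> 1"
  define a where "a = bessel_entire ?\<nu> 0"
  have nn: "?\<nu> \<ge> 0" using assms by simp
  have j: "j > 0" "bessel_entire ?\<nu> (j\<^sup>2) = 0" using bessel_zero_first[OF nn] by (auto simp: j_def)
  have a: "a > 0" using bessel_entire_0[OF nn] by (simp add: a_def)
  have up: "bessel_entire ?\<nu> (t\<^sup>2) \<le> a" if "0 \<le> t" "t \<le> j" for t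
    using bessel_entire_decreasing[OF assms, of 0 t] bessel_zero_interlace[OF assms] that
    by (cases "t = 0") (auto simp: a_def j_def)
  have f1: "bessel_entire (real d / 2) (t\<^sup>2) \<le> a / d" if t: "0 < t" "t \<le> j" for t
  proof -
    have "0 ^ d * a / d - 0 ^ d * bessel_entire (real d / 2) ((1 * 0)\<^sup>2)
        \<le> t ^ d * a / d - t ^ d * bessel_entire (real d / 2) ((1 * t)\<^sup>2)"
    proof (rule DERIV_nonneg_imp_nondecreasing[where
        f = "\<lambda>r. r ^ d * a / d - r ^ d * bessel_entire (real d / 2) ((1 * r)\<^sup>2)"])
      fix r assume r: "0 \<le> r" "r \<le> t"
      have "((\<lambda>r. r ^ d * a / d) has_real_derivative r ^ (d - 1) * a) (at r)"
        using assms by (auto intro!: derivative_eq_intros)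
      from DERIV_diff[OF this bessel_entire_mono_deriv[OF assms, of 1 r UNIV]]
      have "((\<lambda>r. r ^ d * a / d - r ^ d * bessel_entire (real d / 2) ((1 * r)\<^sup>2)) has_real_derivative
         r ^ (d - 1) * (a - bessel_entire ?\<nu> (r\<^sup>2))) (at r)" by (simp add: algebra_simps)
      moreover have "r ^ (d - 1) * (a - bessel_entire ?\<nu> (r\<^sup>2)) \<ge> 0" using up[of r] r t by simp
      ultimately show "\<exists>y. ((\<lambda>r. r ^ d * a / d - r ^ d * bessel_entire (real d / 2) ((1 * r)\<^sup>2)) has_real_derivative y) (at r) \<and> 0 \<le> y"
        by blast
    qed (use t in simp)
    then have "t ^ d * bessel_entire (real d / 2) (t\<^sup>2) \<le> t ^ d * (a / d)" using assms by (simp add: power_0_left)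
    then show ?thesis using t by (subst (asm) mult_le_cancel_left_pos) auto
  qed
  have "bessel_entire ?\<nu> (0\<^sup>2) - a * (1 - 0\<^sup>2 / (2 * d)) \<le> bessel_entire ?\<nu> (j\<^sup>2) - a * (1 - j\<^sup>2 / (2 * d))"
  proof (rule DERIV_nonneg_imp_nondecreasing[where
      f = "\<lambda>t. bessel_entire ?\<nu> (t\<^sup>2) - a * (1 - t\<^sup>2 / (2 * d))"])
    fix r assume r: "0 \<le> r" "r \<le> j"
    have sq: "((\<lambda>t. t\<^sup>2) has_real_derivative 2 * r) (at r)"
      by (auto intro!: derivative_eq_intros)
    have "((\<lambda>t. a * (1 - t\<^sup>2 / (2 * d))) has_real_derivative - (a / d * r)) (at r)"
      using assms by (auto intro!: derivative_eq_intros)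
    from DERIV_diff[OF bessel_entire_deriv_chain[OF nn sq] this]
    have "((\<lambda>t. bessel_entire ?\<nu> (t\<^sup>2) - a * (1 - t\<^sup>2 / (2 * d))) has_real_derivative
       r * (a / d - bessel_entire (real d / 2) (r\<^sup>2))) (at r)" by (simp add: algebra_simps)
    moreover have "r * (a / d - bessel_entire (real d / 2) (r\<^sup>2)) \<ge> 0"
      using f1[of r] r by (cases "r = 0") auto
    ultimately show "\<exists>y. ((\<lambda>t. bessel_entire ?\<nu> (t\<^sup>2) - a * (1 - t\<^sup>2 / (2 * d))) has_real_derivative y) (at r) \<and> 0 \<le> y"
      by blast
  qed (use j in simp)
  moreover have "bessel_entire ?\<nu> (0\<^sup>2) - a * (1 - 0\<^sup>2 / (2 * d)) = 0" by (simp add: a_def)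
  ultimately have "a * (1 - j\<^sup>2 / (2 * d)) \<le> 0" using j(2) by linarith
  then have "1 - j\<^sup>2 / (2 * d) \<le> 0" using a by (metis mult_pos_pos not_less)
  moreover have "2 * real d > 0" using assms by simp
  ultimately have "2 * real d \<le> j\<^sup>2" using pos_le_divide_eq[of "2 * real d" 1 "j\<^sup>2"] by simp
  then show ?thesis by (simp add: j_def)
qed

text \<open>
  The function \<open>Z = f\<^sub>0 - (d/2) f\<^sub>1\<close> satisfies \<open>(t\<^sup>d\<^sup>/\<^sup>2 Z)' = t\<^sup>d\<^sup>/\<^sup>2\<^sup>-\<^sup>1 ((d/2)\<^sup>2 - t\<^sup>2) f\<^sub>1\<close>, hence stays positive up to
  \<open>t = d/2\<close> as long as \<open>f\<^sub>1\<close> is positive; but \<open>Z < 0\<close> at the first zero of \<open>f\<^sub>0\<close>. This bound is the good one in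
  high dimension, where the bound by the square root of \<open>2 d\<close> is of smaller order.
\<close>
lemma bessel_zero_lower_linear:
  assumes "d \<ge> 2"
  shows "bessel_zero (real d / 2 - 1) 1 \<ge> real d / 2"
proof (rule ccontr)
  let ?\<nu> = "real d / 2 - 1" and ?h = "real d / 2"
  define j where "j = bessel_zero ?\<nu> 1"
  assume "\<not> ?thesis"
  then have jd: "j < ?h" by (simp add: j_def)
  have nn: "?\<nu> \<ge> 0" using assms by simp
  have j: "j > 0" "bessel_entire ?\<nu> (j\<^sup>2) = 0" using bessel_zero_first[OF nn] by (auto simp: j_def)
  define Z where "Z t = bessel_entire ?\<nu> (t\<^sup>2) - ?h * bessel_entire ?h (t\<^sup>2)" for t
  have "0 powr ?h * Z 0 < j powr ?h * Z j"
  proof (rule DERIV_pos_imp_increasing_open[OF j(1)])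
    fix t assume t: "0 < t" "t < j"
    have sq: "((\<lambda>t. t\<^sup>2) has_real_derivative 2 * t) (at t)"
      by (auto intro!: derivative_eq_intros)
    let ?f1 = "bessel_entire ?h (t\<^sup>2)" and ?f2 = "bessel_entire (?h + 1) (t\<^sup>2)"
    have rec: "t\<^sup>2 * ?f2 = real d * ?f1 - bessel_entire ?\<nu> (t\<^sup>2)"
      using bessel_entire_recurrence[OF nn, of "t\<^sup>2"] by (simp add: algebra_simps)
    have dZ: "(Z has_real_derivative (- bessel_entire (?\<nu> + 1) (t\<^sup>2) / 2 * (2 * t)) - ?h * (- ?f2 / 2 * (2 * t))) (at t)"
      unfolding Z_def[abs_def]
      by (rule DERIV_diff[OF bessel_entire_deriv_chain[OF nn sq] DERIV_cmult[OF bessel_entire_deriv_chain[OF _ sq]]]) simp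
    have dp: "((\<lambda>t. t powr ?h) has_real_derivative ?h * t powr (?h - 1)) (at t)"
      using has_real_derivative_powr[of t ?h] t by simp
    have "((\<lambda>t. t powr ?h * Z t) has_real_derivative
       ?h * t powr (?h - 1) * Z t + ((- bessel_entire (?\<nu> + 1) (t\<^sup>2) / 2 * (2 * t)) - ?h * (- ?f2 / 2 * (2 * t))) * t powr ?h) (at t)"
      by (rule DERIV_mult[OF dp dZ])
    also have "?h * t powr (?h - 1) * Z t + ((- bessel_entire (?\<nu> + 1) (t\<^sup>2) / 2 * (2 * t)) - ?h * (- ?f2 / 2 * (2 * t))) * t powr ?h
       = t powr (?h - 1) * ((?h\<^sup>2 - t\<^sup>2) * ?f1)"
    proof -
      have "t powr ?h = t powr (?h - 1 + 1)" by simp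
      also have "\<dots> = t powr (?h - 1) * t" using t by (subst powr_add) simp
      finally have p: "t powr ?h = t powr (?h - 1) * t" .
      have "?h * Z t + ((- bessel_entire (?\<nu> + 1) (t\<^sup>2) / 2 * (2 * t)) - ?h * (- ?f2 / 2 * (2 * t))) * t
          = ?h * Z t - t\<^sup>2 * ?f1 + ?h * (t\<^sup>2 * ?f2)"
        by (simp add: algebra_simps power2_eq_square)
      also have "\<dots> = (?h\<^sup>2 - t\<^sup>2) * ?f1"
        unfolding rec Z_def by (simp add: algebra_simps power2_eq_square)
      finally have e: "?h * Z t + ((- bessel_entire (?\<nu> + 1) (t\<^sup>2) / 2 * (2 * t)) - ?h * (- ?f2 / 2 * (2 * t))) * t
          = (?h\<^sup>2 - t\<^sup>2) * ?f1" .
      have "h * P * z + X * (P * t) = P * (h * z + X * t)" for h P z X :: real by (simp add: algebra_simps)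
      then show ?thesis unfolding p e[symmetric] .
    qed
    finally have D: "((\<lambda>t. t powr ?h * Z t) has_real_derivative t powr (?h - 1) * ((?h\<^sup>2 - t\<^sup>2) * ?f1)) (at t)" .
    have "?f1 > 0" using bessel_entire_upper_pos[OF assms, of t] t by (simp add: j_def)
    moreover have "t\<^sup>2 < ?h\<^sup>2" using t jd by (intro power_strict_mono) auto
    ultimately have "t powr (?h - 1) * ((?h\<^sup>2 - t\<^sup>2) * ?f1) > 0" using t by simp
    with D show "\<exists>y. ((\<lambda>t. t powr ?h * Z t) has_real_derivative y) (at t) \<and> 0 < y" by blast
  next
    show "continuous_on {0..j} (\<lambda>t. t powr ?h * Z t)"
      unfolding Z_def using assms nn by (intro continuous_intros continuous_on_powr') auto
  qed
  then have "Z j > 0" using j assms by (simp add: zero_less_mult_iff)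
  moreover have "bessel_entire ?h (j\<^sup>2) > 0" using bessel_entire_upper_pos[OF assms, of j] j by (simp add: j_def)
  ultimately show False using j assms by (simp add: Z_def mult_less_0_iff)
qed

section \<open>Integrals of radial functions\<close>

text \<open>
  Polar coordinates for functions of the norm alone: both measures give \<open>{..a}\<close> the volume of a ball.
\<close>
lemma radial_measure:
  fixes \<rho> :: real
  assumes "\<rho> \<ge> 0"
  shows "distr (density lborel (indicator (cball (0::'a::euclidean_space) \<rho>))) borel norm =
     density lborel (\<lambda>r. ennreal (indicator {0..\<rho>} r * (DIM('a) * unit_ball_vol DIM('a) * r ^ (DIM('a) - 1))))"
    (is "?M = ?N")
proof -
  let ?c = "unit_ball_vol DIM('a)" and ?d = "DIM('a)"
  have [measurable]: "cball (0::'a) r \<in> sets borel" for r by simp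
  have cb: "emeasure lborel (cball (0::'a) r) = ennreal (r ^ ?d * ?c)" if "r \<ge> 0" for r
    using emeasure_cball[OF that, of "0::'a"] by (simp add: mult.commute)
  have M: "emeasure ?M {..a} = emeasure lborel (cball (0::'a) \<rho> \<inter> cball 0 a)" for a
  proof -
    have "emeasure ?M {..a} = emeasure (density lborel (indicator (cball (0::'a) \<rho>))) (cball 0 a)"
      by (subst emeasure_distr) (auto simp: vimage_def cball_def intro!: arg_cong2[where f = emeasure])
    also have "\<dots> = emeasure lborel (cball (0::'a) \<rho> \<inter> cball 0 a)"
      by (subst emeasure_density) (auto simp: indicator_inter_arith[symmetric] simp flip: nn_integral_indicator intro!: nn_integral_cong)
    finally show ?thesis .
  qed
  have N: "emeasure ?N {..a} = ennreal (min a \<rho> ^ ?d * ?c)" if "a \<ge> 0" for a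
  proof -
    have "emeasure ?N {..a} = (\<integral>\<^sup>+r. ennreal (?d * ?c * r ^ (?d - 1)) * indicator {0..min a \<rho>} r \<partial>lborel)"
      by (subst emeasure_density) (auto intro!: nn_integral_cong simp: indicator_def)
    also have "\<dots> = ennreal (min a \<rho> ^ ?d * ?c - 0 ^ ?d * ?c)"
      by (rule nn_integral_FTC_Icc) (use that assms in \<open>auto intro!: derivative_eq_intros\<close>)
    finally show ?thesis by (simp add: zero_power)
  qed
  have N0: "emeasure ?N {..a} = 0" if "a < 0" for a
  proof -
    have "emeasure ?N {..a} = (\<integral>\<^sup>+r. ennreal (indicator {0..\<rho>} r * (?d * ?c * r ^ (?d - 1))) * indicator {..a} r \<partial>lborel)"
      by (rule emeasure_density) auto
    also have "\<dots> = (\<integral>\<^sup>+r. 0 \<partial>(lborel :: real measure))"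
      using that by (intro nn_integral_cong) (auto simp: indicator_def)
    finally show ?thesis by simp
  qed
  have eq: "emeasure ?M {..a} = emeasure ?N {..a}" for a
  proof (cases "a < 0")
    case True
    then show ?thesis unfolding M N0[OF True] by simp
  next
    case False
    then have "cball (0::'a) \<rho> \<inter> cball 0 a = cball 0 (min a \<rho>)" by auto
    moreover have "emeasure lborel (cball (0::'a) (min a \<rho>)) = ennreal (min a \<rho> ^ ?d * ?c)"
      using False assms by (intro cb) simp
    ultimately show ?thesis using N[of a] False unfolding M by simp
  qed
  show ?thesis
  proof (rule measure_eqI_generator_eq[where \<Omega> = UNIV and E = "range (\<lambda>a::real. {..a})" and A = "\<lambda>i. {..real i}"])
    show "Int_stable (range (\<lambda>a::real. {..a}))" 
    proof (rule Int_stableI)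
      fix A B assume "A \<in> range (\<lambda>a::real. {..a})" "B \<in> range (\<lambda>a::real. {..a})"
      then obtain a b :: real where "A = {..a}" "B = {..b}" by blast
      then have "A \<inter> B = {..min a b}" by auto
      then show "A \<inter> B \<in> range (\<lambda>a::real. {..a})" by blast
    qed
    show "sets ?M = sigma_sets UNIV (range (\<lambda>a::real. {..a}))"
      by (simp add: borel_eq_atMost)
    show "sets ?N = sigma_sets UNIV (range (\<lambda>a::real. {..a}))"
      by (simp add: borel_eq_atMost)
    show "(\<Union>i. {..real i}) = UNIV"
    proof -
      have "\<exists>i. x \<le> real i" for x using real_arch_simple by blast
      then show ?thesis by auto
    qed
    show "emeasure ?M {..real i} \<noteq> \<infinity>" for i unfolding eq N[OF of_nat_0_le_iff] by simp
  qed (use eq in auto)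
qed

text \<open>
  The one-dimensional integral is stated through a primitive, because every radial integrand below comes with an
  explicit one.
\<close>
lemma radial_integral_FTC:
  fixes f H :: "real \<Rightarrow> real"
  assumes "\<rho> \<ge> 0" and cont: "continuous_on {0..\<rho>} f"
    and H: "\<And>r. 0 \<le> r \<Longrightarrow> r \<le> \<rho> \<Longrightarrow> (H has_real_derivative r ^ (DIM('a) - 1) * f r) (at r within {0..\<rho>})"
  shows "(LINT x|lborel. indicator (cball (0::'a::euclidean_space) \<rho>) x * f (norm x)) =
     DIM('a) * unit_ball_vol DIM('a) * (H \<rho> - H 0)"
proof -
  let ?c = "unit_ball_vol DIM('a)" and ?d = "DIM('a)"
  have [measurable]: "cball (0::'a) \<rho> \<in> sets borel" by simp
  define g where "g r = indicator {0..\<rho>} r * f r" for r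
  have gm [measurable]: "g \<in> borel_measurable borel"
    unfolding g_def using borel_measurable_continuous_on_indicator[OF _ cont] by simp
  have "(LINT x|lborel. indicator (cball (0::'a) \<rho>) x * f (norm x)) =
        (LINT x|lborel. indicator (cball (0::'a) \<rho>) x *\<^sub>R g (norm x))"
    by (intro Bochner_Integration.integral_cong) (auto simp: g_def indicator_def)
  also have "\<dots> = (LINT x|density lborel (\<lambda>x. ennreal (indicator (cball (0::'a) \<rho>) x)). g (norm x))"
    by (subst integral_density) (auto intro!: borel_measurable_indicator)
  also have "\<dots> = (LINT r|distr (density lborel (indicator (cball (0::'a) \<rho>))) borel norm. g r)"
    by (subst integral_distr) (auto simp: ennreal_indicator)
  also have "\<dots> = (LINT r|lborel. (indicator {0..\<rho>} r * (?d * ?c * r ^ (?d - 1))) *\<^sub>R g r)"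
    unfolding radial_measure[OF assms(1)] by (subst integral_density) (auto simp: indicator_def)
  also have "\<dots> = (LINT r|lborel. (?d * ?c) * (indicator {0..\<rho>} r *\<^sub>R (r ^ (?d - 1) * f r)))"
    by (intro Bochner_Integration.integral_cong) (auto simp: g_def indicator_def)
  also have "\<dots> = (?d * ?c) * (LINT r|lborel. indicator {0..\<rho>} r *\<^sub>R (r ^ (?d - 1) * f r))"
    by simp
  also have "(LINT r|lborel. indicator {0..\<rho>} r *\<^sub>R (r ^ (?d - 1) * f r)) = H \<rho> - H 0"
    by (rule integral_FTC_atLeastAtMost)
       (use assms in \<open>auto intro!: continuous_intros H simp: has_real_derivative_iff_has_vector_derivative[symmetric]\<close>)
  finally show ?thesis .
qed

section \<open>The unit cell as a fundamental domain\<close>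

definition unit_cell :: "(real ^ 'n) set" where
  "unit_cell = {x. \<forall>i. - 1 / 2 \<le> x $ i \<and> x $ i < 1 / 2}"

text \<open>
  The probability measure of the torus, as a measure on the whole space concentrated on one fundamental domain, so
  that periodic functions are integrated without passing to a quotient.
\<close>
definition cell_measure :: "(real ^ 'n) measure" where
  "cell_measure = density lborel (indicator unit_cell)"

definition nearest_int :: "real ^ 'n \<Rightarrow> real ^ 'n" where
  "nearest_int x = (\<chi> i. of_int \<lfloor>x $ i + 1 / 2\<rfloor>)"

definition periodic :: "(real ^ 'n \<Rightarrow> 'a) \<Rightarrow> bool" where
  "periodic f \<longleftrightarrow> (\<forall>x. \<forall>n\<in>integer_points. f (x + n) = f x)"

lemma integer_points_closed [simp]:
  "0 \<in> integer_points"
  "m \<in> integer_points \<Longrightarrow> n \<in> integer_points \<Longrightarrow> m + n \<in> integer_points"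
  "m \<in> integer_points \<Longrightarrow> n \<in> integer_points \<Longrightarrow> m - n \<in> integer_points"
  "m \<in> integer_points \<Longrightarrow> - m \<in> integer_points"
  "axis i 1 \<in> integer_points"
  by (auto simp: integer_points_def axis_def)

lemma nearest_int_integer [simp]: "nearest_int x \<in> integer_points"
  by (simp add: nearest_int_def integer_points_def)

lemma unit_cell_unique:
  assumes "n \<in> integer_points"
  shows "x - n \<in> unit_cell \<longleftrightarrow> n = nearest_int x"
proof -
  have "- 1 / 2 \<le> x $ i - n $ i \<and> x $ i - n $ i < 1 / 2 \<longleftrightarrow> n $ i = of_int \<lfloor>x $ i + 1 / 2\<rfloor>" for i
  proof -
    obtain k :: int where k: "n $ i = of_int k" using assms by (auto simp: integer_points_def Ints_def)
    show ?thesis unfolding k of_int_eq_iff by linarith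
  qed
  then show ?thesis by (simp add: unit_cell_def nearest_int_def vec_eq_iff)
qed

lemma nearest_int_in_cell: "x - nearest_int x \<in> unit_cell"
  by (simp add: unit_cell_unique)

lemma countable_integer_points: "countable (integer_points :: (real ^ 'n) set)"
proof -
  have "integer_points \<subseteq> range (\<lambda>f :: 'n \<Rightarrow> int. \<chi> i. real_of_int (f i))"
  proof
    fix x :: "real ^ 'n" assume "x \<in> integer_points"
    then have "x = (\<chi> i. real_of_int \<lfloor>x $ i\<rfloor>)" by (auto simp: integer_points_def vec_eq_iff Ints_def)
    then show "x \<in> range (\<lambda>f :: 'n \<Rightarrow> int. \<chi> i. real_of_int (f i))" by (intro image_eqI[of _ _ "\<lambda>i. \<lfloor>x $ i\<rfloor>"]) auto
  qed
  moreover have "countable (UNIV :: ('n \<Rightarrow> int) set)"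
    using countable_PiE[of "UNIV :: 'n set" "\<lambda>_. UNIV :: int set"] by (simp add: PiE_UNIV_domain)
  ultimately show ?thesis by (meson countable_image countable_subset)
qed

lemma unit_cell_measurable [measurable]: "unit_cell \<in> sets borel"
  unfolding unit_cell_def by measurable

lemma emeasure_unit_cell: "emeasure lborel (unit_cell :: (real ^ 'n) set) = 1"
proof -
  let ?a = "(\<chi> i. - 1 / 2) :: real ^ 'n" and ?b = "(\<chi> i. 1 / 2) :: real ^ 'n"
  have p: "(\<Prod>b\<in>Basis. (?b - ?a) \<bullet> b) = 1"
  proof -
    have "(?b - ?a) \<bullet> b = 1" if "b \<in> Basis" for b :: "real ^ 'n"
      using that by (auto simp: Basis_vec_def inner_axis)
    then show ?thesis by simp
  qed
  have le: "?a \<bullet> b \<le> ?b \<bullet> b" if "b \<in> Basis" for b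
    using that by (auto simp: Basis_vec_def inner_axis)
  have "box ?a ?b \<subseteq> unit_cell" "unit_cell \<subseteq> cbox ?a ?b"
    by (auto simp: unit_cell_def mem_box_cart less_imp_le)
  then have "emeasure lborel (box ?a ?b) \<le> emeasure lborel (unit_cell :: (real ^ 'n) set)"
    "emeasure lborel (unit_cell :: (real ^ 'n) set) \<le> emeasure lborel (cbox ?a ?b)"
    by (auto intro!: emeasure_mono)
  moreover have "emeasure lborel (box ?a ?b) = 1" "emeasure lborel (cbox ?a ?b) = 1"
    using le p by (subst emeasure_lborel_box emeasure_lborel_cbox; simp)+
  ultimately show ?thesis by simp
qed

lemma sets_cell_measure [simp, measurable_cong]: "sets cell_measure = sets borel"
  by (simp add: cell_measure_def)

lemma space_cell_measure [simp]: "space cell_measure = UNIV"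
  by (simp add: cell_measure_def)

lemma emeasure_cell_measure_UNIV: "emeasure (cell_measure :: (real ^ 'n) measure) UNIV = 1"
  by (simp add: cell_measure_def emeasure_density emeasure_unit_cell)

lemma finite_cell_measure: "finite_measure (cell_measure :: (real ^ 'n) measure)"
  by (rule finite_measureI) (simp add: emeasure_cell_measure_UNIV)

lemma nn_integral_cell_measure:
  "f \<in> borel_measurable borel \<Longrightarrow> (\<integral>\<^sup>+x. f x \<partial>cell_measure) = (\<integral>\<^sup>+x. indicator unit_cell x * f x \<partial>lborel)"
  by (simp add: cell_measure_def nn_integral_density)

lemma nn_integral_translate:
  fixes f :: "real ^ 'n \<Rightarrow> ennreal"
  assumes [measurable]: "f \<in> borel_measurable borel"
  shows "(\<integral>\<^sup>+x. f (a + x) \<partial>lborel) = (\<integral>\<^sup>+x. f x \<partial>lborel)"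
  by (subst lborel_distr_plus[of a, symmetric]) (simp add: nn_integral_distr)

text \<open>
  The translates of the half-open unit cell by integer points partition the space.
\<close>
lemma nn_integral_tile:
  fixes g :: "real ^ 'n \<Rightarrow> ennreal"
  assumes g [measurable]: "g \<in> borel_measurable borel"
  shows "(\<integral>\<^sup>+x. g x \<partial>lborel) = (\<integral>\<^sup>+x. (\<integral>\<^sup>+n. g (x + n) \<partial>count_space integer_points) \<partial>cell_measure)"
proof -
  have "(\<integral>\<^sup>+x. (\<integral>\<^sup>+n. g (x + n) \<partial>count_space integer_points) \<partial>cell_measure)
     = (\<integral>\<^sup>+n. (\<integral>\<^sup>+x. g (x + n) \<partial>cell_measure) \<partial>count_space integer_points)"
    by (rule nn_integral_count_space_nn_integral[OF countable_integer_points]) measurable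
  also have "\<dots> = (\<integral>\<^sup>+n. (\<integral>\<^sup>+x. indicator unit_cell (x - n) * g x \<partial>lborel) \<partial>count_space integer_points)"
  proof (intro nn_integral_cong)
    fix n :: "real ^ 'n"
    have "(\<integral>\<^sup>+x. g (x + n) \<partial>cell_measure) = (\<integral>\<^sup>+x. indicator unit_cell (n + x - n) * g (n + x) \<partial>lborel)"
      by (subst nn_integral_cell_measure) (auto simp: add.commute)
    also have "\<dots> = (\<integral>\<^sup>+x. indicator unit_cell (x - n) * g x \<partial>lborel)"
      by (rule nn_integral_translate[where f = "\<lambda>x. indicator unit_cell (x - n) * g x"]) measurable
    finally show "(\<integral>\<^sup>+x. g (x + n) \<partial>cell_measure) = (\<integral>\<^sup>+x. indicator unit_cell (x - n) * g x \<partial>lborel)" .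
  qed
  also have "\<dots> = (\<integral>\<^sup>+x. (\<integral>\<^sup>+n. indicator unit_cell (x - n) * g x \<partial>count_space integer_points) \<partial>lborel)"
    by (rule nn_integral_count_space_nn_integral[OF countable_integer_points, symmetric]) measurable
  also have "\<dots> = (\<integral>\<^sup>+x. g x \<partial>lborel)"
  proof (intro nn_integral_cong)
    fix x :: "real ^ 'n"
    have "(\<integral>\<^sup>+n. indicator unit_cell (x - n) * g x \<partial>count_space integer_points)
      = (\<integral>\<^sup>+n. g x * indicator {nearest_int x} n \<partial>count_space integer_points)"
      by (intro nn_integral_cong) (auto simp: indicator_def unit_cell_unique)
    also have "\<dots> = g x"
      by (subst nn_integral_cmult_indicator) auto
    finally show "(\<integral>\<^sup>+n. indicator unit_cell (x - n) * g x \<partial>count_space integer_points) = g x" .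
  qed
  finally show ?thesis ..
qed

text \<open>
  A translated cell is cut into pieces of lattice translates of the original cell; a periodic function does not see
  these translations.
\<close>
lemma nn_integral_periodic_shift:
  fixes f :: "real ^ 'n \<Rightarrow> ennreal"
  assumes [measurable]: "f \<in> borel_measurable borel" and p: "periodic f"
  shows "(\<integral>\<^sup>+x. f (x + s) \<partial>cell_measure) = (\<integral>\<^sup>+x. f x \<partial>cell_measure)"
proof -
  have "(\<integral>\<^sup>+x. f (x + s) \<partial>cell_measure) = (\<integral>\<^sup>+x. indicator unit_cell (s + x - s) * f (s + x) \<partial>lborel)"
    by (subst nn_integral_cell_measure) (auto simp: add.commute)
  also have "\<dots> = (\<integral>\<^sup>+x. indicator unit_cell (x - s) * f x \<partial>lborel)"
    by (rule nn_integral_translate[where f = "\<lambda>x. indicator unit_cell (x - s) * f x"]) measurable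
  also have "\<dots> = (\<integral>\<^sup>+x. (\<integral>\<^sup>+n. indicator unit_cell (x + n - s) * f (x + n) \<partial>count_space integer_points) \<partial>cell_measure)"
    by (rule nn_integral_tile) measurable
  also have "\<dots> = (\<integral>\<^sup>+x. f x \<partial>cell_measure)"
  proof (intro nn_integral_cong)
    fix x :: "real ^ 'n"
    have "indicator unit_cell (x + n - s) * f (x + n) = f x * indicator {- nearest_int (x - s)} n" if "n \<in> integer_points" for n
    proof -
      have "x + n - s \<in> unit_cell \<longleftrightarrow> - n = nearest_int (x - s)"
        using unit_cell_unique[of "- n" "x - s"] that by (simp add: algebra_simps)
      moreover have "- n = nearest_int (x - s) \<longleftrightarrow> n = - nearest_int (x - s)" by (metis minus_minus)
      ultimately show ?thesis using p that by (simp add: periodic_def indicator_def)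
    qed
    then have "(\<integral>\<^sup>+n. indicator unit_cell (x + n - s) * f (x + n) \<partial>count_space integer_points)
      = (\<integral>\<^sup>+n. f x * indicator {- nearest_int (x - s)} n \<partial>count_space integer_points)"
      by (intro nn_integral_cong) auto
    also have "\<dots> = f x"
      by (subst nn_integral_cmult_indicator) auto
    finally show "(\<integral>\<^sup>+n. indicator unit_cell (x + n - s) * f (x + n) \<partial>count_space integer_points) = f x" .
  qed
  finally show ?thesis .
qed

lemma cell_integrable_bounded:
  fixes f :: "real ^ 'n \<Rightarrow> 'b::{banach, second_countable_topology}"
  assumes "f \<in> borel_measurable borel" "\<And>x. norm (f x) \<le> B"
  shows "integrable cell_measure f"
  using assms by (intro finite_measure.integrable_const_bound[OF finite_cell_measure, of _ B]) auto

lemma integral_periodic_shift_real: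
  fixes f :: "real ^ 'n \<Rightarrow> real"
  assumes [measurable]: "f \<in> borel_measurable borel" and p: "periodic f" and B: "\<And>x. \<bar>f x\<bar> \<le> B"
  shows "(LINT x|cell_measure. f (x + s)) = (LINT x|cell_measure. f x)"
proof -
  have "integrable cell_measure f" "integrable cell_measure (\<lambda>x. f (x + s))"
    using B by (auto intro!: cell_integrable_bounded[of _ B])
  moreover have "(\<integral>\<^sup>+x. ennreal (f (x + s)) \<partial>cell_measure) = (\<integral>\<^sup>+x. ennreal (f x) \<partial>cell_measure)"
    using p by (intro nn_integral_periodic_shift) (auto simp: periodic_def)
  moreover have "(\<integral>\<^sup>+x. ennreal (- f (x + s)) \<partial>cell_measure) = (\<integral>\<^sup>+x. ennreal (- f x) \<partial>cell_measure)"
    using p by (intro nn_integral_periodic_shift[of "\<lambda>x. ennreal (- f x)"]) (auto simp: periodic_def)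
  ultimately show ?thesis by (simp add: real_lebesgue_integral_def)
qed

lemma integral_periodic_shift:
  fixes f :: "real ^ 'n \<Rightarrow> complex"
  assumes [measurable]: "f \<in> borel_measurable borel" and p: "periodic f" and B: "\<And>x. norm (f x) \<le> B"
  shows "(LINT x|cell_measure. f (x + s)) = (LINT x|cell_measure. f x)"
proof -
  have i: "integrable cell_measure f" "integrable cell_measure (\<lambda>x. f (x + s))"
    using B by (auto intro!: cell_integrable_bounded[of _ B])
  have "(LINT x|cell_measure. Re (f (x + s))) = (LINT x|cell_measure. Re (f x))"
    by (rule integral_periodic_shift_real[of _ B])
       (use p B in \<open>auto simp: periodic_def intro: order.trans[OF abs_Re_le_cmod]\<close>)
  moreover have "(LINT x|cell_measure. Im (f (x + s))) = (LINT x|cell_measure. Im (f x))"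
    by (rule integral_periodic_shift_real[of _ B])
       (use p B in \<open>auto simp: periodic_def intro: order.trans[OF abs_Im_le_cmod]\<close>)
  ultimately show ?thesis using i by (simp add: complex_eq_iff)
qed

section \<open>Fourier series in several variables\<close>

definition wave :: "real ^ 'n \<Rightarrow> real ^ 'n \<Rightarrow> complex" where
  "wave n x = cis (2 * pi * (n \<bullet> x))"

lemma wave_simps [simp]:
  "norm (wave n x) = 1" "wave 0 x = 1" "wave n 0 = 1" "wave n x \<noteq> 0"
  by (simp_all add: wave_def)

lemma wave_add: "wave n (x + y) = wave n x * wave n y"
  by (simp add: wave_def inner_add_right cis_mult distrib_left)

lemma wave_add_freq: "wave (m + n) x = wave m x * wave n x"
  by (simp add: wave_def inner_add_left cis_mult distrib_left)

lemma wave_minus: "wave n (- x) = cnj (wave n x)" "wave (- n) x = cnj (wave n x)"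
  by (simp_all add: wave_def cis_cnj)

lemma wave_diff: "wave n (x - y) = wave n x * cnj (wave n y)"
  using wave_add[of n x "- y"] by (simp add: wave_minus)

lemma wave_diff_freq: "wave (m - n) x = wave m x * cnj (wave n x)"
  using wave_add_freq[of m "- n" x] by (simp add: wave_minus)

lemma wave_integer:
  assumes "m \<in> integer_points" "n \<in> integer_points"
  shows "wave m n = 1"
proof -
  have "m \<bullet> n \<in> \<int>"
    using assms by (auto simp: inner_vec_def integer_points_def intro!: Ints_sum Ints_mult)
  then obtain k :: int where "m \<bullet> n = of_int k" by (auto simp: Ints_def)
  then show ?thesis by (simp add: wave_def cis_multiple_2pi)
qed

lemma periodic_wave: "n \<in> integer_points \<Longrightarrow> periodic (wave n)"
  by (simp add: periodic_def wave_add wave_integer)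

lemma continuous_on_wave [continuous_intros]:
  "continuous_on A f \<Longrightarrow> continuous_on A (\<lambda>x. wave n (f x))"
  unfolding wave_def by (intro continuous_intros)

lemma borel_measurable_wave [measurable]: "wave n \<in> borel_measurable borel"
  by (intro borel_measurable_continuous_onI continuous_intros)

text \<open>
  Translating by half a period in a direction where \<open>n\<close> does not vanish changes the sign of the integrand, but not
  the integral.
\<close>
lemma integral_wave:
  fixes n :: "real ^ 'n"
  assumes "n \<in> integer_points"
  shows "(LINT x|cell_measure. wave n x) = (if n = 0 then 1 else 0)"
proof (cases "n = 0")
  case True
  then show ?thesis by (simp add: measure_def emeasure_cell_measure_UNIV)
next
  case False
  then obtain i where i: "n $ i \<noteq> 0" by (auto simp: vec_eq_iff)
  define s :: "real ^ 'n" where "s = axis i (1 / (2 * n $ i))"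
  have "wave n s = - 1"
    using i by (simp add: wave_def s_def inner_axis)
  then have "(LINT x|cell_measure. wave n (x + s)) = - (LINT x|cell_measure. wave n x)"
    by (simp add: wave_add)
  moreover have "(LINT x|cell_measure. wave n (x + s)) = (LINT x|cell_measure. wave n x)"
    by (rule integral_periodic_shift[of _ 1]) (simp_all add: periodic_wave assms)
  ultimately have "(LINT x|cell_measure. wave n x) = - (LINT x|cell_measure. wave n x)" by simp
  then have "(LINT x|cell_measure. wave n x) = 0" by (simp add: equal_neg_zero)
  with False show ?thesis by simp
qed

lemma borel_measurable_cnj [measurable]: "cnj \<in> borel_measurable borel"
  by (intro borel_measurable_continuous_onI continuous_intros continuous_on_id)

definition trig_sum :: "(real ^ 'n) set \<Rightarrow> (real ^ 'n \<Rightarrow> complex) \<Rightarrow> real ^ 'n \<Rightarrow> complex" where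
  "trig_sum K a x = (\<Sum>n\<in>K. a n * wave n x)"

definition fourier_coeff :: "(real ^ 'n \<Rightarrow> complex) \<Rightarrow> real ^ 'n \<Rightarrow> complex" where
  "fourier_coeff f n = (LINT x|cell_measure. f x * cnj (wave n x))"

lemma continuous_on_trig_sum [continuous_intros]: "continuous_on A (trig_sum K a)"
  unfolding trig_sum_def by (intro continuous_intros continuous_on_id)

lemma borel_measurable_trig_sum [measurable]: "trig_sum K a \<in> borel_measurable borel"
  by (intro borel_measurable_continuous_onI continuous_intros)

lemma norm_trig_sum: "norm (trig_sum K a x) \<le> (\<Sum>n\<in>K. norm (a n))"
  unfolding trig_sum_def by (rule order.trans[OF norm_sum]) (simp add: norm_mult)

lemma fourier_coeff_trig_sum:
  assumes "finite K" "K \<subseteq> integer_points" "n \<in> integer_points"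
  shows "fourier_coeff (trig_sum K a) n = (if n \<in> K then a n else 0)"
proof -
  have "fourier_coeff (trig_sum K a) n = (LINT x|cell_measure. (\<Sum>m\<in>K. a m * wave (m - n) x))"
    unfolding fourier_coeff_def trig_sum_def by (simp add: sum_distrib_right wave_diff_freq mult.assoc)
  also have "\<dots> = (\<Sum>m\<in>K. (LINT x|cell_measure. a m * wave (m - n) x))"
    by (intro Bochner_Integration.integral_sum cell_integrable_bounded[of _ "norm (a m)" for m])
       (auto simp: norm_mult)
  also have "\<dots> = (\<Sum>m\<in>K. if m = n then a m else 0)"
    using assms by (intro sum.cong) (auto simp: integral_wave subset_iff)
  finally show ?thesis using assms by simp
qed

lemma integral_mult_cnj_trig_sum:
  fixes f :: "real ^ 'n \<Rightarrow> complex"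
  assumes [measurable]: "f \<in> borel_measurable borel" and B: "\<And>x. norm (f x) \<le> B" and "finite K"
  shows "(LINT x|cell_measure. f x * cnj (trig_sum K a x)) = (\<Sum>n\<in>K. cnj (a n) * fourier_coeff f n)"
proof -
  have "(LINT x|cell_measure. f x * cnj (trig_sum K a x))
    = (LINT x|cell_measure. (\<Sum>n\<in>K. cnj (a n) * (f x * cnj (wave n x))))"
    by (intro Bochner_Integration.integral_cong) (auto simp: trig_sum_def sum_distrib_left mult_ac)
  also have "\<dots> = (\<Sum>n\<in>K. (LINT x|cell_measure. cnj (a n) * (f x * cnj (wave n x))))"
    using B by (intro Bochner_Integration.integral_sum cell_integrable_bounded[of _ "norm (a n) * B" for n])
       (auto simp: norm_mult intro!: mult_left_mono)
  also have "\<dots> = (\<Sum>n\<in>K. cnj (a n) * fourier_coeff f n)"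
    by (simp add: fourier_coeff_def)
  finally show ?thesis .
qed

lemma trig_parseval:
  fixes a :: "real ^ 'n \<Rightarrow> complex"
  assumes "finite K" "K \<subseteq> integer_points"
  shows "(LINT x|cell_measure. (norm (trig_sum K a x))\<^sup>2) = (\<Sum>n\<in>K. (norm (a n))\<^sup>2)"
proof -
  have "complex_of_real (LINT x|cell_measure. (norm (trig_sum K a x))\<^sup>2)
     = (LINT x|cell_measure. trig_sum K a x * cnj (trig_sum K a x))"
    by (simp only: complex_norm_square flip: integral_complex_of_real)
  also have "\<dots> = (\<Sum>n\<in>K. cnj (a n) * fourier_coeff (trig_sum K a) n)"
    by (rule integral_mult_cnj_trig_sum[OF _ norm_trig_sum assms(1)]) measurable
  also have "\<dots> = (\<Sum>n\<in>K. cnj (a n) * a n)"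
    using assms by (intro sum.cong) (auto simp: fourier_coeff_trig_sum subset_iff)
  also have "\<dots> = complex_of_real (\<Sum>n\<in>K. (norm (a n))\<^sup>2)"
    by (simp add: complex_norm_square mult.commute flip: of_real_power)
  finally show ?thesis by (simp only: of_real_eq_iff)
qed

text \<open>
  This single identity contains the Bessel inequality (take \<open>a\<close> to be the Fourier coefficients) and the optimality
  of the Fourier partial sums among all trigonometric sums with the same frequencies.
\<close>
lemma trig_approx_error:
  fixes f :: "real ^ 'n \<Rightarrow> complex"
  assumes [measurable]: "f \<in> borel_measurable borel" and B: "\<And>x. norm (f x) \<le> B"
    and K: "finite K" "K \<subseteq> integer_points"
  shows "(LINT x|cell_measure. (norm (f x - trig_sum K a x))\<^sup>2)
    = (LINT x|cell_measure. (norm (f x))\<^sup>2) - (\<Sum>n\<in>K. (norm (fourier_coeff f n))\<^sup>2)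
      + (\<Sum>n\<in>K. (norm (a n - fourier_coeff f n))\<^sup>2)"
proof -
  let ?T = "trig_sum K a" and ?A = "\<Sum>n\<in>K. norm (a n)"
  have B0: "B \<ge> 0" using B[of 0] norm_ge_zero order_trans by blast
  have i1: "integrable cell_measure (\<lambda>x. (norm (f x))\<^sup>2)"
    using B by (intro cell_integrable_bounded[of _ "B\<^sup>2"]) (auto intro!: power_mono)
  have i2: "integrable cell_measure (\<lambda>x. f x * cnj (?T x))"
    using B norm_trig_sum[of K a] B0
    by (intro cell_integrable_bounded[of _ "B * ?A"]) (auto simp: norm_mult intro!: mult_mono sum_nonneg)
  have i3: "integrable cell_measure (\<lambda>x. (norm (?T x))\<^sup>2)"
    using norm_trig_sum[of K a] by (intro cell_integrable_bounded[of _ "?A\<^sup>2"]) (auto intro!: power_mono)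
  have pt: "(norm (z - w))\<^sup>2 = (norm z)\<^sup>2 - 2 * Re (z * cnj w) + (norm w)\<^sup>2" for z w :: complex
    by (simp add: cmod_power2 power2_diff algebra_simps)
  have "(LINT x|cell_measure. (norm (f x - ?T x))\<^sup>2)
    = (LINT x|cell_measure. (norm (f x))\<^sup>2 - 2 * Re (f x * cnj (?T x)) + (norm (?T x))\<^sup>2)"
    by (simp only: pt)
  also have "\<dots> = (LINT x|cell_measure. (norm (f x))\<^sup>2) - 2 * Re (LINT x|cell_measure. f x * cnj (?T x))
      + (LINT x|cell_measure. (norm (?T x))\<^sup>2)"
  proof -
    define r where "r x = Re (f x * cnj (?T x))" for x
    have "integrable cell_measure r" "(LINT x|cell_measure. r x) = Re (LINT x|cell_measure. f x * cnj (?T x))"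
      unfolding r_def using integrable_Re[OF i2] integral_Re[OF i2] by auto
    then show ?thesis unfolding r_def[symmetric] using i1 i3 by simp
  qed
  also have "\<dots> = (LINT x|cell_measure. (norm (f x))\<^sup>2)
      - 2 * Re (\<Sum>n\<in>K. cnj (a n) * fourier_coeff f n) + (\<Sum>n\<in>K. (norm (a n))\<^sup>2)"
    using integral_mult_cnj_trig_sum[OF assms(1) B K(1), of a] trig_parseval[OF K, of a] by simp
  also have "\<dots> = (LINT x|cell_measure. (norm (f x))\<^sup>2) - (\<Sum>n\<in>K. (norm (fourier_coeff f n))\<^sup>2)
      + (\<Sum>n\<in>K. (norm (a n - fourier_coeff f n))\<^sup>2)"
  proof -
    have "(norm (a n - fourier_coeff f n))\<^sup>2 =
      (norm (a n))\<^sup>2 - 2 * Re (cnj (a n) * fourier_coeff f n) + (norm (fourier_coeff f n))\<^sup>2" for n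
      unfolding pt by simp
    then have "(\<Sum>n\<in>K. (norm (a n - fourier_coeff f n))\<^sup>2) =
      (\<Sum>n\<in>K. (norm (a n))\<^sup>2) - 2 * (\<Sum>n\<in>K. Re (cnj (a n) * fourier_coeff f n)) + (\<Sum>n\<in>K. (norm (fourier_coeff f n))\<^sup>2)"
      by (simp only: sum.distrib sum_subtractf sum_distrib_left)
    then show ?thesis by simp
  qed
  finally show ?thesis .
qed

lemma bessel_inequality:
  fixes f :: "real ^ 'n \<Rightarrow> complex"
  assumes "f \<in> borel_measurable borel" "\<And>x. norm (f x) \<le> B" "finite K" "K \<subseteq> integer_points"
  shows "(\<Sum>n\<in>K. (norm (fourier_coeff f n))\<^sup>2) \<le> (LINT x|cell_measure. (norm (f x))\<^sup>2)"
proof -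
  have "0 \<le> (LINT x|cell_measure. (norm (f x - trig_sum K (fourier_coeff f) x))\<^sup>2)"
    by (rule integral_nonneg_AE) simp
  then show ?thesis by (subst (asm) trig_approx_error[OF assms]) simp
qed

lemma fourier_coeff_shift:
  fixes f :: "real ^ 'n \<Rightarrow> complex"
  assumes [measurable]: "f \<in> borel_measurable borel" and B: "\<And>x. norm (f x) \<le> B" and p: "periodic f"
    and n: "n \<in> integer_points"
  shows "fourier_coeff (\<lambda>x. f (x + s)) n = wave n s * fourier_coeff f n"
proof -
  have "fourier_coeff (\<lambda>x. f (x + s)) n = (LINT x|cell_measure. wave n s * (f (x + s) * cnj (wave n (x + s))))"
  proof -
    have "wave n s * cnj (wave n s) = 1" by (simp flip: complex_norm_square)
    then have "f (x + s) * cnj (wave n x) = wave n s * (f (x + s) * cnj (wave n (x + s)))" for x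
      by (simp add: wave_add mult_ac)
    then show ?thesis unfolding fourier_coeff_def by (intro Bochner_Integration.integral_cong refl)
  qed
  also have "\<dots> = wave n s * (LINT x|cell_measure. f (x + s) * cnj (wave n (x + s)))" by simp
  also have "(LINT x|cell_measure. f (x + s) * cnj (wave n (x + s))) = fourier_coeff f n"
    unfolding fourier_coeff_def
    by (rule integral_periodic_shift[of "\<lambda>x. f x * cnj (wave n x)" B])
       (use p n B periodic_wave[OF n] in \<open>auto simp: periodic_def norm_mult\<close>)
  finally show ?thesis .
qed

text \<open>
  Convolution of coefficients is multiplication of trigonometric sums, so its norm is controlled by the supremum
  of one factor. Restricting the sum on the left to \<open>T\<close> only decreases it.
\<close>
lemma trig_convolution_bound:
  fixes c A :: "real ^ 'n \<Rightarrow> complex"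
  assumes K: "finite K" "K \<subseteq> integer_points" and S: "finite S" "S \<subseteq> integer_points"
    and A: "\<And>n. n \<notin> S \<Longrightarrow> A n = 0" and M: "\<And>x. norm (trig_sum K c x) \<le> M"
    and T: "finite T" "T \<subseteq> integer_points"
  shows "(\<Sum>w\<in>T. (norm (\<Sum>a\<in>K. c a * A (w - a)))\<^sup>2) \<le> M\<^sup>2 * (\<Sum>n\<in>S. (norm (A n))\<^sup>2)"
proof -
  define b where "b w = (\<Sum>a\<in>K. c a * A (w - a))" for w
  define U where "U = T \<union> (\<lambda>(a, n). a + n) ` (K \<times> S)"
  have U: "finite U" "U \<subseteq> integer_points" using K S T by (auto simp: U_def subset_iff)
  have M0: "M \<ge> 0" using M[of 0] norm_ge_zero order_trans by blast
  have prod: "trig_sum U b x = trig_sum K c x * trig_sum S A x" for x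
  proof -
    have shift: "trig_sum S A x * wave a x = (\<Sum>w\<in>U. A (w - a) * wave w x)" if a: "a \<in> K" for a
    proof -
      have "trig_sum S A x * wave a x = (\<Sum>n\<in>S. A (a + n - a) * wave (a + n) x)"
        by (simp add: trig_sum_def sum_distrib_left sum_distrib_right wave_add_freq mult_ac)
      also have "\<dots> = (\<Sum>w\<in>(+) a ` S. A (w - a) * wave w x)"
        by (subst sum.reindex) auto
      also have "\<dots> = (\<Sum>w\<in>U. A (w - a) * wave w x)"
      proof (rule sum.mono_neutral_left[OF U(1)])
        show "(+) a ` S \<subseteq> U" using a by (auto simp: U_def)
        show "\<forall>w\<in>U - (+) a ` S. A (w - a) * wave w x = 0"
        proof
          fix w assume "w \<in> U - (+) a ` S"
          then have "w - a \<notin> S" by (metis DiffD2 add.commute diff_add_cancel imageI)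
          then show "A (w - a) * wave w x = 0" by (simp add: A)
        qed
      qed
      finally show ?thesis .
    qed
    have "trig_sum K c x * trig_sum S A x = (\<Sum>a\<in>K. c a * (trig_sum S A x * wave a x))"
      by (simp add: trig_sum_def[of K] sum_distrib_left sum_distrib_right mult_ac)
    also have "\<dots> = (\<Sum>a\<in>K. c a * (\<Sum>w\<in>U. A (w - a) * wave w x))"
      by (intro sum.cong refl arg_cong2[where f = "(*)"] shift)
    also have "\<dots> = (\<Sum>w\<in>U. \<Sum>a\<in>K. c a * A (w - a) * wave w x)"
      by (subst sum.swap) (simp add: sum_distrib_left mult_ac)
    finally show ?thesis by (simp add: trig_sum_def b_def sum_distrib_right)
  qed
  have "(\<Sum>w\<in>T. (norm (b w))\<^sup>2) \<le> (\<Sum>w\<in>U. (norm (b w))\<^sup>2)"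
    using U by (intro sum_mono2) (auto simp: U_def)
  also have "\<dots> = (LINT x|cell_measure. (norm (trig_sum K c x * trig_sum S A x))\<^sup>2)"
    by (simp add: trig_parseval[OF U, symmetric] prod)
  also have "\<dots> \<le> (LINT x|cell_measure. M\<^sup>2 * (norm (trig_sum S A x))\<^sup>2)"
  proof (rule integral_mono)
    let ?A = "\<Sum>n\<in>S. norm (A n)"
    show "integrable cell_measure (\<lambda>x. (norm (trig_sum K c x * trig_sum S A x))\<^sup>2)"
      using M norm_trig_sum[of S A] M0
      by (intro cell_integrable_bounded[of _ "(M * ?A)\<^sup>2"])
        (auto simp: norm_mult intro!: power_mono mult_mono)
    show "integrable cell_measure (\<lambda>x. M\<^sup>2 * (norm (trig_sum S A x))\<^sup>2)"
      using norm_trig_sum[of S A]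
      by (intro cell_integrable_bounded[of _ "M\<^sup>2 * ?A\<^sup>2"])
        (auto simp: abs_mult intro!: power_mono mult_left_mono)
    show "(norm (trig_sum K c x * trig_sum S A x))\<^sup>2 \<le> M\<^sup>2 * (norm (trig_sum S A x))\<^sup>2" for x
      using M by (auto simp: norm_mult power_mult_distrib intro!: mult_right_mono power_mono)
  qed
  also have "\<dots> = M\<^sup>2 * (\<Sum>n\<in>S. (norm (A n))\<^sup>2)" by (simp add: trig_parseval[OF S])
  finally show ?thesis by (simp add: b_def)
qed

definition trig_polynomial :: "(real ^ 'n \<Rightarrow> complex) \<Rightarrow> bool" where
  "trig_polynomial f \<longleftrightarrow> (\<exists>K a. finite K \<and> K \<subseteq> integer_points \<and> f = trig_sum K a)"

lemma trig_polynomial_wave: "n \<in> integer_points \<Longrightarrow> trig_polynomial (\<lambda>x. c * wave n x)"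
  unfolding trig_polynomial_def by (rule exI[of _ "{n}"]) (auto simp: trig_sum_def[abs_def])

lemma trig_polynomial_const: "trig_polynomial (\<lambda>x. c)"
  using trig_polynomial_wave[of 0 c] by simp

lemma trig_polynomial_add:
  assumes "trig_polynomial f" "trig_polynomial g"
  shows "trig_polynomial (\<lambda>x. f x + g x)"
proof -
  obtain K a L b where K: "finite K" "K \<subseteq> integer_points" "f = trig_sum K a"
    and L: "finite L" "L \<subseteq> integer_points" "g = trig_sum L b"
    using assms unfolding trig_polynomial_def by blast
  define c where "c n = (if n \<in> K then a n else 0) + (if n \<in> L then b n else 0)" for n
  have "f x + g x = trig_sum (K \<union> L) c x" for x
  proof -
    have "trig_sum (K \<union> L) c x = (\<Sum>n\<in>K \<union> L. (if n \<in> K then a n * wave n x else 0))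
      + (\<Sum>n\<in>K \<union> L. (if n \<in> L then b n * wave n x else 0))"
      unfolding trig_sum_def c_def sum.distrib[symmetric] by (intro sum.cong) (auto simp: algebra_simps)
    also have "(\<Sum>n\<in>K \<union> L. (if n \<in> K then a n * wave n x else 0)) = f x"
      using K L by (simp add: trig_sum_def sum.If_cases Int_absorb1 Int_absorb2 Int_commute)
    also have "(\<Sum>n\<in>K \<union> L. (if n \<in> L then b n * wave n x else 0)) = g x"
      using K L by (simp add: trig_sum_def sum.If_cases Int_absorb1 Int_absorb2 Int_commute)
    finally show ?thesis ..
  qed
  then show ?thesis unfolding trig_polynomial_def using K L
    by (intro exI[of _ "K \<union> L"] exI[of _ c]) auto
qed

lemma trig_polynomial_sum:
  "finite I \<Longrightarrow> (\<And>i. i \<in> I \<Longrightarrow> trig_polynomial (f i)) \<Longrightarrow> trig_polynomial (\<lambda>x. \<Sum>i\<in>I. f i x)"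
  by (induction I rule: finite_induct) (auto intro: trig_polynomial_const trig_polynomial_add)

lemma trig_polynomial_mult:
  assumes "trig_polynomial f" "trig_polynomial g"
  shows "trig_polynomial (\<lambda>x. f x * g x)"
proof -
  obtain K a L b where K: "finite K" "K \<subseteq> integer_points" "f = trig_sum K a"
    and L: "finite L" "L \<subseteq> integer_points" "g = trig_sum L b"
    using assms unfolding trig_polynomial_def by blast
  have "(\<lambda>x. f x * g x) = (\<lambda>x. \<Sum>m\<in>K. \<Sum>n\<in>L. (a m * b n) * wave (m + n) x)"
    by (simp add: K L trig_sum_def sum_product wave_add_freq mult_ac)
  then show ?thesis using K L
    by (auto intro!: trig_polynomial_sum trig_polynomial_wave simp: subset_iff)
qed

text \<open>
  The torus as a compact subset of a Euclidean space, on which the Stone-Weierstrass theorem for polynomials applies.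
\<close>
definition torus_embedding :: "real ^ 'n \<Rightarrow> complex ^ 'n" where
  "torus_embedding x = (\<chi> i. cis (2 * pi * x $ i))"

text \<open>
  The real coordinates of the embedded torus are cosines and sines, and trigonometric polynomials form an algebra.
\<close>
lemma trig_polynomial_torus_polynomial:
  assumes "real_polynomial_function g"
  shows "trig_polynomial (\<lambda>x :: real ^ 'n. of_real (g (torus_embedding x)))"
  using assms
proof (induction rule: real_polynomial_function.induct)
  case (linear f)
  then interpret bounded_linear f .
  have coord: "trig_polynomial (\<lambda>x :: real ^ 'n. of_real (torus_embedding x \<bullet> b))" if b: "b \<in> Basis" for b
  proof -
    obtain i v where b: "b = axis i v" and v: "v = 1 \<or> v = \<i>"
      using b by (auto simp: Basis_vec_def Basis_complex_def)
    have w: "wave (axis i 1) x = cis (2 * pi * x $ i)" for x :: "real ^ 'n" by (simp add: wave_def inner_axis inner_commute)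
    have neg: "- axis i 1 \<in> (integer_points :: (real ^ 'n) set)" by simp
    show ?thesis
    proof (cases "v = 1")
      case True
      then have "(\<lambda>x :: real ^ 'n. complex_of_real (torus_embedding x \<bullet> b)) =
        (\<lambda>x. (1 / 2) * wave (axis i 1) x + (1 / 2) * wave (- axis i 1) x)"
        by (intro ext) (simp add: b inner_axis torus_embedding_def inner_complex_def wave_minus w complex_eq_iff)
      then show ?thesis
        by (simp only:) (intro trig_polynomial_add trig_polynomial_wave neg integer_points_closed)
    next
      case False
      with v have v: "v = \<i>" by blast
      then have "(\<lambda>x :: real ^ 'n. complex_of_real (torus_embedding x \<bullet> b)) =
        (\<lambda>x. (- \<i> / 2) * wave (axis i 1) x + (\<i> / 2) * wave (- axis i 1) x)"
        by (intro ext) (simp add: b inner_axis torus_embedding_def inner_complex_def wave_minus w complex_eq_iff)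
      then show ?thesis
        by (simp only:) (intro trig_polynomial_add trig_polynomial_wave neg integer_points_closed)
    qed
  qed
  have f_expand: "f z = (\<Sum>b\<in>Basis. (z \<bullet> b) * f b)" for z
    by (subst euclidean_representation[of z, symmetric], subst sum) (simp add: scaleR)
  have "(\<lambda>x :: real ^ 'n. complex_of_real (f (torus_embedding x))) =
    (\<lambda>x. \<Sum>b\<in>Basis. of_real (torus_embedding x \<bullet> b) * of_real (f b))"
    by (intro ext, subst f_expand) simp
  moreover have "trig_polynomial (\<lambda>x :: real ^ 'n. of_real (torus_embedding x \<bullet> b) * of_real (f b))"
    if "b \<in> Basis" for b
    by (rule trig_polynomial_mult[OF coord[OF that] trig_polynomial_const])
  ultimately show ?case
    by (simp only:) (rule trig_polynomial_sum[OF finite_Basis])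
qed (auto intro: trig_polynomial_const trig_polynomial_add trig_polynomial_mult)

lemma torus_embedding_eq_iff:
  "torus_embedding x = torus_embedding y \<longleftrightarrow> x - y \<in> integer_points"
proof -
  have "cis (2 * pi * a) = cis (2 * pi * b) \<longleftrightarrow> a - b \<in> \<int>" for a b :: real
  proof -
    have "cis (2 * pi * a) = cis (2 * pi * b) \<longleftrightarrow> cis (2 * pi * (a - b)) = 1"
      by (simp add: right_diff_distrib flip: cis_divide)
    also have "\<dots> \<longleftrightarrow> (\<exists>k::int. 2 * pi * (a - b) = of_int (2 * k) * pi)"
      unfolding cis_conv_exp exp_eq_1 by simp
    also have "\<dots> \<longleftrightarrow> a - b \<in> \<int>" by (auto simp: Ints_def)
    finally show ?thesis .
  qed
  then show ?thesis by (simp add: torus_embedding_def vec_eq_iff integer_points_def)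
qed

text \<open>
  A continuous periodic function factors through the torus. The factor is continuous, because the embedding is a
  closed map on the closed unit cell.
\<close>
lemma trig_polynomial_dense_real:
  fixes f :: "real ^ 'n \<Rightarrow> real"
  assumes cont: "continuous_on UNIV f" and p: "periodic f" and e: "e > 0"
  obtains g where "trig_polynomial g" "\<And>x. norm (of_real (f x) - g x) < e"
proof -
  let ?E = "torus_embedding :: real ^ 'n \<Rightarrow> complex ^ 'n"
  define Q where "Q = cbox ((\<chi> i. - 1 / 2) :: real ^ 'n) (\<chi> i. 1 / 2)"
  define F where "F z = f (SOME x. ?E x = z)" for z
  have FE: "F (?E x) = f x" for x
  proof -
    have "?E (SOME y. ?E y = ?E x) = ?E x" by (rule someI[of _ x]) simp
    then have "(SOME y. ?E y = ?E x) - x \<in> integer_points" by (simp add: torus_embedding_eq_iff)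
    then have "f (x + ((SOME y. ?E y = ?E x) - x)) = f x" using p unfolding periodic_def by blast
    then show ?thesis by (simp add: F_def)
  qed
  have cE: "continuous_on A ?E" for A
    unfolding torus_embedding_def by (intro continuous_intros continuous_on_id)
  have onto: "?E ` Q = range ?E"
  proof -
    have "?E x \<in> ?E ` Q" for x
    proof (rule image_eqI)
      show "?E x = ?E (x - nearest_int x)" by (simp add: torus_embedding_eq_iff)
      show "x - nearest_int x \<in> Q"
        using nearest_int_in_cell[of x] by (auto simp: Q_def unit_cell_def mem_box_cart less_imp_le)
    qed
    then show ?thesis by auto
  qed
  have cQ: "compact Q" by (simp add: Q_def)
  have comp: "compact (range ?E)"
    unfolding onto[symmetric] by (rule compact_continuous_image[OF cE cQ])
  have "continuous_on (range ?E) F"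
  proof (subst continuous_on_closed_vimage)
    show "closed (range ?E)" by (rule compact_imp_closed[OF comp])
    show "\<forall>B. closed B \<longrightarrow> closed (F -` B \<inter> range ?E)"
    proof (intro allI impI)
      fix B :: "real set" assume B: "closed B"
      have "F -` B \<inter> range ?E = ?E ` (Q \<inter> f -` B)"
        unfolding onto[symmetric] using FE by auto
      moreover have "closed (f -` B)" using cont B by (simp add: continuous_on_closed_vimage)
      then have "compact (Q \<inter> f -` B)" using cQ by blast
      then have "compact (?E ` (Q \<inter> f -` B))" by (rule compact_continuous_image[OF cE])
      ultimately show "closed (F -` B \<inter> range ?E)" by (simp add: compact_imp_closed)
    qed
  qed
  from Stone_Weierstrass_real_polynomial_function[OF comp this e]
  obtain g where g: "real_polynomial_function g" "\<And>z. z \<in> range ?E \<Longrightarrow> \<bar>F z - g z\<bar> < e" by blast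
  show ?thesis
  proof (rule that)
    show "trig_polynomial (\<lambda>x. of_real (g (?E x)))" by (rule trig_polynomial_torus_polynomial[OF g(1)])
    show "norm (complex_of_real (f x) - of_real (g (?E x))) < e" for x
      using g(2)[of "?E x"] by (simp add: FE flip: of_real_diff)
  qed
qed

lemma trig_polynomial_dense:
  fixes f :: "real ^ 'n \<Rightarrow> complex"
  assumes cont: "continuous_on UNIV f" and p: "periodic f" and e: "e > 0"
  obtains K a where "finite K" "K \<subseteq> integer_points" "\<And>x. norm (f x - trig_sum K a x) < e"
proof -
  have e2: "e / 2 > 0" using e by simp
  have "continuous_on UNIV (\<lambda>x. Re (f x))" "periodic (\<lambda>x. Re (f x))"
    using continuous_on_Re[OF cont] p by (simp_all add: periodic_def)
  from trig_polynomial_dense_real[OF this e2] obtain g where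
    g: "trig_polynomial g" "\<And>x. norm (of_real (Re (f x)) - g x) < e / 2" by blast
  have "continuous_on UNIV (\<lambda>x. Im (f x))" "periodic (\<lambda>x. Im (f x))"
    using continuous_on_Im[OF cont] p by (simp_all add: periodic_def)
  from trig_polynomial_dense_real[OF this e2] obtain h where
    h: "trig_polynomial h" "\<And>x. norm (of_real (Im (f x)) - h x) < e / 2" by blast
  have "trig_polynomial (\<lambda>x. g x + \<i> * h x)"
    by (intro trig_polynomial_add trig_polynomial_mult trig_polynomial_const g h)
  then obtain K a where K: "finite K" "K \<subseteq> integer_points" "(\<lambda>x. g x + \<i> * h x) = trig_sum K a"
    unfolding trig_polynomial_def by blast
  have "norm (f x - trig_sum K a x) < e" for x
  proof -
    have "f x - trig_sum K a x = (of_real (Re (f x)) - g x) + \<i> * (of_real (Im (f x)) - h x)"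
      unfolding K(3)[symmetric] by (simp add: complex_eq_iff)
    then have "norm (f x - trig_sum K a x) \<le> norm (of_real (Re (f x)) - g x) + norm (of_real (Im (f x)) - h x)"
      using norm_triangle_ineq[of "of_real (Re (f x)) - g x" "\<i> * (of_real (Im (f x)) - h x)"] by (simp add: norm_mult)
    then show ?thesis using g(2)[of x] h(2)[of x] by linarith
  qed
  with K that show ?thesis by blast
qed

section \<open>Distance on the torus\<close>

lemma finite_integer_points_bounded:
  assumes "bounded (S :: (real ^ 'n) set)"
  shows "finite (S \<inter> integer_points)"
proof -
  obtain B where B: "\<And>x. x \<in> S \<Longrightarrow> norm x \<le> B" using assms bounded_iff by blast
  define N where "N = \<lceil>B\<rceil>"
  have "S \<inter> integer_points \<subseteq> (\<lambda>f. \<chi> i. real_of_int (f i)) ` (PiE UNIV (\<lambda>_. {- N..N}))"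
  proof
    fix x assume x: "x \<in> S \<inter> integer_points"
    then have e: "x = (\<chi> i. real_of_int \<lfloor>x $ i\<rfloor>)" by (auto simp: integer_points_def vec_eq_iff Ints_def)
    have "\<lfloor>x $ i\<rfloor> \<in> {- N..N}" for i
    proof -
      have "\<bar>x $ i\<bar> \<le> B" using component_le_norm_cart[of x i] B[of x] x by auto
      moreover have "x $ i = of_int \<lfloor>x $ i\<rfloor>" using x by (auto simp: integer_points_def Ints_def)
      ultimately show ?thesis unfolding N_def by (simp add: abs_le_iff) linarith
    qed
    then show "x \<in> (\<lambda>f. \<chi> i. real_of_int (f i)) ` (PiE UNIV (\<lambda>_. {- N..N}))"
      using e by (intro image_eqI[of _ _ "\<lambda>i. \<lfloor>x $ i\<rfloor>"]) auto
  qed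
  then show ?thesis by (rule finite_subset) (auto intro!: finite_imageI finite_PiE)
qed

lemma torus_norm_le: "n \<in> integer_points \<Longrightarrow> torus_norm x \<le> norm (x + n)"
  unfolding torus_norm_def by (rule cINF_lower[OF bdd_belowI2[of _ 0]]) auto

text \<open>
  Among all integer translates the one with coordinates in \<open>[-1/2, 1/2]\<close> is smallest in every coordinate.
\<close>
lemma torus_norm_eqI:
  fixes x :: "real ^ 'n"
  assumes n: "n \<in> integer_points" and le: "\<And>i. \<bar>x $ i - n $ i\<bar> \<le> 1 / 2"
  shows "torus_norm x = norm (x - n)"
proof (rule antisym)
  show "torus_norm x \<le> norm (x - n)"
    using torus_norm_le[of "- n" x] n by simp
  show "norm (x - n) \<le> torus_norm x"
    unfolding torus_norm_def
  proof (rule cINF_greatest)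
    fix m :: "real ^ 'n" assume m: "m \<in> integer_points"
    show "norm (x - n) \<le> norm (x + m)"
    proof (rule norm_le_componentwise_cart)
      fix i
      have "m $ i \<in> \<int>" "n $ i \<in> \<int>" using m n by (auto simp: integer_points_def)
      then have "m $ i + n $ i \<in> \<int>" by simp
      then obtain k :: int where k: "m $ i + n $ i = of_int k" by (auto simp: Ints_def)
      have "\<bar>a\<bar> \<le> \<bar>a + of_int k\<bar>" if "\<bar>a\<bar> \<le> 1 / 2" for a :: real
      proof (cases "k = 0")
        case False
        then have "1 \<le> \<bar>real_of_int k\<bar>" by linarith
        then show ?thesis using that by linarith
      qed simp
      from this[OF le[of i]] show "norm ((x - n) $ i) \<le> norm ((x + m) $ i)"
        unfolding k[symmetric] by (simp add: add_ac)
    qed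
  qed (use integer_points_closed(1) in blast)
qed

lemma unit_cell_abs: "x \<in> unit_cell \<Longrightarrow> \<bar>x $ i\<bar> \<le> 1 / 2"
  unfolding unit_cell_def mem_Collect_eq by (drule spec[of _ i]) arith

lemma norm_unit_cell: "x \<in> unit_cell \<Longrightarrow> (norm (x :: real ^ 'n))\<^sup>2 \<le> CARD('n) / 4"
proof -
  assume x: "x \<in> unit_cell"
  have "(norm x)\<^sup>2 = (\<Sum>i\<in>UNIV. (x $ i)\<^sup>2)"
    by (simp add: norm_vec_def L2_set_def sum_nonneg)
  also have "\<dots> \<le> (\<Sum>i\<in>(UNIV :: 'n set). (1 / 2)\<^sup>2)"
    using unit_cell_abs[OF x] by (intro sum_mono) (simp only: abs_le_square_iff[symmetric], simp)
  finally show ?thesis by (simp add: power2_eq_square)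
qed

lemma torus_norm_nearest: "torus_norm x = norm (x - nearest_int x)"
  using unit_cell_abs[OF nearest_int_in_cell[of x]] by (intro torus_norm_eqI) simp_all

lemma torus_norm_local:
  assumes "n \<in> integer_points" "norm (x - n) \<le> 1 / 2"
  shows "torus_norm x = norm (x - n)"
proof (rule torus_norm_eqI[OF assms(1)])
  fix i
  show "\<bar>x $ i - n $ i\<bar> \<le> 1 / 2" using component_le_norm_cart[of "x - n" i] assms(2) by simp
qed

lemma torus_norm_nonneg [simp]: "torus_norm x \<ge> 0"
  by (simp add: torus_norm_nearest)

lemma torus_norm_minus [simp]: "torus_norm (- x) = torus_norm x"
proof -
  have "torus_norm (- x) \<le> torus_norm x" for x :: "real ^ 'n"
    using torus_norm_le[of "nearest_int x" "- x"] by (simp add: torus_norm_nearest[of x] norm_minus_commute)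
  from this[of x] this[of "- x"] show ?thesis by simp
qed

lemma torus_norm_commute: "torus_norm (x - y) = torus_norm (y - x)"
  using torus_norm_minus[of "x - y"] by simp

lemma torus_norm_le_add: "torus_norm (x + y) \<le> torus_norm x + norm y"
proof -
  have "torus_norm (x + y) \<le> norm (x + y + - nearest_int x)" by (rule torus_norm_le) simp
  also have "\<dots> = norm ((x - nearest_int x) + y)" by (simp add: algebra_simps)
  also have "\<dots> \<le> torus_norm x + norm y" unfolding torus_norm_nearest by (rule norm_triangle_ineq)
  finally show ?thesis .
qed

lemma periodic_torus_norm:
  assumes "n \<in> integer_points"
  shows "torus_norm (x + n) = torus_norm x"
proof -
  have "torus_norm (x + n) \<le> torus_norm x" if "n \<in> integer_points" for x n :: "real ^ 'n"
    using torus_norm_le[of "- n - nearest_int x" "x + n"] that by (simp add: torus_norm_nearest[of x])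
  from this[OF assms, of x] this[of "- n" "x + n"] assms show ?thesis by simp
qed

lemma torus_norm_triangle: "torus_norm (x + y) \<le> torus_norm x + torus_norm y"
proof -
  have "torus_norm (x + y) = torus_norm (x + (y - nearest_int y))"
    using periodic_torus_norm[of "- nearest_int y" "x + y"] by (simp add: add_diff_eq)
  also have "\<dots> \<le> torus_norm x + torus_norm y"
    using torus_norm_le_add[of x "y - nearest_int y"] by (simp add: torus_norm_nearest[of y])
  finally show ?thesis .
qed

lemma torus_norm_lipschitz: "\<bar>torus_norm x - torus_norm y\<bar> \<le> norm (x - y)"
  using torus_norm_le_add[of y "x - y"] torus_norm_le_add[of x "y - x"]
  by (simp add: norm_minus_commute abs_le_iff)

lemma continuous_on_torus_norm: "continuous_on A torus_norm"
proof (rule lipschitz_on_continuous_on)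
  show "1-lipschitz_on A torus_norm"
    by (rule lipschitz_onI) (use torus_norm_lipschitz in \<open>simp_all add: dist_norm\<close>)
qed

lemma borel_measurable_torus_norm [measurable]: "torus_norm \<in> borel_measurable borel"
  by (intro borel_measurable_continuous_onI continuous_on_torus_norm)

text \<open>
  Bumps can fail to be differentiable only on the boundary spheres of their supports, which form a null set.
\<close>
lemma AE_torus_norm_neq: "AE x in cell_measure. torus_norm (x - y) \<noteq> (\<rho> :: real)"
proof -
  have "{x. torus_norm (x - y) = \<rho>} \<subseteq> (\<Union>n\<in>integer_points. sphere (y + n) \<rho>)"
  proof
    fix x assume "x \<in> {x. torus_norm (x - y) = \<rho>}"
    then have "x \<in> sphere (y + nearest_int (x - y)) \<rho>"
      by (simp add: torus_norm_nearest dist_norm norm_minus_commute algebra_simps)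
    then show "x \<in> (\<Union>n\<in>integer_points. sphere (y + n) \<rho>)" using nearest_int_integer by blast
  qed
  moreover have "(\<Union>n\<in>integer_points. sphere (y + n) \<rho>) \<in> null_sets lborel"
  proof (rule null_sets_UN'[OF countable_integer_points])
    fix n
    have "sphere (y + n) \<rho> \<in> null_sets lebesgue"
      using negligible_sphere[of "y + n" \<rho>] by (simp add: negligible_iff_null_sets)
    moreover have "sphere (y + n) \<rho> \<in> sets lborel" by simp
    ultimately show "sphere (y + n) \<rho> \<in> null_sets lborel"
      using null_sets_completion_iff by blast
  qed
  ultimately have "AE x in lborel. torus_norm (x - y) \<noteq> \<rho>"
    by (intro AE_I') auto
  then show ?thesis unfolding cell_measure_def by (subst AE_density) auto
qed

lemma norm_sum_disjoint:
  fixes f :: "'i \<Rightarrow> complex"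
  assumes "finite Y" "\<And>j k. j \<in> Y \<Longrightarrow> k \<in> Y \<Longrightarrow> f j \<noteq> 0 \<Longrightarrow> f k \<noteq> 0 \<Longrightarrow> j = k"
  shows "(norm (\<Sum>k\<in>Y. f k))\<^sup>2 = (\<Sum>k\<in>Y. (norm (f k))\<^sup>2)"
proof (cases "\<exists>j\<in>Y. f j \<noteq> 0")
  case True
  then obtain j where j: "j \<in> Y" "f j \<noteq> 0" by blast
  then have "f k = 0" if "k \<in> Y - {j}" for k using assms(2) that by blast
  then show ?thesis using assms(1) j by (simp add: sum.remove[OF assms(1) j(1)])
qed auto

text \<open>
  A ball of radius less than \<open>1/2\<close> lies inside the unit cell, where the torus distance is the Euclidean norm.
\<close>
lemma integral_radial_torus:
  fixes f H :: "real \<Rightarrow> real"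
  assumes "0 \<le> \<rho>" "\<rho> < 1 / 2" and cont: "continuous_on {0..\<rho>} f"
    and H: "\<And>r. 0 \<le> r \<Longrightarrow> r \<le> \<rho> \<Longrightarrow> (H has_real_derivative r ^ (CARD('n) - 1) * f r) (at r within {0..\<rho>})"
  shows "(LINT x|cell_measure. (if torus_norm (x :: real ^ 'n) \<le> \<rho> then f (torus_norm x) else 0)) =
     CARD('n) * unit_ball_vol CARD('n) * (H \<rho> - H 0)"
proof -
  have sm: "(\<lambda>r. if 0 \<le> r \<and> r \<le> \<rho> then f r else 0) \<in> borel_measurable borel"
    using borel_measurable_continuous_on_indicator[OF _ cont]
    by (rule iffD1[OF measurable_cong, rotated -1]) (auto simp: indicator_def)
  have m: "(\<lambda>x :: real ^ 'n. if torus_norm x \<le> \<rho> then f (torus_norm x) else 0) \<in> borel_measurable borel"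
    using measurable_compose[OF borel_measurable_torus_norm sm] by simp
  have "(LINT x|cell_measure. (if torus_norm (x :: real ^ 'n) \<le> \<rho> then f (torus_norm x) else 0))
    = (LINT x|lborel. indicator unit_cell x *\<^sub>R (if torus_norm (x :: real ^ 'n) \<le> \<rho> then f (torus_norm x) else 0))"
    unfolding cell_measure_def ennreal_indicator[symmetric]
    by (subst integral_density) (use m in \<open>auto intro!: borel_measurable_indicator\<close>)
  also have "\<dots> = (LINT x|lborel. indicator (cball (0 :: real ^ 'n) \<rho>) x * f (norm x))"
  proof (intro Bochner_Integration.integral_cong refl)
    fix x :: "real ^ 'n"
    have "x \<in> unit_cell" if "norm x \<le> \<rho>"
    proof -
      have "- 1 / 2 \<le> x $ i \<and> x $ i < 1 / 2" for i
        using component_le_norm_cart[of x i] that assms by arith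
      then show ?thesis by (simp add: unit_cell_def)
    qed
    moreover have "torus_norm x = norm x" if "x \<in> unit_cell"
      using torus_norm_eqI[of 0 x] unit_cell_abs[OF that] by simp
    ultimately show "indicator unit_cell x *\<^sub>R (if torus_norm x \<le> \<rho> then f (torus_norm x) else 0)
      = indicator (cball 0 \<rho>) x * f (norm x)" by (auto simp: indicator_def)
  qed
  also have "\<dots> = CARD('n) * unit_ball_vol CARD('n) * (H \<rho> - H 0)"
    using radial_integral_FTC[where 'a = "real ^ 'n" and \<rho> = \<rho> and f = f and H = H] assms by simp
  finally show ?thesis .
qed

section \<open>Superpositions of separated bumps\<close>

text \<open>
  A radial bump \<open>B(\<bar>z\<bar>\<^sup>2)\<close> on the ball of radius \<open>\<rho>\<close>, vanishing on the boundary. The profile is a function of the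
  squared norm, so that smoothness of \<open>B\<close> makes the bump smooth at the centre.
\<close>
locale radial_profile =
  fixes B B' :: "real \<Rightarrow> real" and \<rho> :: real
  assumes \<rho>: "0 < \<rho>" "\<rho> < 1 / 2"
    and B_deriv: "\<And>s. (B has_real_derivative B' s) (at s)"
    and B'_cont: "continuous_on UNIV B'"
    and B_boundary: "B (\<rho>\<^sup>2) = 0"
    and B_nonneg: "\<And>s. 0 \<le> s \<Longrightarrow> s \<le> \<rho>\<^sup>2 \<Longrightarrow> 0 \<le> B s"
begin

text \<open>
  The minimum continues the bump by the boundary value \<open>B(\<rho>\<^sup>2) = 0\<close>, which makes Lipschitz continuity evident.
\<close>
definition bump :: "real ^ 'n \<Rightarrow> real" where
  "bump z = B ((min (torus_norm z) \<rho>)\<^sup>2)"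

text \<open>
  The partial derivative of the bump in direction \<open>i\<close>: the difference is the \<open>i\<close>-th coordinate of \<open>z\<close> relative to
  its nearest integer point. On the boundary sphere, where the derivative may not exist, the value is \<open>0\<close>.
\<close>
definition dbump :: "'n \<Rightarrow> real ^ 'n \<Rightarrow> real" where
  "dbump i z = (if torus_norm z < \<rho> then 2 * (z $ i - of_int \<lfloor>z $ i + 1 / 2\<rfloor>) * B' ((torus_norm z)\<^sup>2) else 0)"

lemma B_cont: "continuous_on A B"
  using B_deriv by (meson DERIV_isCont continuous_at_imp_continuous_on)

lemma bump_nonneg: "bump z \<ge> 0"
  unfolding bump_def using \<rho> by (intro B_nonneg) (auto intro!: power_mono)

lemma bump_eq_0: "torus_norm z \<ge> \<rho> \<Longrightarrow> bump z = 0"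
  by (simp add: bump_def min_absorb2 B_boundary)

lemma bump_inside: "torus_norm z \<le> \<rho> \<Longrightarrow> bump z = B ((torus_norm z)\<^sup>2)"
  by (simp add: bump_def min_absorb1)

lemma periodic_bump: "n \<in> integer_points \<Longrightarrow> bump (z + n) = bump z"
  by (simp add: bump_def periodic_torus_norm)

lemma periodic_dbump:
  assumes "n \<in> integer_points"
  shows "dbump i (z + n) = dbump i z"
proof -
  obtain k :: int where k: "n $ i = of_int k" using assms by (auto simp: integer_points_def Ints_def)
  have "z $ i + of_int k + 1 / 2 = z $ i + 1 / 2 + of_int k" by simp
  then have "\<lfloor>z $ i + of_int k + 1 / 2\<rfloor> = \<lfloor>z $ i + 1 / 2\<rfloor> + k" by (simp only: floor_add_int)
  then show ?thesis by (simp add: dbump_def periodic_torus_norm[OF assms] k)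
qed

lemma bump_lipschitz: "\<exists>C\<ge>0. \<forall>z w :: real ^ 'n. \<bar>bump z - bump w\<bar> \<le> C * norm (z - w)"
proof -
  have "compact (B' ` {0..\<rho>\<^sup>2})"
    by (intro compact_continuous_image continuous_on_subset[OF B'_cont]) auto
  then obtain M where M: "\<And>s. s \<in> {0..\<rho>\<^sup>2} \<Longrightarrow> \<bar>B' s\<bar> \<le> M"
    using compact_imp_bounded bounded_real by (metis imageI)
  have M0: "M \<ge> 0" using M[of 0] by simp
  have lip: "\<bar>B s - B t\<bar> \<le> M * \<bar>s - t\<bar>" if "s \<in> {0..\<rho>\<^sup>2}" "t \<in> {0..\<rho>\<^sup>2}" for s t
    using field_differentiable_bound[of "{0..\<rho>\<^sup>2}" B B' M s t] that M B_deriv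
    by (auto intro: has_field_derivative_at_within)
  have "\<bar>bump z - bump w\<bar> \<le> (2 * M * \<rho>) * norm (z - w)" for z w :: "real ^ 'n"
  proof -
    define a where "a = min (torus_norm z) \<rho>"
    define b where "b = min (torus_norm w) \<rho>"
    have ab: "0 \<le> a" "a \<le> \<rho>" "0 \<le> b" "b \<le> \<rho>" using \<rho> by (auto simp: a_def b_def)
    have bb: "\<bar>bump z - bump w\<bar> \<le> M * \<bar>a\<^sup>2 - b\<^sup>2\<bar>"
      unfolding bump_def a_def[symmetric] b_def[symmetric] using ab by (intro lip) (auto intro!: power_mono)
    have "\<bar>a\<^sup>2 - b\<^sup>2\<bar> = (a + b) * \<bar>a - b\<bar>" using ab by (simp add: power2_eq_square square_diff_square_factored abs_mult)
    also have "\<dots> \<le> (2 * \<rho>) * norm (z - w)"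
    proof (rule mult_mono)
      show "\<bar>a - b\<bar> \<le> norm (z - w)"
        using torus_norm_lipschitz[of z w] unfolding a_def b_def by linarith
    qed (use ab in auto)
    finally have "\<bar>a\<^sup>2 - b\<^sup>2\<bar> \<le> 2 * \<rho> * norm (z - w)" .
    with bb have "\<bar>bump z - bump w\<bar> \<le> M * (2 * \<rho> * norm (z - w))" 
      using M0 mult_left_mono order_trans by blast
    then show ?thesis by (simp add: mult_ac)
  qed
  moreover have "2 * M * \<rho> \<ge> 0" using M0 \<rho> by simp
  ultimately show ?thesis by blast
qed

lemma bump_bounded: "\<exists>D. \<forall>z :: real ^ 'n. \<bar>bump z\<bar> \<le> D"
proof -
  have "compact (B ` {0..\<rho>\<^sup>2})" by (intro compact_continuous_image B_cont) auto
  then obtain D where D: "\<And>s. s \<in> {0..\<rho>\<^sup>2} \<Longrightarrow> \<bar>B s\<bar> \<le> D"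
    using compact_imp_bounded bounded_real by (metis imageI)
  have "\<bar>bump z\<bar> \<le> D" for z :: "real ^ 'n"
    unfolding bump_def using \<rho> by (intro D) (auto intro!: power_mono)
  then show ?thesis by blast
qed

lemma continuous_on_bump: "continuous_on A bump"
  unfolding bump_def using \<rho>
  by (intro continuous_on_compose2[OF B_cont[of UNIV]] continuous_intros continuous_on_torus_norm) auto

lemma borel_measurable_bump [measurable]: "bump \<in> borel_measurable borel"
  by (intro borel_measurable_continuous_onI continuous_on_bump)

lemma borel_measurable_dbump [measurable]: "dbump i \<in> borel_measurable borel"
proof -
  have [measurable]: "B' \<in> borel_measurable borel" by (intro borel_measurable_continuous_onI B'_cont)
  show ?thesis unfolding dbump_def by measurable
qed

lemma dbump_bounded: "\<exists>D. \<forall>z :: real ^ 'n. \<bar>dbump i z\<bar> \<le> D"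
proof -
  have "compact (B' ` {0..\<rho>\<^sup>2})"
    by (intro compact_continuous_image continuous_on_subset[OF B'_cont]) auto
  then obtain M where M: "\<And>s. s \<in> {0..\<rho>\<^sup>2} \<Longrightarrow> \<bar>B' s\<bar> \<le> M"
    using compact_imp_bounded bounded_real by (metis imageI)
  have M0: "M \<ge> 0" using M[of 0] by simp
  have "\<bar>dbump i z\<bar> \<le> M" for z :: "real ^ 'n"
  proof (cases "torus_norm z < \<rho>")
    case True
    have "- (1 / 2) \<le> z $ i - of_int \<lfloor>z $ i + 1 / 2\<rfloor> \<and> z $ i - of_int \<lfloor>z $ i + 1 / 2\<rfloor> \<le> 1 / 2" by linarith
    moreover have "\<bar>2 * a\<bar> \<le> 1" if "- (1 / 2) \<le> a \<and> a \<le> 1 / 2" for a :: real using that by auto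
    ultimately have "\<bar>2 * (z $ i - of_int \<lfloor>z $ i + 1 / 2\<rfloor>)\<bar> \<le> 1" by blast
    moreover have "\<bar>B' ((torus_norm z)\<^sup>2)\<bar> \<le> M" using True by (intro M) (auto intro!: power_mono)
    ultimately have "\<bar>2 * (z $ i - of_int \<lfloor>z $ i + 1 / 2\<rfloor>)\<bar> * \<bar>B' ((torus_norm z)\<^sup>2)\<bar> \<le> 1 * M"
      by (rule mult_mono) auto
    then show ?thesis using True by (simp add: dbump_def abs_mult)
  qed (simp add: dbump_def M0)
  then show ?thesis by blast
qed

lemma bump_partial_deriv:
  fixes z :: "real ^ 'n"
  assumes "torus_norm z \<noteq> \<rho>"
  shows "((\<lambda>h. bump (z + h *\<^sub>R axis i 1)) has_real_derivative dbump i z) (at 0)"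
proof (cases "torus_norm z < \<rho>")
  case True
  define n where "n = nearest_int z"
  define w where "w = z - n"
  have tw: "torus_norm z = norm w" by (simp add: torus_norm_nearest n_def w_def)
  have sq: "(norm (w + h *\<^sub>R axis i 1))\<^sup>2 = (norm w)\<^sup>2 + 2 * h * w $ i + h\<^sup>2" for h
    unfolding power2_norm_eq_inner
    by (simp add: inner_add_left inner_add_right inner_axis inner_commute power2_eq_square algebra_simps)
  have d: "((\<lambda>h. B ((norm w)\<^sup>2 + 2 * h * w $ i + h\<^sup>2)) has_real_derivative B' ((norm w)\<^sup>2 + 2 * 0 * w $ i + 0\<^sup>2) * (2 * w $ i)) (at 0)"
    by (rule DERIV_chain2[OF B_deriv]) (auto intro!: derivative_eq_intros)
  have "((\<lambda>h. bump (z + h *\<^sub>R axis i 1)) has_real_derivative B' ((norm w)\<^sup>2) * (2 * w $ i)) (at 0)"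
  proof (rule has_field_derivative_transform_within_open[of "\<lambda>h. B ((norm w)\<^sup>2 + 2 * h * w $ i + h\<^sup>2)" _ _ "ball 0 (\<rho> - torus_norm z)"])
    show "((\<lambda>h. B ((norm w)\<^sup>2 + 2 * h * w $ i + h\<^sup>2)) has_real_derivative B' ((norm w)\<^sup>2) * (2 * w $ i)) (at 0)"
      using d by simp
    show "B ((norm w)\<^sup>2 + 2 * h * w $ i + h\<^sup>2) = bump (z + h *\<^sub>R axis i 1)" if "h \<in> ball 0 (\<rho> - torus_norm z)" for h
    proof -
      have "norm (w + h *\<^sub>R axis i 1) \<le> norm w + \<bar>h\<bar>"
        using norm_triangle_ineq[of w "h *\<^sub>R axis i 1"] by simp
      also have "\<dots> < \<rho>" using that tw by simp
      finally have lt: "norm (w + h *\<^sub>R axis i 1) < \<rho>" .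
      have eq: "z + h *\<^sub>R axis i 1 - n = w + h *\<^sub>R axis i 1" by (simp add: w_def)
      then have "torus_norm (z + h *\<^sub>R axis i 1) = norm (w + h *\<^sub>R axis i 1)"
        using torus_norm_local[of n "z + h *\<^sub>R axis i 1", unfolded eq] lt \<rho> by (simp add: n_def)
      then show ?thesis using lt by (simp add: bump_inside sq)
    qed
  qed (use True in auto)
  also have "B' ((norm w)\<^sup>2) * (2 * w $ i) = dbump i z"
    using True by (simp add: dbump_def tw) (simp add: w_def n_def nearest_int_def)
  finally show ?thesis .
next
  case False
  then have gt: "torus_norm z > \<rho>" using assms by simp
  have "((\<lambda>h. bump (z + h *\<^sub>R axis i 1)) has_real_derivative 0) (at 0)"
  proof (rule has_field_derivative_transform_within_open[of "\<lambda>h. 0" _ _ "ball 0 (torus_norm z - \<rho>)"])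
    show "0 = bump (z + h *\<^sub>R axis i 1)" if "h \<in> ball 0 (torus_norm z - \<rho>)" for h
      using torus_norm_lipschitz[of "z + h *\<^sub>R axis i 1" z] that
      by (intro bump_eq_0[symmetric]) auto
  qed (use gt in auto)
  then show ?thesis using gt by (simp add: dbump_def)
qed

lemma sum_dbump_square:
  "(\<Sum>i\<in>UNIV. (dbump i z)\<^sup>2) = (if torus_norm z < \<rho> then 4 * (torus_norm z)\<^sup>2 * (B' ((torus_norm z)\<^sup>2))\<^sup>2 else 0)"
proof (cases "torus_norm z < \<rho>")
  case True
  have "(\<Sum>i\<in>UNIV. (dbump i z)\<^sup>2) = (\<Sum>i\<in>UNIV. ((z - nearest_int z) $ i)\<^sup>2) * (4 * (B' ((torus_norm z)\<^sup>2))\<^sup>2)"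
    unfolding sum_distrib_right using True
    by (intro sum.cong) (simp_all only: dbump_def nearest_int_def power_mult_distrib vector_minus_component
       vec_lambda_beta if_True, simp_all)
  also have "(\<Sum>i\<in>UNIV. ((z - nearest_int z) $ i)\<^sup>2) = (torus_norm z)\<^sup>2"
    unfolding torus_norm_nearest norm_vec_def L2_set_def by (simp add: sum_nonneg)
  finally show ?thesis using True by simp
qed (simp add: dbump_def)

definition bump_mass :: "'n::finite itself \<Rightarrow> real" where
  "bump_mass _ = (LINT z|cell_measure. bump (z :: real ^ 'n))"

text \<open>
  The integral of \<open>b\<^sup>2 - \<bar>\<nabla>b\<bar>\<^sup>2 / (2 \<pi> R)\<^sup>2\<close> for the bump \<open>b\<close>: by Parseval, the sum of its squared Fourier coefficients with
  weights \<open>1 - \<bar>n\<bar>\<^sup>2/R\<^sup>2\<close> over all integer points \<open>n\<close>.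
\<close>
definition bump_energy :: "'n::finite itself \<Rightarrow> real \<Rightarrow> real" where
  "bump_energy _ R = (LINT z|cell_measure. (bump (z :: real ^ 'n))\<^sup>2)
     - (\<Sum>i\<in>UNIV. LINT z|cell_measure. (dbump i (z :: real ^ 'n))\<^sup>2) / (4 * pi\<^sup>2 * R\<^sup>2)"

definition bump_comb :: "'i set \<Rightarrow> ('i \<Rightarrow> real ^ 'n) \<Rightarrow> ('i \<Rightarrow> complex) \<Rightarrow> real ^ 'n \<Rightarrow> complex" where
  "bump_comb Y y u x = (\<Sum>k\<in>Y. u k * of_real (bump (x - y k)))"

lemma borel_measurable_bump_comb [measurable]: "bump_comb Y y u \<in> borel_measurable borel"
  unfolding bump_comb_def by measurable

lemma continuous_on_bump_comb: "continuous_on A (bump_comb Y y u)"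
  unfolding bump_comb_def
  by (intro continuous_intros continuous_on_compose2[OF continuous_on_bump[of UNIV]]) auto

lemma periodic_bump_comb:
  fixes y :: "'i \<Rightarrow> real ^ 'n"
  shows "periodic (bump_comb Y y u)"
  unfolding periodic_def bump_comb_def
proof (intro allI ballI sum.cong refl)
  fix x n :: "real ^ 'n" and k assume "n \<in> integer_points"
  then show "u k * of_real (bump (x + n - y k)) = u k * of_real (bump (x - y k))"
    using periodic_bump[of n "x - y k"] by (simp add: algebra_simps)
qed

lemma bump_comb_bounded:
  fixes y :: "'i \<Rightarrow> real ^ 'n"
  shows "\<exists>D. \<forall>x. norm (bump_comb Y y u x) \<le> D"
proof -
  obtain D where D: "\<And>z :: real ^ 'n. \<bar>bump z\<bar> \<le> D" using bump_bounded by blast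
  have "norm (bump_comb Y y u x) \<le> (\<Sum>k\<in>Y. norm (u k) * D)" for x
    unfolding bump_comb_def
    by (rule order.trans[OF norm_sum], intro sum_mono) (auto simp: norm_mult intro!: mult_left_mono D)
  then show ?thesis by blast
qed

text \<open>
  The superposition is the convolution of the bump with the point masses \<open>u\<^sub>k\<close> at \<open>y\<^sub>k\<close>.
\<close>
lemma fourier_coeff_bump_comb:
  fixes y :: "'i \<Rightarrow> real ^ 'n"
  assumes "finite Y" "n \<in> integer_points"
  shows "fourier_coeff (bump_comb Y y u) n
    = (\<Sum>k\<in>Y. u k * cnj (wave n (y k))) * fourier_coeff (\<lambda>z. of_real (bump z)) n"
proof -
  obtain D where D: "\<And>z :: real ^ 'n. \<bar>bump z\<bar> \<le> D" using bump_bounded by blast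
  have "fourier_coeff (bump_comb Y y u) n
     = (LINT x|cell_measure. (\<Sum>k\<in>Y. u k * (of_real (bump (x - y k)) * cnj (wave n x))))"
    unfolding fourier_coeff_def bump_comb_def by (simp add: sum_distrib_right mult.assoc)
  also have "\<dots> = (\<Sum>k\<in>Y. (LINT x|cell_measure. u k * (of_real (bump (x - y k)) * cnj (wave n x))))"
  proof (rule Bochner_Integration.integral_sum)
    show "integrable cell_measure (\<lambda>x. u k * (of_real (bump (x - y k)) * cnj (wave n x)))" for k
      by (rule cell_integrable_bounded[of _ "norm (u k) * D"])
         (use D in \<open>auto simp: norm_mult intro!: mult_left_mono\<close>)
  qed
  also have "\<dots> = (\<Sum>k\<in>Y. u k * fourier_coeff (\<lambda>x. of_real (bump (x + - y k))) n)"
    by (simp add: fourier_coeff_def)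
  also have "\<dots> = (\<Sum>k\<in>Y. u k * (wave n (- y k) * fourier_coeff (\<lambda>z. of_real (bump z)) n))"
  proof (intro sum.cong refl arg_cong2[where f = "(*)"])
    fix k
    show "fourier_coeff (\<lambda>x. of_real (bump (x + - y k))) n = wave n (- y k) * fourier_coeff (\<lambda>z. of_real (bump z)) n"
      by (rule fourier_coeff_shift[of "\<lambda>z. of_real (bump z)" D])
         (use D assms in \<open>auto simp: periodic_def periodic_bump\<close>)
  qed
  finally show ?thesis by (simp add: wave_minus sum_distrib_right mult.assoc)
qed

lemma norm_fourier_coeff_bump:
  "norm (fourier_coeff (\<lambda>z :: real ^ 'n. of_real (bump z)) n) \<le> bump_mass TYPE('n)"
proof -
  have "norm (fourier_coeff (\<lambda>z :: real ^ 'n. of_real (bump z)) n)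
      \<le> (LINT x|cell_measure. norm (of_real (bump x) * cnj (wave n x)))"
    unfolding fourier_coeff_def by (rule integral_norm_bound)
  also have "\<dots> = bump_mass TYPE('n)" unfolding bump_mass_def by (simp add: norm_mult bump_nonneg)
  finally show ?thesis .
qed

lemma separated_bumps_disjoint:
  assumes sep: "\<And>j k. j \<in> Y \<Longrightarrow> k \<in> Y \<Longrightarrow> j \<noteq> k \<Longrightarrow> 2 * \<rho> < torus_norm (y j - y k)"
    and "j \<in> Y" "k \<in> Y" "torus_norm (x - y j) \<le> \<rho>" "torus_norm (x - y k) \<le> \<rho>"
  shows "j = k"
proof (rule ccontr)
  assume "j \<noteq> k"
  then have "2 * \<rho> < torus_norm (y j - y k)" using sep assms by blast
  also have "y j - y k = (x - y k) + - (x - y j)" by simp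
  also have "torus_norm \<dots> \<le> torus_norm (x - y k) + torus_norm (- (x - y j))" by (rule torus_norm_triangle)
  finally show False using assms(4,5) by (simp only: torus_norm_minus)
qed

lemma integral_cell_shift_bounded:
  fixes f :: "real ^ 'n \<Rightarrow> real"
  assumes "f \<in> borel_measurable borel" "\<And>x. \<bar>f x\<bar> \<le> D" "\<And>x n. n \<in> integer_points \<Longrightarrow> f (x + n) = f x"
  shows "(LINT x|cell_measure. f (x - s)) = (LINT x|cell_measure. f x)"
  using integral_periodic_shift_real[of f D "- s"] assms by (simp add: periodic_def)

lemma integral_norm_bump_comb:
  fixes y :: "'i \<Rightarrow> real ^ 'n"
  assumes "finite Y"
    and sep: "\<And>j k. j \<in> Y \<Longrightarrow> k \<in> Y \<Longrightarrow> j \<noteq> k \<Longrightarrow> 2 * \<rho> < torus_norm (y j - y k)"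
  shows "(LINT x|cell_measure. (norm (bump_comb Y y u x))\<^sup>2)
    = (\<Sum>k\<in>Y. (norm (u k))\<^sup>2) * (LINT z|cell_measure. (bump (z :: real ^ 'n))\<^sup>2)"
proof -
  obtain D where D: "\<And>z :: real ^ 'n. \<bar>bump z\<bar> \<le> D" using bump_bounded by blast
  have D2: "\<bar>(bump z)\<^sup>2\<bar> \<le> D\<^sup>2" for z :: "real ^ 'n"
    using D[of z] by (simp add: power2_le_iff_abs_le abs_le_square_iff[symmetric])
  have "(norm (bump_comb Y y u x))\<^sup>2 = (\<Sum>k\<in>Y. (norm (u k))\<^sup>2 * (bump (x - y k))\<^sup>2)" for x
  proof -
    have "(norm (bump_comb Y y u x))\<^sup>2 = (\<Sum>k\<in>Y. (norm (u k * of_real (bump (x - y k))))\<^sup>2)"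
      unfolding bump_comb_def
    proof (rule norm_sum_disjoint[OF assms(1)])
      fix j k assume jk: "j \<in> Y" "k \<in> Y" and "u j * of_real (bump (x - y j)) \<noteq> 0" "u k * of_real (bump (x - y k)) \<noteq> 0"
      then have "torus_norm (x - y j) \<le> \<rho>" "torus_norm (x - y k) \<le> \<rho>"
        using bump_eq_0[of "x - y j"] bump_eq_0[of "x - y k"] by (force intro: ccontr)+
      then show "j = k" by (rule separated_bumps_disjoint[OF sep jk, rotated -2])
    qed
    then show ?thesis by (simp add: norm_mult power_mult_distrib)
  qed
  then have "(LINT x|cell_measure. (norm (bump_comb Y y u x))\<^sup>2)
      = (LINT x|cell_measure. (\<Sum>k\<in>Y. (norm (u k))\<^sup>2 * (bump (x - y k))\<^sup>2))" by simp
  also have "\<dots> = (\<Sum>k\<in>Y. (LINT x|cell_measure. (norm (u k))\<^sup>2 * (bump (x - y k))\<^sup>2))"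
  proof (rule Bochner_Integration.integral_sum)
    show "integrable cell_measure (\<lambda>x. (norm (u k))\<^sup>2 * (bump (x - y k))\<^sup>2)" for k
      by (rule cell_integrable_bounded[of _ "(norm (u k))\<^sup>2 * D\<^sup>2"])
         (use D2 in \<open>auto simp: abs_mult intro!: mult_left_mono\<close>)
  qed
  also have "\<dots> = (\<Sum>k\<in>Y. (norm (u k))\<^sup>2 * (LINT z|cell_measure. (bump (z :: real ^ 'n))\<^sup>2))"
    using integral_cell_shift_bounded[of "\<lambda>z. (bump (z :: real ^ 'n))\<^sup>2" "D\<^sup>2", OF _ D2]
    by (simp add: periodic_bump)
  finally show ?thesis by (simp add: sum_distrib_right)
qed

text \<open>
  The Bessel inequality for the \<open>i\<close>-th partial derivative of the superposition. It is obtained as the limit of the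
  Bessel inequalities for difference quotients, so that no integration by parts over the kinks at the
  boundary of the bumps is involved. Lipschitz continuity provides the dominating constant.
\<close>
lemma bump_comb_gradient_bound:
  fixes y :: "'i \<Rightarrow> real ^ 'n"
  assumes Y: "finite Y" and K: "finite K" "K \<subseteq> integer_points"
    and sep: "\<And>j k. j \<in> Y \<Longrightarrow> k \<in> Y \<Longrightarrow> j \<noteq> k \<Longrightarrow> 2 * \<rho> < torus_norm (y j - y k)"
  shows "(\<Sum>n\<in>K. (2 * pi * n $ i)\<^sup>2 * (norm (fourier_coeff (bump_comb Y y u) n))\<^sup>2)
    \<le> (\<Sum>k\<in>Y. (norm (u k))\<^sup>2) * (LINT z|cell_measure. (dbump i (z :: real ^ 'n))\<^sup>2)"
proof -
  let ?W = "bump_comb Y y u"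
  define e :: "real ^ 'n" where "e = axis i 1"
  define h where "h N = inverse (real (Suc N))" for N
  have h: "h N > 0" for N by (simp add: h_def)
  have hlim: "h \<longlonglongrightarrow> 0" unfolding h_def using LIMSEQ_inverse_real_of_nat by simp
  have hat: "filterlim h (at 0) sequentially"
    by (rule filterlim_atI[OF hlim]) (use h in \<open>auto intro!: always_eventually simp: less_imp_neq[symmetric]\<close>)
  have hatc: "filterlim (\<lambda>N. complex_of_real (h N)) (at 0) sequentially"
    using tendsto_of_real[OF hlim, where 'a = complex] h
    by (intro filterlim_atI) (auto intro!: always_eventually simp: less_imp_neq[symmetric])
  define Q where "Q N x = (?W (x + h N *\<^sub>R e) - ?W x) / of_real (h N)" for N x
  obtain D where D: "\<And>x. norm (?W x) \<le> D" using bump_comb_bounded by blast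
  \<comment> \<open>The Lipschitz constant bounds all difference quotients and dominates their squares.\<close>
  obtain C where C: "C \<ge> 0" "\<And>z w :: real ^ 'n. \<bar>bump z - bump w\<bar> \<le> C * norm (z - w)" using bump_lipschitz by blast
  define L where "L = (\<Sum>k\<in>Y. norm (u k) * C)"
  have QL: "norm (Q N x) \<le> L" for N x
  proof -
    have "norm (?W (x + h N *\<^sub>R e) - ?W x) \<le> (\<Sum>k\<in>Y. norm (u k) * (C * h N))"
      unfolding bump_comb_def sum_subtractf[symmetric] right_diff_distrib[symmetric] of_real_diff[symmetric]
    proof (rule order.trans[OF norm_sum], intro sum_mono)
      fix k
      have "\<bar>bump (x + h N *\<^sub>R e - y k) - bump (x - y k)\<bar> \<le> C * h N"
        using C(2)[of "x + h N *\<^sub>R e - y k" "x - y k"] h[of N] by (simp add: e_def)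
      then show "norm (u k * of_real (bump (x + h N *\<^sub>R e - y k) - bump (x - y k))) \<le> norm (u k) * (C * h N)"
        by (simp only: norm_mult norm_of_real) (rule mult_left_mono, simp_all)
    qed
    also have "\<dots> = L * h N" by (simp add: L_def sum_distrib_right mult.assoc)
    finally show ?thesis using h[of N] by (simp add: Q_def norm_divide divide_le_eq)
  qed
  have Qm [measurable]: "Q N \<in> borel_measurable borel" for N unfolding Q_def by measurable
  have coeff: "fourier_coeff (Q N) n = (wave n (h N *\<^sub>R e) - 1) / of_real (h N) * fourier_coeff ?W n"
    if n: "n \<in> integer_points" for N n
  proof -
    have i: "integrable cell_measure (\<lambda>x. ?W (x + s) * cnj (wave n x))" for s
      by (rule cell_integrable_bounded[of _ D]) (use D in \<open>auto simp: norm_mult\<close>)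
    have "fourier_coeff (Q N) n = (LINT x|cell_measure. (?W (x + h N *\<^sub>R e) * cnj (wave n x) - ?W (x + 0) * cnj (wave n x)) / of_real (h N))"
      unfolding fourier_coeff_def Q_def by (simp add: left_diff_distrib)
    also have "\<dots> = (fourier_coeff (\<lambda>x. ?W (x + h N *\<^sub>R e)) n - fourier_coeff ?W n) / of_real (h N)"
      using i[of "h N *\<^sub>R e"] i[of 0] by (simp add: fourier_coeff_def)
    also have "fourier_coeff (\<lambda>x. ?W (x + h N *\<^sub>R e)) n = wave n (h N *\<^sub>R e) * fourier_coeff ?W n"
      by (rule fourier_coeff_shift[OF _ D periodic_bump_comb n]) measurable
    finally show ?thesis by (simp add: left_diff_distrib)
  qed
  define g where "g x = (\<Sum>k\<in>Y. (norm (u k))\<^sup>2 * (dbump i (x - y k))\<^sup>2)" for x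
  have gm [measurable]: "g \<in> borel_measurable borel" unfolding g_def by measurable
  have lim_rhs: "(\<lambda>N. LINT x|cell_measure. (norm (Q N x))\<^sup>2) \<longlonglongrightarrow> (LINT x|cell_measure. g x)"
  proof (rule integral_dominated_convergence[where w = "\<lambda>x. L\<^sup>2"])
    show "AE x in cell_measure. (\<lambda>N. (norm (Q N x))\<^sup>2) \<longlonglongrightarrow> g x"
    proof -
      have "AE x in cell_measure. \<forall>k\<in>Y. torus_norm (x - y k) \<noteq> \<rho>"
        using Y by (simp add: AE_finite_all AE_torus_norm_neq)
      then show ?thesis
      proof eventually_elim
        case (elim x)
        have qlim: "(\<lambda>N. Q N x) \<longlonglongrightarrow> (\<Sum>k\<in>Y. u k * of_real (dbump i (x - y k)))"
        proof -
          have Qx: "Q N x = (\<Sum>k\<in>Y. u k * of_real ((bump (x - y k + h N *\<^sub>R e) - bump (x - y k)) / h N))" for N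
            unfolding Q_def bump_comb_def sum_subtractf[symmetric] sum_divide_distrib
            by (intro sum.cong refl) (simp add: right_diff_distrib algebra_simps)
          have dq: "(\<lambda>N. (bump (x - y k + h N *\<^sub>R e) - bump (x - y k)) / h N) \<longlonglongrightarrow> dbump i (x - y k)"
            if k: "k \<in> Y" for k
          proof -
            have "((\<lambda>t. bump (x - y k + t *\<^sub>R e)) has_real_derivative dbump i (x - y k)) (at 0)"
              unfolding e_def using elim k by (intro bump_partial_deriv) auto
            then have "((\<lambda>t. (bump (x - y k + t *\<^sub>R e) - bump (x - y k)) / t) \<longlongrightarrow> dbump i (x - y k)) (at 0)"
              by (simp add: DERIV_def)
            from filterlim_compose[OF this hat] show ?thesis .
          qed
          show ?thesis unfolding Qx
            by (intro tendsto_sum tendsto_mult tendsto_const tendsto_of_real dq)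
        qed
        have "(norm (\<Sum>k\<in>Y. u k * of_real (dbump i (x - y k))))\<^sup>2 = (\<Sum>k\<in>Y. (norm (u k * of_real (dbump i (x - y k))))\<^sup>2)"
        proof (rule norm_sum_disjoint[OF Y])
          fix j k assume jk: "j \<in> Y" "k \<in> Y" and "u j * of_real (dbump i (x - y j)) \<noteq> 0" "u k * of_real (dbump i (x - y k)) \<noteq> 0"
          then have "torus_norm (x - y j) \<le> \<rho>" "torus_norm (x - y k) \<le> \<rho>"
            by (auto simp: dbump_def split: if_splits)
          then show "j = k" by (rule separated_bumps_disjoint[OF sep jk, rotated -2])
        qed
        also have "\<dots> = g x" by (simp add: g_def norm_mult power_mult_distrib)
        finally show ?case using tendsto_power[OF tendsto_norm[OF qlim], of 2] by simp
      qed
    qed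
    show "AE x in cell_measure. norm ((norm (Q N x))\<^sup>2) \<le> L\<^sup>2" for N
      using QL by (auto intro!: power_mono)
    show "integrable cell_measure (\<lambda>x :: real ^ 'n. L\<^sup>2)" by (rule cell_integrable_bounded[of _ "L\<^sup>2"]) auto
  qed measurable
  have lim_lhs: "(\<lambda>N. \<Sum>n\<in>K. (norm (fourier_coeff (Q N) n))\<^sup>2)
      \<longlonglongrightarrow> (\<Sum>n\<in>K. (2 * pi * n $ i)\<^sup>2 * (norm (fourier_coeff ?W n))\<^sup>2)"
  proof (intro tendsto_sum)
    fix n assume n: "n \<in> K"
    let ?a = "complex_of_real (2 * pi * n $ i)"
    have "((\<lambda>z. exp (\<i> * ?a * z)) has_field_derivative \<i> * ?a) (at 0)"
      by (auto intro!: derivative_eq_intros)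
    then have "((\<lambda>t. (exp (\<i> * ?a * t) - 1) / t) \<longlongrightarrow> \<i> * ?a) (at 0)"
      by (simp add: DERIV_def)
    from filterlim_compose[OF this hatc]
    have "(\<lambda>N. (wave n (h N *\<^sub>R e) - 1) / of_real (h N)) \<longlonglongrightarrow> \<i> * ?a"
      by (simp add: wave_def e_def inner_axis cis_conv_exp mult_ac)
    from tendsto_power[OF tendsto_norm[OF tendsto_mult[OF this tendsto_const]], of "fourier_coeff ?W n" 2]
    show "(\<lambda>N. (norm (fourier_coeff (Q N) n))\<^sup>2) \<longlonglongrightarrow> (2 * pi * n $ i)\<^sup>2 * (norm (fourier_coeff ?W n))\<^sup>2"
      using n K by (simp add: coeff subset_iff norm_mult power_mult_distrib)
  qed
  have "(\<Sum>n\<in>K. (2 * pi * n $ i)\<^sup>2 * (norm (fourier_coeff ?W n))\<^sup>2) \<le> (LINT x|cell_measure. g x)"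
    by (rule tendsto_le[OF _ lim_rhs lim_lhs])
       (auto intro!: always_eventually bessel_inequality[OF Qm QL K])
  also have "\<dots> = (\<Sum>k\<in>Y. (norm (u k))\<^sup>2) * (LINT z|cell_measure. (dbump i (z :: real ^ 'n))\<^sup>2)"
  proof -
    obtain G where G: "\<And>z :: real ^ 'n. \<bar>dbump i z\<bar> \<le> G" using dbump_bounded by blast
    have G2: "\<bar>(dbump i z)\<^sup>2\<bar> \<le> G\<^sup>2" for z :: "real ^ 'n"
      using G[of z] by (simp add: power2_le_iff_abs_le abs_le_square_iff[symmetric])
    have "(LINT x|cell_measure. g x) = (\<Sum>k\<in>Y. (LINT x|cell_measure. (norm (u k))\<^sup>2 * (dbump i (x - y k))\<^sup>2))"
      unfolding g_def
    proof (rule Bochner_Integration.integral_sum)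
      show "integrable cell_measure (\<lambda>x. (norm (u k))\<^sup>2 * (dbump i (x - y k))\<^sup>2)" for k
        by (rule cell_integrable_bounded[of _ "(norm (u k))\<^sup>2 * G\<^sup>2"])
           (use G2 in \<open>auto simp: abs_mult intro!: mult_left_mono\<close>)
    qed
    also have "\<dots> = (\<Sum>k\<in>Y. (norm (u k))\<^sup>2 * (LINT z|cell_measure. (dbump i (z :: real ^ 'n))\<^sup>2))"
      using integral_cell_shift_bounded[of "\<lambda>z. (dbump i (z :: real ^ 'n))\<^sup>2" "G\<^sup>2", OF _ G2]
      by (simp add: periodic_dbump)
    finally show ?thesis by (simp add: sum_distrib_right)
  qed
  finally show ?thesis .
qed

text \<open>
  Let \<open>W\<close> be the superposition. The weight \<open>1 - \<bar>n\<bar>\<^sup>2/R\<^sup>2\<close> is negative outside the ball of radius \<open>R\<close>, so the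
  weighted sum over the ball is at least the sum over any larger finite set of frequencies. Completeness makes the
  unweighted part almost \<open>\<integral>\<bar>W\<bar>\<^sup>2\<close>, and the gradient bound controls the subtracted part. Finally each Fourier
  coefficient of \<open>W\<close> is at most the mass of the bump times the exponential sum of the points.
\<close>
lemma bump_frame_bound:
  fixes y :: "'i \<Rightarrow> real ^ 'n"
  assumes Y: "finite Y" and R: "R > 0"
    and sep: "\<And>j k. j \<in> Y \<Longrightarrow> k \<in> Y \<Longrightarrow> j \<noteq> k \<Longrightarrow> 2 * \<rho> < torus_norm (y j - y k)"
  shows "bump_energy TYPE('n) R * (\<Sum>k\<in>Y. (norm (u k))\<^sup>2) \<le> (bump_mass TYPE('n))\<^sup>2 *
    (\<Sum>n\<in>cball 0 R \<inter> integer_points. (1 - (norm n / R)\<^sup>2) * (norm (\<Sum>k\<in>Y. u k * cnj (wave n (y k))))\<^sup>2)"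
    (is "?E * ?S \<le> ?m\<^sup>2 * ?A")
proof (rule field_le_epsilon)
  fix \<epsilon> :: real assume \<epsilon>: "\<epsilon> > 0"
  let ?W = "bump_comb Y y u" and ?P = "cball 0 R \<inter> integer_points :: (real ^ 'n) set"
  let ?c = "\<lambda>n. (norm (fourier_coeff ?W n))\<^sup>2"
  obtain D where D: "\<And>x. norm (?W x) \<le> D" using bump_comb_bounded by blast
  have "sqrt \<epsilon> > 0" using \<epsilon> by simp
  from trig_polynomial_dense[OF continuous_on_bump_comb periodic_bump_comb this]
  obtain K0 a where K0: "finite K0" "K0 \<subseteq> integer_points" and a: "\<And>x. norm (?W x - trig_sum K0 a x) < sqrt \<epsilon>"
    by blast
  define K where "K = K0 \<union> ?P"
  have P: "finite ?P" by (rule finite_integer_points_bounded) simp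
  have K: "finite K" "K \<subseteq> integer_points" using K0 P by (auto simp: K_def)
  define b where "b n = (if n \<in> K0 then a n else 0)" for n
  have T: "trig_sum K b x = trig_sum K0 a x" for x
    unfolding trig_sum_def by (rule sum.mono_neutral_cong_right) (use K in \<open>auto simp: K_def b_def\<close>)
  have "(LINT x|cell_measure. (norm (?W x - trig_sum K b x))\<^sup>2) \<le> (LINT x|(cell_measure :: (real ^ 'n) measure). \<epsilon>)"
  proof (rule integral_mono)
    have le: "(norm (?W x - trig_sum K b x))\<^sup>2 \<le> \<epsilon>" for x
      using power_mono[OF less_imp_le[OF a[of x]], of 2] \<epsilon> by (simp add: T)
    then show "(norm (?W x - trig_sum K b x))\<^sup>2 \<le> \<epsilon>" for x .
    show "integrable cell_measure (\<lambda>x. (norm (?W x - trig_sum K b x))\<^sup>2)"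
      by (rule cell_integrable_bounded[of _ \<epsilon>]) (use le in auto)
    show "integrable (cell_measure :: (real ^ 'n) measure) (\<lambda>x. \<epsilon>)"
      by (rule cell_integrable_bounded[of _ \<epsilon>]) (use \<epsilon> in auto)
  qed
  also have "\<dots> = \<epsilon>" by (simp add: measure_def emeasure_cell_measure_UNIV)
  finally have "(LINT x|cell_measure. (norm (?W x))\<^sup>2) - (\<Sum>n\<in>K. ?c n)
      + (\<Sum>n\<in>K. (norm (b n - fourier_coeff ?W n))\<^sup>2) \<le> \<epsilon>"
    unfolding trig_approx_error[OF borel_measurable_bump_comb D K] .
  moreover have "(\<Sum>n\<in>K. (norm (b n - fourier_coeff ?W n))\<^sup>2) \<ge> 0" by (simp add: sum_nonneg)
  ultimately have complete: "?S * (LINT z|cell_measure. (bump (z :: real ^ 'n))\<^sup>2) \<le> (\<Sum>n\<in>K. ?c n) + \<epsilon>"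
    using integral_norm_bump_comb[where y = y and u = u, OF Y sep] by linarith
  let ?G = "\<Sum>i\<in>UNIV. LINT z|cell_measure. (dbump i (z :: real ^ 'n))\<^sup>2"
  have "(\<Sum>n\<in>K. (2 * pi * norm n)\<^sup>2 * ?c n) = (\<Sum>i\<in>UNIV. \<Sum>n\<in>K. (2 * pi * n $ i)\<^sup>2 * ?c n)"
  proof -
    have "(2 * pi * norm n)\<^sup>2 = (\<Sum>i\<in>UNIV. (2 * pi * n $ i)\<^sup>2)" for n :: "real ^ 'n"
      by (simp add: norm_vec_def L2_set_def power_mult_distrib sum_nonneg sum_distrib_left)
    then show ?thesis by (subst sum.swap) (simp add: sum_distrib_right)
  qed
  also have "\<dots> \<le> (\<Sum>i\<in>UNIV. ?S * (LINT z|cell_measure. (dbump i (z :: real ^ 'n))\<^sup>2))"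
    by (intro sum_mono bump_comb_gradient_bound Y K sep)
  also have "\<dots> = ?S * ?G" by (simp add: sum_distrib_left)
  finally have grad: "(\<Sum>n\<in>K. (2 * pi * norm n)\<^sup>2 * ?c n) \<le> ?S * ?G" .
  have "(\<Sum>n\<in>K. (1 - (norm n / R)\<^sup>2) * ?c n) = (\<Sum>n\<in>K. ?c n) - (\<Sum>n\<in>K. (2 * pi * norm n)\<^sup>2 * ?c n) / (4 * pi\<^sup>2 * R\<^sup>2)"
    using R by (simp add: left_diff_distrib sum_subtractf sum_divide_distrib power_mult_distrib power_divide)
  moreover have "(\<Sum>n\<in>K. (2 * pi * norm n)\<^sup>2 * ?c n) / (4 * pi\<^sup>2 * R\<^sup>2) \<le> ?S * ?G / (4 * pi\<^sup>2 * R\<^sup>2)"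
    by (rule divide_right_mono[OF grad]) simp
  moreover have "?E * ?S = ?S * (LINT z|cell_measure. (bump (z :: real ^ 'n))\<^sup>2) - ?S * ?G / (4 * pi\<^sup>2 * R\<^sup>2)"
    by (simp add: bump_energy_def algebra_simps)
  ultimately have "?E * ?S \<le> (\<Sum>n\<in>K. (1 - (norm n / R)\<^sup>2) * ?c n) + \<epsilon>"
    using complete by linarith
  also have "(\<Sum>n\<in>K. (1 - (norm n / R)\<^sup>2) * ?c n) \<le> (\<Sum>n\<in>?P. (1 - (norm n / R)\<^sup>2) * ?c n)"
  proof -
    have "(\<Sum>n\<in>K - ?P. (1 - (norm n / R)\<^sup>2) * ?c n) \<le> 0"
    proof (rule sum_nonpos)
      fix n assume "n \<in> K - ?P"
      then have "norm n > R" using K by (auto simp: subset_iff)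
      then have "1 \<le> (norm n / R)\<^sup>2" using R by (intro one_le_power) (simp add: le_divide_eq)
      then show "(1 - (norm n / R)\<^sup>2) * ?c n \<le> 0" by (intro mult_nonpos_nonneg) auto
    qed
    then show ?thesis using sum.subset_diff[of ?P K "\<lambda>n. (1 - (norm n / R)\<^sup>2) * ?c n"] K by (simp add: K_def)
  qed
  also have "(\<Sum>n\<in>?P. (1 - (norm n / R)\<^sup>2) * ?c n) \<le> (\<Sum>n\<in>?P. ?m\<^sup>2 * ((1 - (norm n / R)\<^sup>2) * (norm (\<Sum>k\<in>Y. u k * cnj (wave n (y k))))\<^sup>2))"
  proof (rule sum_mono)
    fix n assume n: "n \<in> ?P"
    let ?a = "norm (\<Sum>k\<in>Y. u k * cnj (wave n (y k)))"
    have "norm (fourier_coeff ?W n) \<le> ?a * ?m"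
      using n norm_fourier_coeff_bump[of n] by (simp add: fourier_coeff_bump_comb[OF Y] norm_mult mult_left_mono)
    from power_mono[OF this, of 2] have c: "?c n \<le> ?m\<^sup>2 * ?a\<^sup>2" by (simp add: power_mult_distrib mult.commute)
    have "(norm n / R)\<^sup>2 \<le> 1" using n R by (intro power_le_one) (auto simp: divide_le_eq)
    then have "(1 - (norm n / R)\<^sup>2) * ?c n \<le> (1 - (norm n / R)\<^sup>2) * (?m\<^sup>2 * ?a\<^sup>2)"
      using c by (intro mult_left_mono) auto
    then show "(1 - (norm n / R)\<^sup>2) * ?c n \<le> ?m\<^sup>2 * ((1 - (norm n / R)\<^sup>2) * ?a\<^sup>2)"
      by (simp only: mult.left_commute)
  qed
  also have "\<dots> = ?m\<^sup>2 * ?A" by (simp add: sum_distrib_left)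
  finally show "?E * ?S \<le> ?m\<^sup>2 * ?A + \<epsilon>" by linarith
qed

lemma bump_mass_radial:
  assumes "\<And>r. 0 \<le> r \<Longrightarrow> r \<le> \<rho> \<Longrightarrow> (H has_real_derivative r ^ (CARD('n) - 1) * B (r\<^sup>2)) (at r within {0..\<rho>})"
  shows "bump_mass TYPE('n::finite) = CARD('n) * unit_ball_vol CARD('n) * (H \<rho> - H 0)"
proof -
  have "bump_mass TYPE('n) = (LINT x|cell_measure. (if torus_norm (x :: real ^ 'n) \<le> \<rho> then B ((torus_norm x)\<^sup>2) else 0))"
    unfolding bump_mass_def by (intro Bochner_Integration.integral_cong) (auto simp: bump_inside bump_eq_0)
  also have "\<dots> = CARD('n) * unit_ball_vol CARD('n) * (H \<rho> - H 0)"
    by (rule integral_radial_torus[where f = "\<lambda>r. B (r\<^sup>2)"])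
       (use \<rho> assms in \<open>auto intro!: continuous_on_compose2[OF B_cont[of UNIV]] continuous_intros\<close>)
  finally show ?thesis .
qed

lemma bump_energy_radial:
  assumes "R > 0" and H: "\<And>r. 0 \<le> r \<Longrightarrow> r \<le> \<rho> \<Longrightarrow>
    (H has_real_derivative r ^ (CARD('n) - 1) * ((B (r\<^sup>2))\<^sup>2 - 4 * r\<^sup>2 * (B' (r\<^sup>2))\<^sup>2 / (4 * pi\<^sup>2 * R\<^sup>2))) (at r within {0..\<rho>})"
  shows "bump_energy TYPE('n::finite) R = CARD('n) * unit_ball_vol CARD('n) * (H \<rho> - H 0)"
proof -
  let ?q = "4 * pi\<^sup>2 * R\<^sup>2"
  obtain D where D: "\<And>z :: real ^ 'n. \<bar>bump z\<bar> \<le> D" using bump_bounded by blast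
  have i1: "integrable cell_measure (\<lambda>z :: real ^ 'n. (bump z)\<^sup>2)"
    by (rule cell_integrable_bounded[of _ "D\<^sup>2"]) (use D in \<open>auto simp: abs_le_square_iff[symmetric] intro: order.trans[OF D abs_ge_self]\<close>)
  have i2: "integrable cell_measure (\<lambda>z :: real ^ 'n. (dbump i z)\<^sup>2)" for i
  proof -
    obtain G where G: "\<And>z :: real ^ 'n. \<bar>dbump i z\<bar> \<le> G" using dbump_bounded by blast
    show ?thesis by (rule cell_integrable_bounded[of _ "G\<^sup>2"]) (use G in \<open>auto simp: abs_le_square_iff[symmetric] intro: order.trans[OF G abs_ge_self]\<close>)
  qed
  let ?f = "\<lambda>r. (B (r\<^sup>2))\<^sup>2 - 4 * r\<^sup>2 * (B' (r\<^sup>2))\<^sup>2 / ?q"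
  have cont: "continuous_on {0..\<rho>} ?f"
    by (intro continuous_intros continuous_on_compose2[OF B_cont[of UNIV]] continuous_on_compose2[OF B'_cont])
       (use assms in auto)
  have "bump_energy TYPE('n) R = (LINT z|cell_measure. (bump (z :: real ^ 'n))\<^sup>2 - (\<Sum>i\<in>UNIV. (dbump i z)\<^sup>2) / ?q)"
    unfolding bump_energy_def using i1 i2 by (simp add: Bochner_Integration.integral_sum)
  also have "\<dots> = (LINT x|cell_measure. (if torus_norm (x :: real ^ 'n) \<le> \<rho> then ?f (torus_norm x) else 0))"
  proof (rule integral_cong_AE)
    show "(\<lambda>z :: real ^ 'n. (bump z)\<^sup>2 - (\<Sum>i\<in>UNIV. (dbump i z)\<^sup>2) / ?q) \<in> borel_measurable cell_measure" by measurable
    have [measurable]: "B \<in> borel_measurable borel" "B' \<in> borel_measurable borel"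
      by (intro borel_measurable_continuous_onI B'_cont B_cont)+
    show "(\<lambda>x :: real ^ 'n. if torus_norm x \<le> \<rho> then ?f (torus_norm x) else 0) \<in> borel_measurable cell_measure" by measurable
    show "AE z in cell_measure. (bump (z :: real ^ 'n))\<^sup>2 - (\<Sum>i\<in>UNIV. (dbump i z)\<^sup>2) / ?q
       = (if torus_norm z \<le> \<rho> then ?f (torus_norm z) else 0)"
      using AE_torus_norm_neq[of 0 \<rho>]
      by eventually_elim (auto simp: sum_dbump_square bump_inside bump_eq_0)
  qed
  also have "\<dots> = CARD('n) * unit_ball_vol CARD('n) * (H \<rho> - H 0)"
    by (rule integral_radial_torus[where f = ?f]) (use \<rho> H cont in auto)
  finally show ?thesis .
qed

end

section \<open>The frame bound of separated points\<close>

lemma surface_measure_unit_sphere: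
  "surface_measure (sphere 0 1 :: (real ^ 'n) set) = CARD('n) * unit_ball_vol CARD('n)"
proof -
  have "{r *\<^sub>R x | r (x :: real ^ 'n). 0 < r \<and> r \<le> 1 \<and> x \<in> sphere 0 1 \<inter> sphere 0 1} = cball 0 1 - {0}"
  proof (intro set_eqI iffI)
    fix z :: "real ^ 'n" assume "z \<in> cball 0 1 - {0}"
    then have "z = norm z *\<^sub>R (z /\<^sub>R norm z)" "0 < norm z" "norm z \<le> 1" "z /\<^sub>R norm z \<in> sphere 0 1" by auto
    then show "z \<in> {r *\<^sub>R x | r x. 0 < r \<and> r \<le> 1 \<and> x \<in> sphere 0 1 \<inter> sphere 0 1}" by blast
  qed auto
  moreover have "measure lebesgue (cball (0 :: real ^ 'n) 1 - {0}) = measure lebesgue (cball (0 :: real ^ 'n) 1)"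
    by (rule measure_Diff_null_set) auto
  moreover have "measure lebesgue (cball (0 :: real ^ 'n) 1) = unit_ball_vol CARD('n)"
    using content_cball[of 1 "0 :: real ^ 'n"] by (simp add: measure_completion)
  ultimately show ?thesis by (simp add: surface_measure_def)
qed

text \<open>
  The profile is \<open>1 - L(2 \<pi> R r) / L(\<beta>)\<close> with \<open>L(t) = t\<^sup>-\<^sup>\<mu> J\<^sub>\<mu>(t)\<close>, \<open>\<mu> = d/2 - 1\<close>, on the ball of radius
  \<open>\<rho> = \<beta> / (2 \<pi> R)\<close>, where \<open>\<beta>\<close> is the smaller of \<open>\<pi> \<alpha>\<close> and the first zero of \<open>J\<^sub>\<mu>\<^sub>+\<^sub>1\<close>. Up to that zero \<open>L\<close>
  decreases, and \<open>L(\<beta>) < 0\<close>, so the profile is nonnegative. Explicit primitives show that mass and energy coincide.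
  Their common value \<open>I\<close> turns \<open>bump_frame_bound\<close> into \<open>\<bar>u\<bar>\<^sup>2 / I \<le> \<dots>\<close>. For \<open>\<beta> = \<pi> \<alpha>\<close> below the zero, \<open>1 / I\<close> is
  exactly \<open>c(\<alpha>) R\<^sup>d\<close>; at the zero it is \<open>d\<close> times as large.
\<close>
lemma c_const_pos_and_frame_bound:
  fixes y :: "'i \<Rightarrow> real ^ 'n" and \<alpha> :: real
  assumes d2: "CARD('n) \<ge> 2" and \<alpha>: "\<alpha> > bessel_zero (real CARD('n) / 2 - 1) 1 / pi"
    and R: "R > 0" and small: "\<alpha> / R < 1" and Y: "finite Y"
    and sep: "\<And>j k. j \<in> Y \<Longrightarrow> k \<in> Y \<Longrightarrow> j \<noteq> k \<Longrightarrow> \<alpha> / R < torus_norm (y j - y k)"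
  shows "c_const TYPE('n) \<alpha> > 0"
    and "c_const TYPE('n) \<alpha> * R ^ CARD('n) * (\<Sum>k\<in>Y. (norm (u k))\<^sup>2)
      \<le> (\<Sum>n\<in>cball 0 R \<inter> integer_points. (1 - (norm n / R)\<^sup>2) * (norm (\<Sum>k\<in>Y. u k * cnj (wave n (y k))))\<^sup>2)"
proof -
  let ?d = "CARD('n)"
  define V where "V = unit_ball_vol ?d"
  define j0 where "j0 = bessel_zero (real ?d / 2 - 1) 1"
  define j1 where "j1 = bessel_zero (real ?d / 2) 1"
  define \<beta> where "\<beta> = min (pi * \<alpha>) j1"
  define \<kappa> where "\<kappa> = 2 * pi * R"
  define \<rho> where "\<rho> = \<beta> / \<kappa>"
  define f0 where "f0 = bessel_entire (real ?d / 2 - 1)"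
  define f1 where "f1 = bessel_entire (real ?d / 2)"
  have V: "V > 0" by (simp add: V_def)
  have nn: "real ?d / 2 - 1 \<ge> 0" using d2 by simp
  have j0: "j0 > 0" unfolding j0_def using bessel_zero_first(1)[OF nn] .
  have j01: "j0 < j1" unfolding j0_def j1_def by (rule bessel_zero_interlace[OF d2])
  have \<alpha>0: "j0 < pi * \<alpha>" using \<alpha> by (simp add: j0_def divide_less_eq mult.commute)
  have \<alpha>p: "\<alpha> > 0" using order.strict_trans[OF j0 \<alpha>0] by (simp add: zero_less_mult_iff)
  have \<beta>: "j0 < \<beta>" "\<beta> \<le> j1" "\<beta> \<le> pi * \<alpha>" using \<alpha>0 j01 by (auto simp: \<beta>_def)
  have \<beta>p: "\<beta> > 0" using \<beta> j0 by simp
  have \<kappa>: "\<kappa> > 0" using R by (simp add: \<kappa>_def)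
  have \<rho>p: "\<rho> > 0" using \<beta>p \<kappa> by (simp add: \<rho>_def)
  have \<rho>_le: "2 * \<rho> \<le> \<alpha> / R"
  proof -
    have "2 * \<rho> \<le> 2 * (pi * \<alpha> / \<kappa>)" unfolding \<rho>_def using \<beta>(3) \<kappa> by (intro mult_left_mono divide_right_mono) auto
    also have "\<dots> = \<alpha> / R" using R by (simp add: \<kappa>_def)
    finally show ?thesis .
  qed
  have \<kappa>\<rho>: "\<kappa> * \<rho> = \<beta>" using \<kappa> by (simp add: \<rho>_def)
  define e where "e = f0 (\<beta>\<^sup>2)"
  have e: "e < 0" unfolding e_def f0_def using bessel_entire_neg[OF d2] \<beta> by (simp add: j0_def j1_def)
  define B where "B s = 1 - f0 (\<kappa>\<^sup>2 * s) / e" for s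
  define B' where "B' s = \<kappa>\<^sup>2 * f1 (\<kappa>\<^sup>2 * s) / (2 * e)" for s
  have dB: "(B has_real_derivative B' s) (at s within A)" for s A
  proof -
    have l: "((\<lambda>s. \<kappa>\<^sup>2 * s) has_real_derivative \<kappa>\<^sup>2) (at s within A)" by (auto intro!: derivative_eq_intros)
    have "((\<lambda>s. 1 - f0 (\<kappa>\<^sup>2 * s) / e) has_real_derivative 0 - (- bessel_entire (real ?d / 2 - 1 + 1) (\<kappa>\<^sup>2 * s) / 2 * \<kappa>\<^sup>2) / e) (at s within A)"
      unfolding f0_def by (intro DERIV_diff DERIV_const DERIV_cdivide bessel_entire_deriv_chain[OF nn l])
    then show ?thesis unfolding B_def[abs_def] B'_def f1_def by (simp add: mult_ac)
  qed
  have prof: "radial_profile B B' \<rho>"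
  proof
    show "0 < \<rho>" by fact
    show "\<rho> < 1 / 2" using \<rho>_le small by simp
    show "(B has_real_derivative B' s) (at s)" for s by (rule dB)
    show "continuous_on UNIV B'" unfolding B'_def f1_def
      by (intro continuous_intros) (use e in auto)
    show "B (\<rho>\<^sup>2) = 0" using e \<kappa>\<rho> by (simp add: B_def e_def power_mult_distrib[symmetric])
    show "0 \<le> B s" if s: "0 \<le> s" "s \<le> \<rho>\<^sup>2" for s
    proof -
      define t where "t = \<kappa> * sqrt s"
      have ts: "t\<^sup>2 = \<kappa>\<^sup>2 * s" using s by (simp add: t_def power_mult_distrib)
      have t: "0 \<le> t" "t \<le> \<beta>"
      proof -
        show "0 \<le> t" using s \<kappa> by (simp add: t_def)
        have "sqrt s \<le> \<rho>" using s \<rho>p by (simp add: real_le_lsqrt)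
        then show "t \<le> \<beta>" unfolding t_def \<kappa>\<rho>[symmetric] using \<kappa> by (intro mult_left_mono) auto
      qed
      have "f0 (t\<^sup>2) \<ge> e"
        using bessel_entire_decreasing[OF d2 t(1), of \<beta>] t(2) \<beta>(2)
        by (cases "t = \<beta>") (auto simp: e_def f0_def j1_def)
      then have "f0 (\<kappa>\<^sup>2 * s) / e \<le> 1" using e by (simp add: ts divide_le_eq)
      then show ?thesis by (simp add: B_def)
    qed
  qed
  interpret radial_profile B B' \<rho> by (rule prof)
  define F where "F r = r ^ ?d * f1 ((\<kappa> * r)\<^sup>2)" for r
  have dF: "(F has_real_derivative r ^ (?d - 1) * f0 ((\<kappa> * r)\<^sup>2)) (at r within A)" for r A
    unfolding F_def[abs_def] f0_def f1_def by (rule bessel_entire_mono_deriv[OF d2])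
  have f0B: "f0 ((\<kappa> * r)\<^sup>2) / e = 1 - B (r\<^sup>2)" for r by (simp add: B_def power_mult_distrib)
  define H where "H r = r ^ ?d / ?d - F r / e" for r
  define I where "I = ?d * V * (\<rho> ^ ?d * (1 / ?d - f1 (\<beta>\<^sup>2) / e))"
  have dH: "(H has_real_derivative r ^ (?d - 1) * B (r\<^sup>2)) (at r within A)" for r A
  proof -
    have "((\<lambda>r. r ^ ?d / ?d) has_real_derivative r ^ (?d - 1)) (at r within A)"
      by (auto intro!: derivative_eq_intros)
    from DERIV_diff[OF this DERIV_cdivide[OF dF, of e]]
    have "(H has_real_derivative r ^ (?d - 1) - r ^ (?d - 1) * f0 ((\<kappa> * r)\<^sup>2) / e) (at r within A)"
      unfolding H_def[abs_def] .
    also have "r ^ (?d - 1) - r ^ (?d - 1) * f0 ((\<kappa> * r)\<^sup>2) / e = r ^ (?d - 1) * (1 - f0 ((\<kappa> * r)\<^sup>2) / e)"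
      by (simp add: right_diff_distrib)
    finally show ?thesis unfolding f0B by simp
  qed
  have H\<rho>: "H \<rho> - H 0 = \<rho> ^ ?d * (1 / ?d - f1 (\<beta>\<^sup>2) / e)"
    by (simp add: H_def F_def \<kappa>\<rho> right_diff_distrib zero_power)
  have mass: "bump_mass TYPE('n) = I"
    unfolding bump_mass_radial[where 'n = 'n, OF dH] H\<rho> by (simp add: I_def V_def)
  have energy: "bump_energy TYPE('n) R = I"
  proof -
    \<comment> \<open>Integration by parts, using that the flux \<open>F\<close> has derivative \<open>r\<^sup>d\<^sup>-\<^sup>1 (1 - B)\<close> up to the factor \<open>e\<close>; the boundary
      term vanishes at \<open>0\<close> and at \<open>\<rho>\<close>, so the primitives of energy and mass have equal increments.\<close>
    define H2 where "H2 r = H r - B (r\<^sup>2) * (F r / e)" for r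
    have "(H2 has_real_derivative r ^ (?d - 1) * ((B (r\<^sup>2))\<^sup>2 - 4 * r\<^sup>2 * (B' (r\<^sup>2))\<^sup>2 / (4 * pi\<^sup>2 * R\<^sup>2))) (at r within A)" for r A
    proof -
      have sq: "((\<lambda>r. r\<^sup>2) has_real_derivative 2 * r) (at r within A)" by (auto intro!: derivative_eq_intros)
      have "((\<lambda>r. B (r\<^sup>2)) has_real_derivative B' (r\<^sup>2) * (2 * r)) (at r within A)"
        by (rule DERIV_chain2[OF B_deriv sq])
      from DERIV_diff[OF dH DERIV_mult[OF this DERIV_cdivide[OF dF, of e]]]
      have "(H2 has_real_derivative r ^ (?d - 1) * B (r\<^sup>2) -
        (B' (r\<^sup>2) * (2 * r) * (F r / e) + r ^ (?d - 1) * f0 ((\<kappa> * r)\<^sup>2) / e * B (r\<^sup>2))) (at r within A)"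
        unfolding H2_def[abs_def] .
      also have "r ^ (?d - 1) * f0 ((\<kappa> * r)\<^sup>2) / e = r ^ (?d - 1) * (1 - B (r\<^sup>2))"
        by (simp flip: f0B)
      also have "F r / e = r ^ (?d - 1) * r * (2 * B' (r\<^sup>2) / \<kappa>\<^sup>2)"
      proof -
        have "r ^ ?d = r ^ (?d - 1) * r" by (simp flip: power_Suc2)
        then show ?thesis using \<kappa> by (simp add: F_def B'_def power_mult_distrib)
      qed
      also have "r ^ (?d - 1) * B (r\<^sup>2) - (B' (r\<^sup>2) * (2 * r) * (r ^ (?d - 1) * r * (2 * B' (r\<^sup>2) / \<kappa>\<^sup>2)) + r ^ (?d - 1) * (1 - B (r\<^sup>2)) * B (r\<^sup>2))
        = r ^ (?d - 1) * ((B (r\<^sup>2))\<^sup>2 - 4 * r\<^sup>2 * (B' (r\<^sup>2))\<^sup>2 / \<kappa>\<^sup>2)"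
        by (simp add: algebra_simps power2_eq_square)
      finally show ?thesis by (simp add: \<kappa>_def power_mult_distrib)
    qed
    then have "bump_energy TYPE('n) R = ?d * unit_ball_vol ?d * (H2 \<rho> - H2 0)"
      by (intro bump_energy_radial R)
    also have "H2 \<rho> - H2 0 = H \<rho> - H 0"
      using B_boundary by (simp add: H2_def F_def zero_power)
    finally show ?thesis unfolding H\<rho> by (simp add: I_def V_def)
  qed
  have f1: "f1 (\<beta>\<^sup>2) \<ge> 0"
    using bessel_zero_first(2,3)[of "real ?d / 2"] \<beta>(2) \<beta>p
    by (cases "\<beta> = j1") (auto simp: f1_def j1_def less_le)
  have I: "I > 0"
  proof -
    have "f1 (\<beta>\<^sup>2) / e \<le> 0" using e f1 by (simp add: divide_nonneg_neg)
    moreover have "1 / real ?d > 0" by simp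
    ultimately have "1 / ?d - f1 (\<beta>\<^sup>2) / e > 0" by linarith
    then show ?thesis using V \<rho>p by (simp add: I_def)
  qed
  have c: "0 < c_const TYPE('n) \<alpha> \<and> c_const TYPE('n) \<alpha> * R ^ ?d \<le> 1 / I"
  proof (cases "\<alpha> < j1 / pi")
    case True
    then have lt: "pi * \<alpha> < j1" by (simp add: less_divide_eq mult.commute)
    then have \<beta>e: "\<beta> = pi * \<alpha>" by (simp add: \<beta>_def)
    have f1p: "f1 (\<beta>\<^sup>2) > 0"
      using bessel_zero_first(3)[of "real ?d / 2" \<beta>] lt \<beta>p by (simp add: f1_def j1_def \<beta>e)
    define g where "g = - e / f1 (\<beta>\<^sup>2)"
    have g: "g > 0" unfolding g_def by (rule divide_pos_pos) (use e f1p in auto)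
    have "gamma_const ?d \<alpha> = g"
    proof -
      have "bessel_J (real ?d / 2 - 1) \<beta> = \<beta> powr (real ?d / 2 - 1) * e"
        using bessel_J_entire[OF \<beta>p nn] by (simp add: e_def f0_def)
      moreover have "bessel_J (real ?d / 2) \<beta> = \<beta> powr (real ?d / 2 - 1) * \<beta> * f1 (\<beta>\<^sup>2)"
      proof -
        have "\<beta> powr (real ?d / 2) = \<beta> powr (real ?d / 2 - 1 + 1)" by simp
        also have "\<dots> = \<beta> powr (real ?d / 2 - 1) * \<beta>" using \<beta>p by (subst powr_add) simp
        finally show ?thesis using bessel_J_entire[OF \<beta>p, of "real ?d / 2"] by (simp add: f1_def)
      qed
      ultimately show ?thesis unfolding gamma_const_def using \<beta>p f1p
        by (simp flip: \<beta>e) (simp add: g_def field_simps)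
    qed
    then have "c_const TYPE('n) \<alpha> = 1 / (?d * V) * (2 / \<alpha>) ^ ?d * (g / (1 + g / ?d))"
      using True unfolding c_const_def Let_def surface_measure_unit_sphere V_def[symmetric] j1_def[symmetric] by simp
    moreover have "I = ?d * V * (\<alpha> / (2 * R)) ^ ?d * (1 / ?d + 1 / g)"
    proof -
      have "\<rho> = \<alpha> / (2 * R)" by (simp add: \<rho>_def \<kappa>_def \<beta>e)
      moreover have "f1 (\<beta>\<^sup>2) / e = - (1 / g)" using e by (simp add: g_def)
      ultimately show ?thesis by (simp add: I_def)
    qed
    moreover have "1 / (?d * V) * (2 / \<alpha>) ^ ?d * (g / (1 + g / ?d)) * R ^ ?d = 1 / (?d * V * (\<alpha> / (2 * R)) ^ ?d * (1 / ?d + 1 / g))"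
    proof -
      have "g / (1 + g / ?d) = 1 / (1 / ?d + 1 / g)" using g by (simp add: field_simps)
      moreover have "(2 / \<alpha>) ^ ?d * R ^ ?d = 1 / (\<alpha> / (2 * R)) ^ ?d"
        by (simp add: power_divide power_mult_distrib)
      ultimately show ?thesis by (simp add: mult_ac)
    qed
    ultimately show ?thesis using g V \<alpha>p by (auto intro!: mult_pos_pos divide_pos_pos add_pos_pos)
  next
    case False
    then have "j1 \<le> pi * \<alpha>" by (simp add: not_less pos_divide_le_eq mult.commute)
    then have \<beta>e: "\<beta> = j1" by (simp add: \<beta>_def min_absorb2)
    have j1p: "j1 > 0" using \<beta>p \<beta>e by simp
    have ce: "c_const TYPE('n) \<alpha> = 1 / (?d * V) * (2 * pi / j1) ^ ?d"
      using False unfolding c_const_def Let_def surface_measure_unit_sphere V_def[symmetric] j1_def[symmetric] by simp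
    have "f1 (\<beta>\<^sup>2) = 0" using bessel_zero_first(2)[of "real ?d / 2"] by (simp add: \<beta>e f1_def j1_def)
    then have "I = V * (j1 / (2 * pi * R)) ^ ?d" by (simp add: I_def \<rho>_def \<kappa>_def \<beta>e)
    then have "1 / I = 1 / V * ((2 * pi / j1) ^ ?d * R ^ ?d)"
      by (simp add: power_divide power_mult_distrib)
    moreover have "1 / (?d * V) \<le> 1 / V" using V by (simp add: divide_simps)
    then have "1 / (?d * V) * ((2 * pi / j1) ^ ?d * R ^ ?d) \<le> 1 / V * ((2 * pi / j1) ^ ?d * R ^ ?d)"
      using j1p R by (intro mult_right_mono) auto
    ultimately show ?thesis using V j1p by (simp add: ce mult.assoc)
  qed
  then show "c_const TYPE('n) \<alpha> > 0" by blast
  let ?S = "\<Sum>k\<in>Y. (norm (u k))\<^sup>2"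
  let ?A = "\<Sum>n\<in>cball 0 R \<inter> integer_points. (1 - (norm n / R)\<^sup>2) * (norm (\<Sum>k\<in>Y. u k * cnj (wave n (y k))))\<^sup>2"
  have "I * ?S \<le> I\<^sup>2 * ?A"
    using bump_frame_bound[OF Y R, of y u] sep \<rho>_le unfolding mass energy by (meson order.strict_trans1)
  then have "I * ?S \<le> I * (I * ?A)" by (simp add: power2_eq_square mult.assoc)
  then have "?S \<le> I * ?A" using I by simp
  then have "?S * (1 / I) \<le> ?A" using I by (simp add: divide_le_eq mult.commute)
  moreover have "c_const TYPE('n) \<alpha> * R ^ ?d * ?S \<le> 1 / I * ?S"
    using c by (intro mult_right_mono) (auto simp: sum_nonneg)
  ultimately show "c_const TYPE('n) \<alpha> * R ^ ?d * ?S \<le> ?A" by (simp add: mult.commute)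
qed

section \<open>Interpolation, colouring and separating frequencies\<close>

text \<open>
  The operator \<open>G\<close> of the weighted Gram matrix is injective by the frame bound, hence surjective. The
  interpolant is the synthesis of the weighted analysis of a solution of \<open>G u = e\<^sub>k\<close>. Its weighted norm is the quadratic
  form at \<open>u\<close>, at most \<open>1 / C\<close>, and Cauchy-Schwarz with the weights bounds the supremum.
\<close>
lemma interpolation_from_frame_bound:
  fixes y :: "'s::finite \<Rightarrow> real ^ 'n" and w :: "real ^ 'n \<Rightarrow> real"
  assumes k: "k \<in> Y" and w: "\<And>n. n \<in> P \<Longrightarrow> w n \<ge> 0" and C: "C > 0"
    and frame: "\<And>u. C * (\<Sum>j\<in>Y. (norm (u j))\<^sup>2)
      \<le> (\<Sum>n\<in>P. w n * (norm (\<Sum>j\<in>Y. u j * cnj (wave n (y j))))\<^sup>2)"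
  obtains c where "\<And>j. j \<in> Y \<Longrightarrow> trig_sum P c (y j) = (if j = k then 1 else 0)"
    and "\<And>x. norm (trig_sum P c x) \<le> sqrt ((\<Sum>n\<in>P. w n) / C)"
proof -
  define a where "a u n = (\<Sum>j\<in>Y. u $ j * cnj (wave n (y j)))" for u :: "complex ^ 's" and n
  define G :: "complex ^ 's \<Rightarrow> complex ^ 's" where
    "G u = (\<chi> i. if i \<in> Y then \<Sum>n\<in>P. of_real (w n) * a u n * wave n (y i) else u $ i)" for u
  have a_add: "a (u + v) n = a u n + a v n" for u v n
    by (simp add: a_def distrib_right sum.distrib)
  have a_scale: "a (c *\<^sub>R u) n = c *\<^sub>R a u n" for c u n
    by (simp add: a_def scaleR_sum_right)
  have linG: "linear G"
    by (rule linearI)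
       (simp_all add: G_def vec_eq_iff a_add a_scale distrib_left distrib_right sum.distrib scaleR_sum_right)
  have quad: "(\<Sum>i\<in>Y. cnj (u $ i) * (G u $ i)) = of_real (\<Sum>n\<in>P. w n * (norm (a u n))\<^sup>2)" for u
  proof -
    have "(\<Sum>i\<in>Y. cnj (u $ i) * (G u $ i)) = (\<Sum>i\<in>Y. \<Sum>n\<in>P. of_real (w n) * a u n * (cnj (u $ i) * wave n (y i)))"
      by (intro sum.cong refl) (simp add: G_def sum_distrib_left mult_ac)
    also have "\<dots> = (\<Sum>n\<in>P. of_real (w n) * a u n * (\<Sum>i\<in>Y. cnj (u $ i) * wave n (y i)))"
      by (subst sum.swap) (simp add: sum_distrib_left)
    also have "\<dots> = (\<Sum>n\<in>P. of_real (w n) * (a u n * cnj (a u n)))"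
      by (simp add: a_def mult.assoc)
    finally show ?thesis by (simp only: of_real_sum of_real_mult complex_norm_square)
  qed
  have injG: "inj G"
  proof (subst linear_injective_0[OF linG], intro allI impI)
    fix u assume u: "G u = 0"
    have off: "u $ i = 0" if "i \<notin> Y" for i
    proof -
      have "G u $ i = u $ i" using that by (simp add: G_def)
      then show ?thesis using u by simp
    qed
    have "of_real (\<Sum>n\<in>P. w n * (norm (a u n))\<^sup>2) = (0 :: complex)"
      unfolding quad[symmetric] u by simp
    then have "(\<Sum>n\<in>P. w n * (norm (a u n))\<^sup>2) = 0" by (simp only: of_real_eq_0_iff)
    then have "C * (\<Sum>j\<in>Y. (norm (u $ j))\<^sup>2) \<le> 0" using frame[of "\<lambda>j. u $ j"] by (simp add: a_def)
    then have "(\<Sum>j\<in>Y. (norm (u $ j))\<^sup>2) \<le> 0" using C by (simp add: mult_le_0_iff)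
    then have "(\<Sum>j\<in>Y. (norm (u $ j))\<^sup>2) = 0" by (intro antisym sum_nonneg) auto
    then have "u $ j = 0" if "j \<in> Y" for j using that by (simp add: sum_nonneg_eq_0_iff)
    then show "u = 0" using off by (auto simp: vec_eq_iff)
  qed
  then have "surj G" using linear_injective_imp_surjective[OF linG] by blast
  then obtain u where u: "G u = axis k 1" by (metis surj_def)
  define c where "c n = of_real (w n) * a u n" for n
  define q where "q = (\<Sum>n\<in>P. w n * (norm (a u n))\<^sup>2)"
  have interp: "trig_sum P c (y j) = (if j = k then 1 else 0)" if "j \<in> Y" for j
  proof -
    have "trig_sum P c (y j) = G u $ j" using that by (simp add: trig_sum_def c_def G_def)
    then show ?thesis by (simp add: u axis_def)
  qed
  have "of_real q = (\<Sum>i\<in>Y. cnj (u $ i) * (if i = k then 1 else 0))"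
    unfolding q_def quad[symmetric] u by (intro sum.cong) (auto simp: axis_def)
  also have "\<dots> = cnj (u $ k)" using k by (simp add: if_distrib[of "(*) _"] cong: if_cong)
  finally have "norm (of_real q :: complex) = norm (u $ k)" by simp
  moreover have q0: "q \<ge> 0" unfolding q_def using w by (intro sum_nonneg) auto
  ultimately have uk: "norm (u $ k) = q" by simp
  have "C * q\<^sup>2 \<le> C * (\<Sum>j\<in>Y. (norm (u $ j))\<^sup>2)"
    using C k by (auto simp: uk[symmetric] intro!: mult_left_mono member_le_sum)
  also have "\<dots> \<le> q" using frame[of "\<lambda>j. u $ j"] by (simp add: q_def a_def)
  finally have "C * q\<^sup>2 \<le> q" .
  then have q1: "q \<le> 1 / C"
  proof (cases "q = 0")
    case False
    then have "q > 0" using q0 by simp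
    moreover have "(C * q) * q \<le> 1 * q" using \<open>C * q\<^sup>2 \<le> q\<close> by (simp add: power2_eq_square mult.assoc)
    ultimately have "C * q \<le> 1" by (rule mult_right_le_imp_le[rotated])
    then show ?thesis using C by (simp add: le_divide_eq mult.commute)
  qed (use C in simp)
  have "norm (trig_sum P c x) \<le> sqrt ((\<Sum>n\<in>P. w n) / C)" for x
  proof -
    have "norm (trig_sum P c x) \<le> (\<Sum>n\<in>P. norm (c n))" by (rule norm_trig_sum)
    also have "\<dots> = (\<Sum>n\<in>P. \<bar>sqrt (w n)\<bar> * \<bar>sqrt (w n) * norm (a u n)\<bar>)"
      using w by (intro sum.cong) (simp_all add: c_def norm_mult abs_mult mult.assoc[symmetric])
    also have "\<dots> \<le> L2_set (\<lambda>n. sqrt (w n)) P * L2_set (\<lambda>n. sqrt (w n) * norm (a u n)) P"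
      by (rule L2_set_mult_ineq)
    also have "\<dots> = sqrt (\<Sum>n\<in>P. w n) * sqrt q"
      using w by (simp add: L2_set_def q_def power_mult_distrib)
    also have "\<dots> \<le> sqrt (\<Sum>n\<in>P. w n) * sqrt (1 / C)"
      using q1 w by (intro mult_left_mono) (auto intro: sum_nonneg)
    also have "\<dots> = sqrt ((\<Sum>n\<in>P. w n) / C)" by (simp flip: real_sqrt_mult)
    finally show ?thesis .
  qed
  with interp that show ?thesis by blast
qed

text \<open>
  A new vertex has fewer than \<open>n\<close> neighbours, so one of the \<open>n\<close> colours is free.
\<close>
lemma greedy_colouring:
  assumes "finite V" and sym: "\<And>v w. E v w \<Longrightarrow> E w v"
    and deg: "\<And>v. v \<in> V \<Longrightarrow> card {w \<in> V. w \<noteq> v \<and> E v w} < n"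
  shows "\<exists>col. (\<forall>v\<in>V. col v < (n::nat)) \<and> (\<forall>v\<in>V. \<forall>w\<in>V. v \<noteq> w \<longrightarrow> E v w \<longrightarrow> col v \<noteq> col w)"
  using assms(1) deg
proof (induction V rule: finite_induct)
  case (insert z V)
  have "card {w \<in> V. w \<noteq> v \<and> E v w} < n" if "v \<in> V" for v
    by (rule le_less_trans[OF card_mono insert.prems[of v]]) (use insert.hyps that in auto)
  then have "\<exists>col. (\<forall>v\<in>V. col v < n) \<and> (\<forall>v\<in>V. \<forall>w\<in>V. v \<noteq> w \<longrightarrow> E v w \<longrightarrow> col v \<noteq> col w)"
    by (rule insert.IH)
  then obtain col where
    col: "\<forall>v\<in>V. col v < n" "\<forall>v\<in>V. \<forall>w\<in>V. v \<noteq> w \<longrightarrow> E v w \<longrightarrow> col v \<noteq> col w"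
    by (elim exE conjE)
  let ?N = "{w \<in> insert z V. w \<noteq> z \<and> E z w}"
  have "card (col ` ?N) < n"
    using card_image_le[of ?N col] insert.prems[of z] insert.hyps by simp
  then have "\<not> {..<n} \<subseteq> col ` ?N"
    using card_mono[of "col ` ?N" "{..<n}"] insert.hyps by auto
  then obtain m where m: "m < n" "m \<notin> col ` ?N" by blast
  have m2: "m \<noteq> col w" if "w \<in> V" "E z w" for w using m(2) that insert.hyps by auto
  show ?case
  proof (intro exI[of _ "col(z := m)"] conjI ballI impI)
    fix v w assume vw: "v \<in> insert z V" "w \<in> insert z V" "v \<noteq> w" "E v w"
    show "(col(z := m)) v \<noteq> (col(z := m)) w"
    proof (cases "v = z")
      case True
      then show ?thesis using vw m2[of w] by auto
    next
      case False
      then show ?thesis using vw m2[of v] sym[OF vw(4)] col(2) by (cases "w = z") auto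
    qed
  qed (use col m in auto)
qed simp

lemma sin_concave_bound:
  fixes T :: real
  assumes "0 \<le> T" "T \<le> 1"
  shows "sin (pi / 4 * T) \<ge> T * (sqrt 2 / 2)"
proof -
  have "concave_on {0..pi} sin"
    by (rule f''_le0_imp_concave[where f' = cos and f'' = "\<lambda>x. - sin x"])
       (auto intro!: derivative_eq_intros simp: sin_ge_zero)
  then have "sin ((1 - T) *\<^sub>R 0 + T *\<^sub>R (pi / 4)) \<ge> (1 - T) * sin 0 + T * sin (pi / 4)"
    using concave_onD[of "{0..pi}" sin T 0 "pi / 4"] assms by simp
  then show ?thesis by (simp add: sin_45 mult.commute)
qed

lemma sin_pi_lower:
  fixes T \<theta> :: real
  assumes "0 \<le> T" "T \<le> 1" "T / 4 \<le> \<theta>" "\<theta> \<le> 1 / 2"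
  shows "2 * sin (pi * \<theta>) \<ge> sqrt 2 * T"
proof -
  have "sin (pi / 4 * T) \<le> sin (pi * \<theta>)"
  proof (rule sin_monotone_2pi_le)
    have "pi * (T / 4) \<le> pi * \<theta>" using assms by (intro mult_left_mono) auto
    then show "pi / 4 * T \<le> pi * \<theta>" by simp
    have "pi * \<theta> \<le> pi * (1 / 2)" using assms by (intro mult_left_mono) auto
    then show "pi * \<theta> \<le> pi / 2" by simp
    have "0 \<le> pi / 4 * T" using assms by simp
    then show "- (pi / 2) \<le> pi / 4 * T" using pi_gt_zero by linarith
  qed
  then show ?thesis using sin_concave_bound[OF assms(1,2)] by (simp add: mult.commute)
qed

lemma norm_wave_minus_one: "norm (wave n x - 1) = 2 * \<bar>sin (pi * (n \<bullet> x))\<bar>"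
proof -
  have "(norm (cis (2 * t) - 1))\<^sup>2 = (2 * sin t)\<^sup>2" for t
  proof -
    have "(norm (cis (2 * t) - 1))\<^sup>2 = (cos (2 * t) - 1)\<^sup>2 + (sin (2 * t))\<^sup>2" by (simp add: cmod_power2)
    also have "\<dots> = (2 * (sin t)\<^sup>2)\<^sup>2 + (2 * sin t * cos t)\<^sup>2"
      by (simp add: cos_double_sin sin_double power2_eq_square)
    also have "\<dots> = 4 * (sin t)\<^sup>2 * ((sin t)\<^sup>2 + (cos t)\<^sup>2)"
    proof -
      have "(2 * s\<^sup>2)\<^sup>2 + (2 * s * c)\<^sup>2 = 4 * s\<^sup>2 * (s\<^sup>2 + c\<^sup>2)" for s c :: real
        by (simp add: power2_eq_square algebra_simps)
      then show ?thesis .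
    qed
    also have "\<dots> = (2 * sin t)\<^sup>2" by (simp add: power_mult_distrib)
    finally show ?thesis .
  qed
  from this[of "pi * (n \<bullet> x)"] have "(norm (wave n x - 1))\<^sup>2 = (2 * \<bar>sin (pi * (n \<bullet> x))\<bar>)\<^sup>2"
    by (simp add: wave_def mult.assoc power_mult_distrib)
  then show ?thesis by (rule power2_eq_imp_eq) auto
qed

lemma norm_diff_nearest_int: "norm (x - nearest_int x) \<le> sqrt (CARD('n)) / 2" for x :: "real ^ 'n"
proof -
  have "(norm (x - nearest_int x))\<^sup>2 \<le> (sqrt (CARD('n)) / 2)\<^sup>2"
    using norm_unit_cell[OF nearest_int_in_cell[of x]] by (simp add: power_divide)
  then show ?thesis by (rule power2_le_imp_le) simp
qed

text \<open>
  Choose \<open>n\<close> as the integer point nearest to a suitable multiple of the shortest representative of \<open>\<delta>\<close>. The length of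
  the multiple is \<open>3 r / 4\<close> for small \<open>\<delta>\<close>, and otherwise such that its inner product with \<open>\<delta>\<close> is \<open>3/8\<close>. Rounding
  moves the frequency by at most half the square root of \<open>d\<close>, hence by at most \<open>r / 4\<close>, and the inner product by a third of
  its value at most; it stays at most \<open>1/2\<close>, where the sine is bounded below by concavity.
\<close>
lemma separating_frequency:
  fixes \<delta> :: "real ^ 'n"
  assumes t: "0 < torus_norm \<delta>" "torus_norm \<delta> \<le> 1 / (4 * sqrt CARD('n))" and r: "r \<ge> 2 * sqrt CARD('n)"
  obtains n where "n \<in> integer_points" "norm n \<le> r"
    "norm (wave n \<delta> - 1) \<ge> sqrt 2 * min 1 (2 * r * torus_norm \<delta>)"
proof -
  let ?D = "sqrt (real CARD('n))"
  define v where "v = \<delta> - nearest_int \<delta>"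
  define t where "t = torus_norm \<delta>"
  have tv: "norm v = t" by (simp add: v_def t_def torus_norm_nearest)
  have tp: "t > 0" using assms by (simp add: t_def)
  have D: "?D > 0" by simp
  have rp: "r > 0" using r D by linarith
  define l where "l = (if 2 * r * t \<le> 1 then 3 * r / 4 else 3 / (8 * t))"
  have l: "0 \<le> l" "l \<le> 3 * r / 4"
    using rp tp by (auto simp: l_def divide_simps mult_ac)
  define n where "n = nearest_int ((l / t) *\<^sub>R v)"
  define err where "err = (l / t) *\<^sub>R v - n"
  have err: "norm err \<le> ?D / 2" unfolding err_def n_def by (rule norm_diff_nearest_int)
  have nZ: "n \<in> integer_points" by (simp add: n_def)
  have nv: "n \<bullet> v = l * t - err \<bullet> v"
  proof -
    have "((l / t) *\<^sub>R v) \<bullet> v = l * t" using tp by (simp add: tv power2_norm_eq_inner[symmetric]) (simp add: power2_eq_square tv)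
    then show ?thesis by (simp add: err_def inner_diff_left)
  qed
  have ev: "\<bar>err \<bullet> v\<bar> \<le> ?D / 2 * t"
  proof -
    have "norm err * t \<le> ?D / 2 * t" by (rule mult_right_mono[OF err]) (use tp in simp)
    then show ?thesis using Cauchy_Schwarz_ineq2[of err v] unfolding tv by linarith
  qed
  have "norm n \<le> r"
  proof -
    have "n = (l / t) *\<^sub>R v - err" by (simp add: err_def)
    then have "norm n \<le> norm ((l / t) *\<^sub>R v) + norm err" by (metis norm_triangle_ineq4)
    also have "norm ((l / t) *\<^sub>R v) = l" using l tp by (simp add: tv)
    finally show ?thesis using l(2) err r by linarith
  qed
  moreover have "norm (wave n \<delta> - 1) \<ge> sqrt 2 * min 1 (2 * r * t)"
  proof -
    have "wave n \<delta> = wave n v"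
      unfolding v_def using nZ by (simp add: wave_diff wave_integer)
    then have eq: "norm (wave n \<delta> - 1) = 2 * \<bar>sin (pi * (n \<bullet> v))\<bar>" by (simp add: norm_wave_minus_one)
    let ?T = "min 1 (2 * r * t)"
    have "?T / 4 \<le> n \<bullet> v \<and> n \<bullet> v \<le> 1 / 2"
    proof (cases "2 * r * t \<le> 1")
      case True
      have "?D / 2 * t \<le> r / 4 * t" using r tp by (intro mult_right_mono) auto
      from order.trans[OF ev this] have "\<bar>err \<bullet> v\<bar> \<le> r * t / 4" by simp
      moreover have "l * t = 3 * (r * t) / 4" using True by (simp add: l_def)
      ultimately have "r * t / 2 \<le> n \<bullet> v" "n \<bullet> v \<le> r * t" unfolding nv by linarith+
      then show ?thesis using True by (simp add: min_def)
    next
      case False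
      have "?D / 2 * t \<le> ?D / 2 * (1 / (4 * ?D))" using assms(2) D by (intro mult_left_mono) (auto simp: t_def)
      also have "\<dots> = 1 / 8" using D by simp
      finally have "\<bar>err \<bullet> v\<bar> \<le> 1 / 8" using ev by linarith
      moreover have "l * t = 3 / 8" using False tp by (simp add: l_def)
      ultimately have "1 / 4 \<le> n \<bullet> v" "n \<bullet> v \<le> 1 / 2" unfolding nv by linarith+
      then show ?thesis using False by (simp add: min_def)
    qed
    then have "sqrt 2 * ?T \<le> 2 * sin (pi * (n \<bullet> v))"
      using rp tp by (intro sin_pi_lower) auto
    then show ?thesis unfolding eq by linarith
  qed
  ultimately show ?thesis using that nZ by (simp add: t_def)
qed

definition band_limited :: "real \<Rightarrow> (real ^ 'n \<Rightarrow> complex) \<Rightarrow> bool" where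
  "band_limited \<sigma> f \<longleftrightarrow> (\<exists>K a. finite K \<and> K \<subseteq> integer_points \<inter> cball 0 \<sigma> \<and> f = trig_sum K a)"

lemma band_limited_mono: "band_limited \<sigma> f \<Longrightarrow> \<sigma> \<le> \<sigma>' \<Longrightarrow> band_limited \<sigma>' f"
  unfolding band_limited_def using subset_cball[of \<sigma> \<sigma>' 0] by (elim exE) (intro exI, auto)

lemma band_limited_one: "band_limited 0 (\<lambda>x. 1)"
  unfolding band_limited_def by (intro exI[of _ "{0}"] exI[of _ "\<lambda>_. 1"]) (auto simp: trig_sum_def)

lemma band_limited_mult:
  assumes "band_limited \<sigma> f" "band_limited \<sigma>' g"
  shows "band_limited (\<sigma> + \<sigma>') (\<lambda>x. f x * g x)"
proof -
  obtain K a L b where K: "finite K" "K \<subseteq> integer_points \<inter> cball 0 \<sigma>" "f = trig_sum K a"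
    and L: "finite L" "L \<subseteq> integer_points \<inter> cball 0 \<sigma>'" "g = trig_sum L b"
    using assms unfolding band_limited_def by blast
  let ?s = "\<lambda>p. fst p + snd p"
  define c where "c w = (\<Sum>p\<in>{p \<in> K \<times> L. ?s p = w}. a (fst p) * b (snd p))" for w
  have "f x * g x = trig_sum (?s ` (K \<times> L)) c x" for x
  proof -
    have "f x * g x = (\<Sum>p\<in>K \<times> L. a (fst p) * b (snd p) * wave (?s p) x)"
      by (simp add: K L trig_sum_def sum_product sum.cartesian_product wave_add_freq mult_ac split_beta)
    also have "\<dots> = (\<Sum>w\<in>?s ` (K \<times> L). \<Sum>p\<in>{p \<in> K \<times> L. ?s p = w}. a (fst p) * b (snd p) * wave (?s p) x)"
      using K L by (intro sum.image_gen) auto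
    also have "\<dots> = trig_sum (?s ` (K \<times> L)) c x"
      by (auto simp: trig_sum_def c_def sum_distrib_right intro!: sum.cong)
    finally show ?thesis .
  qed
  moreover have "?s ` (K \<times> L) \<subseteq> integer_points \<inter> cball 0 (\<sigma> + \<sigma>')"
  proof
    fix z assume "z \<in> ?s ` (K \<times> L)"
    then obtain p q where z: "z = p + q" "p \<in> K" "q \<in> L" by auto
    then have "norm z \<le> \<sigma> + \<sigma>'" using K L norm_triangle_ineq[of p q] by (force simp: subset_iff)
    then show "z \<in> integer_points \<inter> cball 0 (\<sigma> + \<sigma>')" using z K L by (auto intro!: integer_points_closed(2))
  qed
  ultimately show ?thesis unfolding band_limited_def using K L
    by (intro exI[of _ "?s ` (K \<times> L)"] exI[of _ c]) auto
qed

lemma band_limited_prod: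
  assumes "finite I" "\<And>i. i \<in> I \<Longrightarrow> band_limited (\<sigma> i) (f i)"
  shows "band_limited (\<Sum>i\<in>I. \<sigma> i) (\<lambda>x. \<Prod>i\<in>I. f i x)"
  using assms by (induction I rule: finite_induct) (auto intro: band_limited_one band_limited_mult)

lemma band_limited_separating_factor:
  fixes a b :: "real ^ 'n"
  assumes "0 < torus_norm (a - b)" "torus_norm (a - b) \<le> 1 / (4 * sqrt CARD('n))" "r \<ge> 2 * sqrt CARD('n)"
  obtains f where "band_limited r f" "f a = 1" "f b = 0"
    "\<And>x. norm (f x) \<le> sqrt 2 / min 1 (2 * r * torus_norm (a - b))"
proof -
  from separating_frequency[OF assms] obtain n where n: "n \<in> integer_points" "norm n \<le> r"
    "norm (wave n (a - b) - 1) \<ge> sqrt 2 * min 1 (2 * r * torus_norm (a - b))" by blast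
  let ?m = "min 1 (2 * r * torus_norm (a - b))" and ?D = "wave n (a - b) - 1"
  have r: "r > 0" using assms(3) by (smt (verit) real_sqrt_gt_zero of_nat_0_less_iff zero_less_card_finite)
  have m: "?m > 0" using r assms(1) by simp
  then have "sqrt 2 * ?m > 0" by simp
  then have D0: "norm ?D > 0" using n(3) by linarith
  define f where "f x = (wave n (x - b) - 1) / ?D" for x
  have n0: "n \<noteq> 0" using D0 by auto
  have "f = trig_sum {0, n} (\<lambda>k. if k = 0 then - 1 / ?D else cnj (wave n b) / ?D)"
    using n0 by (auto simp: f_def trig_sum_def wave_diff divide_simps fun_eq_iff)
  then have "band_limited r f" unfolding band_limited_def
    using n r by (intro exI[of _ "{0, n}"] exI conjI) auto
  moreover have "f a = 1" "f b = 0" using D0 by (auto simp: f_def)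
  moreover have "norm (f x) \<le> sqrt 2 / ?m" for x
  proof -
    have "norm (wave n (x - b) - 1) \<le> 2" using norm_triangle_ineq4[of "wave n (x - b)" 1] by simp
    then have "norm (f x) \<le> 2 / norm ?D" using D0 by (simp add: f_def norm_divide divide_right_mono)
    also have "\<dots> \<le> 2 / (sqrt 2 * ?m)" using n(3) m by (intro divide_left_mono) (auto intro!: mult_pos_pos D0)
    also have "\<dots> = sqrt 2 / ?m" using m by (simp add: real_div_sqrt field_simps)
    finally show ?thesis .
  qed
  ultimately show ?thesis using that by blast
qed

section \<open>Lagrange functions and lower bounds on shifted lattices\<close>

lemma bessel_zero_pi_pos: "d \<ge> 2 \<Longrightarrow> bessel_zero (real d / 2 - 1) 1 / pi > 0"
  using bessel_zero_first(1)[of "real d / 2 - 1"] by simp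

lemma ball_weight_nonneg: "R > 0 \<Longrightarrow> n \<in> cball 0 R \<Longrightarrow> 1 - (norm n / R)\<^sup>2 \<ge> 0"
  using power_le_one[of "norm n / R" 2] by (simp add: divide_le_eq)

lemma separation_lt_1:
  assumes "CARD('n::finite) \<ge> 2" "t \<le> 1 / (4 * sqrt (real CARD('n)))"
  shows "t < 1"
proof -
  have "sqrt (real CARD('n)) \<ge> 1" using assms(1) by simp
  then have "1 / (4 * sqrt (real CARD('n))) \<le> 1 / (4 * 1)" by (intro divide_left_mono) auto
  with assms(2) show ?thesis by linarith
qed

text \<open>
  The points within distance \<open>\<alpha> / R\<close> of \<open>y\<^sub>k\<close> receive one separating factor each. The others are coloured such that
  equal colours are farther apart than \<open>\<alpha> / R\<close>; every colour class, enlarged by \<open>y\<^sub>k\<close>, is then separated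
  and receives one interpolating factor. A nearby point at distance more than \<open>1 / (2 r)\<close> costs only the factor
  \<open>\<surd>2\<close>, so only the points within \<open>1 / (2 r)\<close> enter the product in the bound.
\<close>
lemma lagrange_function:
  fixes y :: "'s::finite \<Rightarrow> real ^ 'n" and \<alpha> R r :: real and \<nu> :: nat
  assumes d2: "CARD('n) \<ge> 2" and \<alpha>: "\<alpha> > bessel_zero (real CARD('n) / 2 - 1) 1 / pi"
    and R: "R > 0" and \<tau>: "\<alpha> / R \<le> 1 / (4 * sqrt CARD('n))" and r: "r \<ge> 2 * sqrt CARD('n)"
    and distinct: "\<And>j k. j \<noteq> k \<Longrightarrow> torus_norm (y j - y k) > 0"
    and \<nu>: "\<And>j. card {i. torus_norm (y i - y j) \<le> \<alpha> / R} \<le> \<nu>"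
  shows "\<exists>f. band_limited (\<nu> * R + (real \<nu> - 1) * r) f \<and> (\<forall>j. f (y j) = (if j = k then 1 else 0)) \<and>
    (\<forall>x. norm (f x) * (\<Prod>j | 0 < torus_norm (y j - y k) \<and> torus_norm (y j - y k) \<le> 1 / (2 * r). 2 * r * torus_norm (y j - y k))
      \<le> sqrt (2 ^ (\<nu> - 1)) * sqrt ((\<Sum>n\<in>cball (0 :: real ^ 'n) R \<inter> integer_points. 1 - (norm n / R)\<^sup>2)
          / (c_const TYPE('n) \<alpha> * R ^ CARD('n))) ^ \<nu>)"
proof -
  define t where "t j = torus_norm (y j - y k)" for j
  define \<tau> where "\<tau> = \<alpha> / R"
  define C where "C = c_const TYPE('n) \<alpha> * R ^ CARD('n)"
  define P where "P = cball (0 :: real ^ 'n) R \<inter> integer_points"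
  define M where "M = sqrt ((\<Sum>n\<in>P. 1 - (norm n / R)\<^sup>2) / C)"
  have \<alpha>p: "\<alpha> > 0" using \<alpha> bessel_zero_pi_pos[OF d2] by linarith
  have \<tau>p: "\<tau> > 0" using \<alpha>p R by (simp add: \<tau>_def)
  have D: "sqrt (real CARD('n)) \<ge> 1" using d2 by simp
  have rp: "r > 0" using r D by linarith
  have \<tau>4: "\<tau> \<le> 1 / (4 * sqrt CARD('n))" using assms(4) by (simp add: \<tau>_def)
  have small: "\<alpha> / R < 1"
    by (rule separation_lt_1[OF d2 assms(4)])
  have C: "C > 0"
    using c_const_pos_and_frame_bound(1)[where Y = "{} :: 's set" and y = y, OF d2 \<alpha> R small] R by (simp add: C_def)
  define near where "near = {j. j \<noteq> k \<and> t j \<le> \<tau>}"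
  define far where "far = {j. t j > \<tau>}"
  have tk: "t k = 0" using torus_norm_local[of 0 "0 :: real ^ 'n"] by (simp add: t_def)
  have t0: "t j \<ge> 0" for j by (simp add: t_def)
  have cn: "real (card near) \<le> real \<nu> - 1" and cn': "card near \<le> \<nu> - 1" and \<nu>1: "\<nu> \<ge> 1"
  proof -
    have "{i. torus_norm (y i - y k) \<le> \<alpha> / R} = insert k near"
      using tk \<tau>p by (auto simp: near_def t_def \<tau>_def)
    moreover have "card (insert k near) = Suc (card near)" by (simp add: near_def)
    ultimately have "Suc (card near) \<le> \<nu>" using \<nu>[of k] by simp
    then show "real (card near) \<le> real \<nu> - 1" "card near \<le> \<nu> - 1" "\<nu> \<ge> 1" by auto
  qed
  obtain col where col: "\<forall>v\<in>far. col v < \<nu>"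
    "\<forall>v\<in>far. \<forall>w\<in>far. v \<noteq> w \<longrightarrow> torus_norm (y v - y w) \<le> \<tau> \<longrightarrow> col v \<noteq> col w"
  proof -
    have "\<exists>col. (\<forall>v\<in>far. col v < \<nu>) \<and> (\<forall>v\<in>far. \<forall>w\<in>far. v \<noteq> w \<longrightarrow> torus_norm (y v - y w) \<le> \<tau> \<longrightarrow> col v \<noteq> col w)"
    proof (rule greedy_colouring)
      show "torus_norm (y w - y v) \<le> \<tau>" if "torus_norm (y v - y w) \<le> \<tau>" for v w
        using that torus_norm_commute[of "y v" "y w"] by simp
      show "card {w \<in> far. w \<noteq> v \<and> torus_norm (y v - y w) \<le> \<tau>} < \<nu>" for v
      proof -
        have z: "torus_norm (y v - y v) \<le> \<alpha> / R" using torus_norm_local[of 0 "0 :: real ^ 'n"] \<tau>p by (simp add: \<tau>_def)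
        have "{w \<in> far. w \<noteq> v \<and> torus_norm (y v - y w) \<le> \<tau>} \<subset> {i. torus_norm (y i - y v) \<le> \<alpha> / R}"
        proof (intro psubsetI subsetI)
          fix w assume "w \<in> {w \<in> far. w \<noteq> v \<and> torus_norm (y v - y w) \<le> \<tau>}"
          then show "w \<in> {i. torus_norm (y i - y v) \<le> \<alpha> / R}"
            using torus_norm_commute[of "y v" "y w"] by (simp add: \<tau>_def)
        qed (use z in blast)
        then have "card {w \<in> far. w \<noteq> v \<and> torus_norm (y v - y w) \<le> \<tau>} < card {i. torus_norm (y i - y v) \<le> \<alpha> / R}"
          by (intro psubset_card_mono) auto
        then show ?thesis using \<nu>[of v] by simp
      qed
    qed simp
    then show ?thesis by (elim exE conjE) (rule that)
  qed
  have "\<exists>g. band_limited R g \<and> g (y k) = 1 \<and> (\<forall>j\<in>far. col j = i \<longrightarrow> g (y j) = 0) \<and> (\<forall>x. norm (g x) \<le> M)" for i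
  proof -
    define Y where "Y = insert k {j \<in> far. col j = i}"
    have kfar: "k \<notin> far" using tk \<tau>p by (simp add: far_def)
    have sep: "\<alpha> / R < torus_norm (y j - y l)" if jl: "j \<in> Y" "l \<in> Y" "j \<noteq> l" for j l
    proof (cases "j = k \<or> l = k")
      case True
      then show ?thesis using jl torus_norm_commute[of "y j" "y l"]
        by (auto simp: Y_def far_def t_def \<tau>_def)
    next
      case False
      then have "j \<in> far" "l \<in> far" "col j = col l" using jl by (auto simp: Y_def)
      then have "\<not> torus_norm (y j - y l) \<le> \<tau>" using col(2) jl(3) by blast
      then show ?thesis by (simp add: \<tau>_def)
    qed
    have w: "1 - (norm n / R)\<^sup>2 \<ge> 0" if "n \<in> P" for n
      using ball_weight_nonneg[OF R, of n] that by (simp add: P_def)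
    have frame: "C * (\<Sum>j\<in>Y. (norm (u j))\<^sup>2) \<le> (\<Sum>n\<in>P. (1 - (norm n / R)\<^sup>2) * (norm (\<Sum>j\<in>Y. u j * cnj (wave n (y j))))\<^sup>2)" for u
      unfolding C_def P_def
      by (rule c_const_pos_and_frame_bound(2)[OF d2 \<alpha> R small _ sep]) simp_all
    have "k \<in> Y" by (simp add: Y_def)
    from interpolation_from_frame_bound[OF this w C frame] obtain c where
      c: "\<And>j. j \<in> Y \<Longrightarrow> trig_sum P c (y j) = (if j = k then 1 else 0)" "\<And>x. norm (trig_sum P c x) \<le> M"
      unfolding M_def by blast
    have "band_limited R (trig_sum P c)"
      unfolding band_limited_def
      by (intro exI[of _ P] exI[of _ c]) (auto simp: P_def intro!: finite_integer_points_bounded)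
    moreover have "trig_sum P c (y k) = 1" using c(1)[of k] by (simp add: Y_def)
    moreover have "trig_sum P c (y j) = 0" if "j \<in> far" "col j = i" for j
      using c(1)[of j] that kfar by (auto simp: Y_def)
    ultimately show ?thesis using c(2) by blast
  qed
  then have "\<exists>g. \<forall>i. band_limited R (g i) \<and> g i (y k) = 1 \<and> (\<forall>j\<in>far. col j = i \<longrightarrow> g i (y j) = 0) \<and> (\<forall>x. norm (g i x) \<le> M)"
    by (intro choice allI)
  then obtain g where g: "\<And>i. band_limited R (g i)" "\<And>i. g i (y k) = 1"
    "\<And>i j. j \<in> far \<Longrightarrow> col j = i \<Longrightarrow> g i (y j) = 0" "\<And>i x. norm (g i x) \<le> M" by blast
  have "\<forall>j\<in>near. \<exists>l. band_limited r l \<and> l (y k) = 1 \<and> l (y j) = 0 \<and> (\<forall>x. norm (l x) \<le> sqrt 2 / min 1 (2 * r * t j))"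
  proof
    fix j assume j: "j \<in> near"
    have tj: "torus_norm (y k - y j) = t j" unfolding t_def by (rule torus_norm_commute)
    have "0 < torus_norm (y k - y j)" using distinct[of k j] j by (auto simp: near_def)
    moreover have "torus_norm (y k - y j) \<le> 1 / (4 * sqrt CARD('n))" using j \<tau>4 unfolding tj near_def by simp
    ultimately obtain l where "band_limited r l" "l (y k) = 1" "l (y j) = 0"
      "\<And>x. norm (l x) \<le> sqrt 2 / min 1 (2 * r * torus_norm (y k - y j))"
      using band_limited_separating_factor[OF _ _ r] by blast
    then show "\<exists>l. band_limited r l \<and> l (y k) = 1 \<and> l (y j) = 0 \<and> (\<forall>x. norm (l x) \<le> sqrt 2 / min 1 (2 * r * t j))"
      unfolding tj by blast
  qed
  from bchoice[OF this] obtain l where l: "\<And>j. j \<in> near \<Longrightarrow> band_limited r (l j)" "\<And>j. j \<in> near \<Longrightarrow> l j (y k) = 1"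
    "\<And>j. j \<in> near \<Longrightarrow> l j (y j) = 0" "\<And>j x. j \<in> near \<Longrightarrow> norm (l j x) \<le> sqrt 2 / min 1 (2 * r * t j)" by blast
  define f where "f x = (\<Prod>i<\<nu>. g i x) * (\<Prod>j\<in>near. l j x)" for x
  have "band_limited ((\<Sum>i<\<nu>. R) + (\<Sum>j\<in>near. r)) f"
    unfolding f_def by (intro band_limited_mult band_limited_prod g l) auto
  then have "band_limited (\<nu> * R + (real \<nu> - 1) * r) f"
    by (rule band_limited_mono) (use cn rp in \<open>simp add: mult_right_mono\<close>)
  moreover have "f (y j) = (if j = k then 1 else 0)" for j
  proof (cases "j = k")
    case True
    then show ?thesis by (simp add: f_def g l)
  next
    case False
    then consider "j \<in> near" | "j \<in> far" by (force simp: near_def far_def)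
    then show ?thesis
    proof cases
      case 1
      then have "(\<Prod>j'\<in>near. l j' (y j)) = 0" using l(3)[OF 1] by (intro prod_zero) auto
      then show ?thesis using False by (simp add: f_def)
    next
      case 2
      then have "(\<Prod>i<\<nu>. g i (y j)) = 0" using g(3)[OF 2 refl] col(1) by (intro prod_zero) auto
      then show ?thesis using False by (simp add: f_def)
    qed
  qed
  moreover have "norm (f x) * (\<Prod>j | 0 < t j \<and> t j \<le> 1 / (2 * r). 2 * r * t j) \<le> sqrt (2 ^ (\<nu> - 1)) * M ^ \<nu>" for x
  proof -
    let ?m = "\<lambda>j. min 1 (2 * r * t j)"
    define Q where "Q = {j. 0 < t j \<and> t j \<le> 1 / (2 * r)}"
    have Q1: "2 * r * t j \<le> 1" if "j \<in> Q" for j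
      using that rp by (simp add: Q_def le_divide_eq mult.commute)
    have m: "?m j > 0" if "j \<in> near" for j using that distinct[of j k] rp by (simp add: near_def t_def)
    have M0: "M \<ge> 0" using g(4)[of 0 0] norm_ge_zero order_trans by blast
    \<comment> \<open>Points of \<open>Q\<close> that are not near contribute factors of at most \<open>1\<close> to the left-hand side.\<close>
    have "(\<Prod>j\<in>Q. 2 * r * t j) = (\<Prod>j\<in>Q - near. 2 * r * t j) * (\<Prod>j\<in>Q \<inter> near. 2 * r * t j)"
      by (subst prod.union_disjoint[symmetric]) (auto intro!: prod.cong)
    also have "\<dots> \<le> 1 * (\<Prod>j\<in>Q \<inter> near. 2 * r * t j)"
      using Q1 rp t0 by (intro mult_right_mono prod_le_1 prod_nonneg) auto
    also have "1 * (\<Prod>j\<in>Q \<inter> near. 2 * r * t j) = (\<Prod>j\<in>Q \<inter> near. ?m j)"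
      unfolding mult_1 using Q1 by (intro prod.cong refl) (simp add: min_absorb2)
    also have "\<dots> = (\<Prod>j\<in>near. ?m j)"
    proof (rule prod.mono_neutral_left)
      show "\<forall>j\<in>near - Q \<inter> near. ?m j = 1"
      proof
        fix j assume j: "j \<in> near - Q \<inter> near"
        then have "t j > 0" using distinct[of j k] by (auto simp: near_def t_def)
        then have "t j > 1 / (2 * r)" using j by (auto simp: Q_def)
        then have "2 * r * t j > 1" using rp by (simp add: divide_less_eq mult.commute)
        then show "?m j = 1" by simp
      qed
    qed auto
    finally have Qm: "(\<Prod>j\<in>Q. 2 * r * t j) \<le> (\<Prod>j\<in>near. ?m j)" .
    have "norm (f x) \<le> M ^ \<nu> * (\<Prod>j\<in>near. sqrt 2 / ?m j)"
    proof -
      have "(\<Prod>i<\<nu>. norm (g i x)) \<le> (\<Prod>i<\<nu>. M)" by (intro prod_mono) (simp add: g)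
      moreover have "(\<Prod>j\<in>near. norm (l j x)) \<le> (\<Prod>j\<in>near. sqrt 2 / ?m j)" by (intro prod_mono) (simp add: l)
      ultimately show ?thesis unfolding f_def norm_mult prod_norm[symmetric]
        using M0 by (intro mult_mono) (auto intro!: prod_nonneg)
    qed
    then have "norm (f x) * (\<Prod>j\<in>Q. 2 * r * t j) \<le> M ^ \<nu> * (\<Prod>j\<in>near. sqrt 2 / ?m j) * (\<Prod>j\<in>near. ?m j)"
      using Qm M0 m rp t0
      by (intro mult_mono) (auto intro!: prod_nonneg mult_nonneg_nonneg divide_nonneg_nonneg simp: less_imp_le)
    also have "\<dots> = M ^ \<nu> * (\<Prod>j\<in>near. sqrt 2 / ?m j * ?m j)" by (simp only: prod.distrib mult.assoc)
    also have "(\<Prod>j\<in>near. sqrt 2 / ?m j * ?m j) = sqrt 2 ^ card near"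
      unfolding prod_constant[symmetric] using m by (intro prod.cong) (auto simp: less_le)
    also have "M ^ \<nu> * sqrt 2 ^ card near \<le> M ^ \<nu> * sqrt 2 ^ (\<nu> - 1)"
      using cn' M0 by (intro mult_left_mono power_increasing) auto
    finally show ?thesis unfolding Q_def by (simp add: real_sqrt_power mult.commute)
  qed
  ultimately show ?thesis unfolding M_def P_def C_def t_def by blast
qed

lemma finite_shifted_lattice: "finite {n \<in> integer_points. n + \<theta> \<in> cball 0 r}" for \<theta> :: "real ^ 'n"
proof -
  have "{n \<in> integer_points. n + \<theta> \<in> cball 0 r} = cball (- \<theta>) r \<inter> integer_points"
    by (auto simp: dist_norm norm_minus_commute algebra_simps)
  then show ?thesis by (simp add: finite_integer_points_bounded)
qed

text \<open>
  For \<open>w\<close> in the ball of radius \<open>r\<close>, the convolution at \<open>w\<close> of the coefficients of \<open>f\<close> with the exponential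
  sum of \<open>u\<close> evaluates \<open>f\<close> at the points and leaves \<open>u\<^sub>k\<close> up to a phase. It only uses the exponential sum in the ball of
  radius \<open>r + \<sigma>\<close>, so \<open>trig_convolution_bound\<close> applies to the restriction.
\<close>
lemma band_limited_sampling_bound:
  fixes y :: "'s::finite \<Rightarrow> real ^ 'n"
  assumes f: "band_limited \<sigma> f" and interp: "\<And>j. f (y j) = (if j = k then 1 else 0)" and M: "\<And>x. norm (f x) \<le> M"
  shows "real (card {n \<in> integer_points. n + \<theta> \<in> cball 0 r}) * (norm (u k))\<^sup>2
    \<le> M\<^sup>2 * (\<Sum>n\<in>{n \<in> integer_points. n + \<theta> \<in> cball 0 (r + \<sigma>)}. (norm (\<Sum>j\<in>UNIV. u j * cnj (wave (n + \<theta>) (y j))))\<^sup>2)"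
proof -
  obtain K c where K: "finite K" "K \<subseteq> integer_points \<inter> cball 0 \<sigma>" "f = trig_sum K c"
    using f unfolding band_limited_def by blast
  define T where "T = {n \<in> integer_points. n + \<theta> \<in> cball 0 r}"
  define S where "S = {n \<in> integer_points. n + \<theta> \<in> cball 0 (r + \<sigma>)}"
  define A where "A n = (\<Sum>j\<in>UNIV. u j * cnj (wave (n + \<theta>) (y j)))" for n
  define A' where "A' n = (if n \<in> S then A n else 0)" for n
  have conv: "norm (\<Sum>a\<in>K. c a * A' (w - a)) = norm (u k)" if w: "w \<in> T" for w
  proof -
    have "w - a \<in> S" if "a \<in> K" for a
    proof -
      have "norm (w - a + \<theta>) \<le> norm (w + \<theta>) + norm a"
        using norm_triangle_ineq4[of "w + \<theta>" a] by (simp add: algebra_simps)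
      moreover have "norm a \<le> \<sigma>" "norm (w + \<theta>) \<le> r" using K w that by (auto simp: T_def subset_iff)
      ultimately show ?thesis using K w that by (auto simp: S_def T_def subset_iff intro!: integer_points_closed(3))
    qed
    then have "(\<Sum>a\<in>K. c a * A' (w - a)) = (\<Sum>a\<in>K. \<Sum>j\<in>UNIV. c a * (u j * cnj (wave (w + \<theta> - a) (y j))))"
      by (simp add: A'_def A_def sum_distrib_left algebra_simps)
    also have "\<dots> = (\<Sum>j\<in>UNIV. u j * cnj (wave (w + \<theta>) (y j)) * (\<Sum>a\<in>K. c a * wave a (y j)))"
      by (subst sum.swap) (simp add: wave_diff_freq sum_distrib_left mult_ac)
    also have "\<dots> = (\<Sum>j\<in>UNIV. u j * cnj (wave (w + \<theta>) (y j)) * (if j = k then 1 else 0))"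
      using interp by (simp add: K(3) trig_sum_def)
    also have "\<dots> = u k * cnj (wave (w + \<theta>) (y k))" by (simp add: if_distrib[of "(*) _"] cong: if_cong)
    finally show ?thesis by (simp add: norm_mult)
  qed
  have "real (card T) * (norm (u k))\<^sup>2 = (\<Sum>w\<in>T. (norm (\<Sum>a\<in>K. c a * A' (w - a)))\<^sup>2)"
    by (simp add: conv)
  also have "\<dots> \<le> M\<^sup>2 * (\<Sum>n\<in>S. (norm (A' n))\<^sup>2)"
  proof (rule trig_convolution_bound)
    show "finite T" "finite S" unfolding T_def S_def by (rule finite_shifted_lattice)+
  qed (use K M in \<open>auto simp: S_def T_def A'_def\<close>)
  also have "(\<Sum>n\<in>S. (norm (A' n))\<^sup>2) = (\<Sum>n\<in>S. (norm (A n))\<^sup>2)" by (simp add: A'_def)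
  finally show ?thesis by (simp add: T_def S_def A_def)
qed

text \<open>
  The bounds for the single coordinates \<open>u\<^sub>k\<close> are added, which costs the factor \<open>CARD('s)\<close>. The band of the Lagrange
  function and the radius \<open>r\<close> add up to \<open>\<nu> R + \<nu> r \<le> 2 \<nu> r\<close>. Arbitrary shifts \<open>\<theta>\<close> are allowed, because
  only differences of frequencies have to be integral.
\<close>
lemma shifted_lattice_lower_bound:
  fixes y :: "'s::finite \<Rightarrow> real ^ 'n" and \<alpha> R r p :: real and \<nu> :: nat
  assumes d2: "CARD('n) \<ge> 2" and \<alpha>: "\<alpha> > bessel_zero (real CARD('n) / 2 - 1) 1 / pi"
    and R: "R > 0" and \<tau>: "\<alpha> / R \<le> 1 / (4 * sqrt CARD('n))" and r: "r \<ge> 2 * sqrt CARD('n)" and Rr: "R \<le> r"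
    and distinct: "\<And>j k. j \<noteq> k \<Longrightarrow> torus_norm (y j - y k) > 0"
    and \<nu>: "\<And>j. card {i. torus_norm (y i - y j) \<le> \<alpha> / R} \<le> \<nu>"
    and p: "p > 0" "\<And>k. p \<le> (\<Prod>j | 0 < torus_norm (y j - y k) \<and> torus_norm (y j - y k) \<le> 1 / (2 * r). 2 * r * torus_norm (y j - y k))"
  shows "p\<^sup>2 * real (card {n \<in> integer_points. n + \<theta> \<in> cball 0 r}) * (\<Sum>k\<in>UNIV. (norm (u k))\<^sup>2)
    \<le> real CARD('s) * 2 ^ (\<nu> - 1) * ((\<Sum>n\<in>cball (0 :: real ^ 'n) R \<inter> integer_points. 1 - (norm n / R)\<^sup>2)
          / (c_const TYPE('n) \<alpha> * R ^ CARD('n))) ^ \<nu>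
      * (\<Sum>n\<in>{n \<in> integer_points. n + \<theta> \<in> cball 0 (2 * real \<nu> * r)}. (norm (\<Sum>j\<in>UNIV. u j * cnj (wave (n + \<theta>) (y j))))\<^sup>2)"
proof -
  define N where "N = real (card {n \<in> integer_points. n + \<theta> \<in> cball 0 r})"
  define q where "q = (\<Sum>n\<in>cball (0 :: real ^ 'n) R \<inter> integer_points. 1 - (norm n / R)\<^sup>2) / (c_const TYPE('n) \<alpha> * R ^ CARD('n))"
  define A where "A = (\<Sum>n\<in>{n \<in> integer_points. n + \<theta> \<in> cball 0 (2 * real \<nu> * r)}. (norm (\<Sum>j\<in>UNIV. u j * cnj (wave (n + \<theta>) (y j))))\<^sup>2)"
  have one: "p\<^sup>2 * N * (norm (u k))\<^sup>2 \<le> 2 ^ (\<nu> - 1) * q ^ \<nu> * A" for k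
  proof -
    define P where "P = (\<Prod>j | 0 < torus_norm (y j - y k) \<and> torus_norm (y j - y k) \<le> 1 / (2 * r). 2 * r * torus_norm (y j - y k))"
    have pP: "p \<le> P" unfolding P_def by (rule p(2))
    have "\<exists>f. band_limited (\<nu> * R + (real \<nu> - 1) * r) f \<and> (\<forall>j. f (y j) = (if j = k then 1 else 0)) \<and>
      (\<forall>x. norm (f x) * P \<le> sqrt (2 ^ (\<nu> - 1)) * sqrt q ^ \<nu>)"
      unfolding q_def P_def by (rule lagrange_function[OF d2 \<alpha> R \<tau> r distinct \<nu>])
    then obtain f where f: "band_limited (\<nu> * R + (real \<nu> - 1) * r) f" "\<And>j. f (y j) = (if j = k then 1 else 0)"
      "\<And>x. norm (f x) * P \<le> sqrt (2 ^ (\<nu> - 1)) * sqrt q ^ \<nu>"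
      by blast
    have P: "P > 0" using p(1) pP by linarith
    have "(sqrt q)\<^sup>2 = q" unfolding q_def
    proof (rule real_sqrt_pow2, rule divide_nonneg_nonneg)
      show "0 \<le> (\<Sum>n\<in>cball (0 :: real ^ 'n) R \<inter> integer_points. 1 - (norm n / R)\<^sup>2)"
        using ball_weight_nonneg[OF R] by (intro sum_nonneg) auto
      show "0 \<le> c_const TYPE('n) \<alpha> * R ^ CARD('n)"
        using c_const_pos_and_frame_bound(1)[where Y = "{} :: 's set" and y = y, OF d2 \<alpha> R separation_lt_1[OF d2 \<tau>]] R by simp
    qed
    then have q\<nu>: "(sqrt q ^ \<nu>)\<^sup>2 = q ^ \<nu>" 
      by (simp only: power_mult[symmetric] mult.commute[of \<nu>]) (simp only: power_mult)
    let ?M = "sqrt (2 ^ (\<nu> - 1)) * sqrt q ^ \<nu> / P"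
    have M: "norm (f x) \<le> ?M" for x using f(3)[of x] P by (simp add: le_divide_eq)
    have sub: "{n \<in> integer_points. n + \<theta> \<in> cball 0 (r + (\<nu> * R + (real \<nu> - 1) * r))}
        \<subseteq> {n \<in> integer_points. n + \<theta> \<in> cball 0 (2 * real \<nu> * r)}"
    proof -
      have "r + (\<nu> * R + (real \<nu> - 1) * r) \<le> 2 * real \<nu> * r"
        using mult_left_mono[OF Rr, of "real \<nu>"] by (simp add: algebra_simps)
      then show ?thesis by auto
    qed
    have "N * (norm (u k))\<^sup>2 \<le> ?M\<^sup>2 * A" unfolding N_def A_def
      by (rule order.trans[OF band_limited_sampling_bound[OF f(1,2) M, of \<theta> r u]])
         (intro mult_left_mono sum_mono2 sub finite_shifted_lattice, auto)
    also have "?M\<^sup>2 = 2 ^ (\<nu> - 1) * q ^ \<nu> / P\<^sup>2" by (simp add: power_divide power_mult_distrib q\<nu>)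
    finally have "P\<^sup>2 * (N * (norm (u k))\<^sup>2) \<le> 2 ^ (\<nu> - 1) * q ^ \<nu> * A"
      using P by (simp add: le_divide_eq mult_ac)
    moreover have "p\<^sup>2 * (N * (norm (u k))\<^sup>2) \<le> P\<^sup>2 * (N * (norm (u k))\<^sup>2)"
      using p(1) pP by (intro mult_right_mono power_mono) (auto simp: N_def)
    ultimately show ?thesis by (simp add: mult.assoc)
  qed
  have "p\<^sup>2 * N * (\<Sum>k\<in>UNIV. (norm (u k))\<^sup>2) = (\<Sum>k\<in>UNIV. p\<^sup>2 * N * (norm (u k))\<^sup>2)" by (simp add: sum_distrib_left)
  also have "\<dots> \<le> (\<Sum>k\<in>(UNIV :: 's set). 2 ^ (\<nu> - 1) * q ^ \<nu> * A)" by (intro sum_mono one)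
  also have "\<dots> = real CARD('s) * 2 ^ (\<nu> - 1) * q ^ \<nu> * A" by simp
  finally show ?thesis unfolding N_def q_def A_def .
qed

section \<open>Volumes and lattice points\<close>

lemma nn_integral_scale:
  fixes f :: "real ^ 'n \<Rightarrow> ennreal"
  assumes [measurable]: "f \<in> borel_measurable borel" and c: "c > 0"
  shows "(\<integral>\<^sup>+x. f x \<partial>lborel) = ennreal (c ^ CARD('n)) * (\<integral>\<^sup>+x. f (c *\<^sub>R x) \<partial>lborel)"
proof -
  have "(\<integral>\<^sup>+x. f x \<partial>lborel) = (\<integral>\<^sup>+x. f x \<partial>density (distr lborel borel (\<lambda>x. 0 + c *\<^sub>R x)) (\<lambda>_. \<bar>c\<bar> ^ DIM(real ^ 'n)))"
    using lborel_affine[of c "0 :: real ^ 'n"] c by simp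
  also have "\<dots> = (\<integral>\<^sup>+x. ennreal (c ^ CARD('n)) * f (c *\<^sub>R x) \<partial>lborel)"
    using c by (subst nn_integral_density) (simp_all add: nn_integral_distr)
  also have "\<dots> = ennreal (c ^ CARD('n)) * (\<integral>\<^sup>+x. f (c *\<^sub>R x) \<partial>lborel)"
    by (rule nn_integral_cmult) measurable
  finally show ?thesis .
qed

text \<open>
  Integrating a lattice sum over all shifts of the lattice gives the integral over the space.
\<close>
lemma nn_integral_cball_lattice:
  fixes g :: "real ^ 'n \<Rightarrow> real"
  assumes [measurable]: "g \<in> borel_measurable borel" and g: "\<And>x. g x \<ge> 0"
  shows "(\<integral>\<^sup>+x. ennreal (indicator (cball 0 r) x * g x) \<partial>lborel)
    = (\<integral>\<^sup>+\<theta>. ennreal (\<Sum>n\<in>{n \<in> integer_points. n + \<theta> \<in> cball 0 r}. g (n + \<theta>)) \<partial>cell_measure)"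
proof -
  have [measurable]: "cball (0 :: real ^ 'n) r \<in> sets borel" by simp
  have "(\<integral>\<^sup>+x. ennreal (indicator (cball 0 r) x * g x) \<partial>lborel)
    = (\<integral>\<^sup>+\<theta>. (\<integral>\<^sup>+n. ennreal (indicator (cball 0 r) (\<theta> + n) * g (\<theta> + n)) \<partial>count_space integer_points) \<partial>cell_measure)"
    by (rule nn_integral_tile) measurable
  also have "\<dots> = (\<integral>\<^sup>+\<theta>. ennreal (\<Sum>n\<in>{n \<in> integer_points. n + \<theta> \<in> cball 0 r}. g (n + \<theta>)) \<partial>cell_measure)"
  proof (intro nn_integral_cong)
    fix \<theta> :: "real ^ 'n"
    have "(\<integral>\<^sup>+n. ennreal (indicator (cball 0 r) (\<theta> + n) * g (\<theta> + n)) \<partial>count_space integer_points)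
      = (\<Sum>n\<in>{n \<in> integer_points. n + \<theta> \<in> cball 0 r}. ennreal (indicator (cball 0 r) (\<theta> + n) * g (\<theta> + n)))"
      by (rule nn_integral_count_space'[OF finite_shifted_lattice]) (auto simp: indicator_def add.commute)
    also have "\<dots> = (\<Sum>n\<in>{n \<in> integer_points. n + \<theta> \<in> cball 0 r}. ennreal (g (n + \<theta>)))"
      by (intro sum.cong) (auto simp: indicator_def add.commute)
    also have "\<dots> = ennreal (\<Sum>n\<in>{n \<in> integer_points. n + \<theta> \<in> cball 0 r}. g (n + \<theta>))"
      by (rule sum_ennreal) (simp add: g)
    finally show "(\<integral>\<^sup>+n. ennreal (indicator (cball 0 r) (\<theta> + n) * g (\<theta> + n)) \<partial>count_space integer_points)
      = ennreal (\<Sum>n\<in>{n \<in> integer_points. n + \<theta> \<in> cball 0 r}. g (n + \<theta>))" .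
  qed
  finally show ?thesis .
qed

lemma emeasure_cball_lattice:
  "emeasure lborel (cball (0 :: real ^ 'n) r)
    = (\<integral>\<^sup>+\<theta>. ennreal (card {n \<in> integer_points. n + \<theta> \<in> cball (0 :: real ^ 'n) r}) \<partial>cell_measure)"
proof -
  have "emeasure lborel (cball (0 :: real ^ 'n) r) = (\<integral>\<^sup>+x. ennreal (indicator (cball (0 :: real ^ 'n) r) x * 1) \<partial>lborel)"
    by (simp add: ennreal_indicator)
  also have "\<dots> = (\<integral>\<^sup>+\<theta>. ennreal (\<Sum>n\<in>{n \<in> integer_points. n + \<theta> \<in> cball (0 :: real ^ 'n) r}. 1) \<partial>cell_measure)"
    by (rule nn_integral_cball_lattice) auto
  finally show ?thesis by simp
qed

lemma AE_cell_measure: "AE x in cell_measure. x \<in> unit_cell"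
  unfolding cell_measure_def by (subst AE_density) (auto simp: indicator_def)

text \<open>
  The unit cells around the lattice points in the ball of radius \<open>R\<close> cover the ball whose radius is smaller by half the
  diagonal of a cell.
\<close>
lemma unit_ball_vol_le_lattice_points:
  assumes "R \<ge> sqrt (real CARD('n)) / 2"
  shows "unit_ball_vol CARD('n) * (R - sqrt CARD('n) / 2) ^ CARD('n) \<le> vol_star (cball (0 :: real ^ 'n) R)"
proof -
  let ?D = "sqrt (real CARD('n)) / 2"
  have "ennreal (unit_ball_vol CARD('n) * (R - ?D) ^ CARD('n)) = emeasure lborel (cball (0 :: real ^ 'n) (R - ?D))"
    using emeasure_cball[of "R - ?D" "0 :: real ^ 'n"] assms by simp
  also have "\<dots> = (\<integral>\<^sup>+\<theta>. ennreal (card {n \<in> integer_points. n + \<theta> \<in> cball (0 :: real ^ 'n) (R - ?D)}) \<partial>cell_measure)"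
    by (rule emeasure_cball_lattice)
  also have "\<dots> \<le> (\<integral>\<^sup>+\<theta>. ennreal (vol_star (cball (0 :: real ^ 'n) R)) \<partial>(cell_measure :: (real ^ 'n) measure))"
  proof (rule nn_integral_mono_AE)
    show "AE \<theta> in cell_measure. ennreal (card {n \<in> integer_points. n + \<theta> \<in> cball (0 :: real ^ 'n) (R - ?D)}) \<le> ennreal (vol_star (cball (0 :: real ^ 'n) R))"
      using AE_cell_measure
    proof eventually_elim
      case (elim \<theta>)
      have "(norm \<theta>)\<^sup>2 \<le> ?D\<^sup>2" using norm_unit_cell[OF elim] by (simp add: power_divide)
      then have "norm \<theta> \<le> ?D" by (rule power2_le_imp_le) simp
      then have "norm n \<le> R" if "norm (n + \<theta>) \<le> R - ?D" for n
        using norm_triangle_ineq4[of "n + \<theta>" \<theta>] that by simp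
      then have "{n \<in> integer_points. n + \<theta> \<in> cball 0 (R - ?D)} \<subseteq> cball 0 R \<inter> integer_points" by auto
      then have "card {n \<in> integer_points. n + \<theta> \<in> cball 0 (R - ?D)} \<le> card (cball 0 R \<inter> (integer_points :: (real ^ 'n) set))"
        by (intro card_mono finite_integer_points_bounded) auto
      then show ?case by (simp add: vol_star_def)
    qed
  qed
  also have "\<dots> = ennreal (vol_star (cball (0 :: real ^ 'n) R))" by (simp add: emeasure_cell_measure_UNIV)
  finally show ?thesis by (simp add: vol_star_def)
qed

text \<open>
  Compare \<open>R\<^sup>2 - \<bar>n\<bar>\<^sup>2\<close> with the values of \<open>max 0 (S\<^sup>2 - \<bar>x\<bar>\<^sup>2)\<close> on the cell around \<open>n\<close>. Expanding \<open>\<bar>n + \<theta>\<bar>\<^sup>2\<close>, the quadratic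
  term in \<open>\<theta>\<close> is absorbed by \<open>S\<^sup>2 - R\<^sup>2\<close>, and the linear terms cancel in the sum over \<open>n\<close>, because the set of lattice
  points is symmetric. The right-hand side is the integral of \<open>max 0 (S\<^sup>2 - \<bar>x\<bar>\<^sup>2)\<close>.
\<close>
lemma lattice_weight_sum_le:
  fixes R :: real
  assumes R: "R > 0"
  defines "S \<equiv> sqrt (R\<^sup>2 + CARD('n) / 4)"
  shows "(\<Sum>n\<in>cball (0 :: real ^ 'n) R \<inter> integer_points. R\<^sup>2 - (norm n)\<^sup>2)
    \<le> unit_ball_vol CARD('n) * S ^ (CARD('n) + 2) * (2 / (CARD('n) + 2))"
proof -
  let ?d = "CARD('n)"
  let ?P = "cball (0 :: real ^ 'n) R \<inter> integer_points"
  let ?X = "\<Sum>n\<in>?P. R\<^sup>2 - (norm n)\<^sup>2"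
  have S2: "S\<^sup>2 = R\<^sup>2 + ?d / 4" by (simp add: S_def)
  have S0: "S \<ge> 0" by (simp add: S_def)
  have fin: "finite ?P" by (rule finite_integer_points_bounded) simp
  define g where "g x = max 0 (S\<^sup>2 - (norm x)\<^sup>2)" for x :: "real ^ 'n"
  have gm [measurable]: "g \<in> borel_measurable borel" unfolding g_def by measurable
  have sum0: "(\<Sum>n\<in>?P. n \<bullet> \<theta>) = 0" for \<theta>
  proof -
    have "(\<Sum>n\<in>?P. n \<bullet> \<theta>) = (\<Sum>n\<in>?P. (- n) \<bullet> \<theta>)"
      by (rule sum.reindex_bij_witness[of _ uminus uminus]) auto
    then show ?thesis by (simp add: sum_negf)
  qed
  have "ennreal ?X = (\<integral>\<^sup>+\<theta>. ennreal ?X \<partial>(cell_measure :: (real ^ 'n) measure))"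
    by (simp add: emeasure_cell_measure_UNIV)
  also have "\<dots> \<le> (\<integral>\<^sup>+\<theta>. ennreal (\<Sum>n\<in>{n \<in> integer_points. n + \<theta> \<in> cball (0 :: real ^ 'n) S}. g (n + \<theta>)) \<partial>cell_measure)"
  proof (rule nn_integral_mono_AE)
    show "AE \<theta> in cell_measure. ennreal ?X \<le> ennreal (\<Sum>n\<in>{n \<in> integer_points. n + \<theta> \<in> cball (0 :: real ^ 'n) S}. g (n + \<theta>))"
      using AE_cell_measure
    proof eventually_elim
      case (elim \<theta>)
      let ?Q = "{n \<in> integer_points. n + \<theta> \<in> cball (0 :: real ^ 'n) S}"
      have "?X = (\<Sum>n\<in>?P. R\<^sup>2 - (norm n)\<^sup>2 - 2 * (n \<bullet> \<theta>))"
        by (simp add: sum_subtractf sum0 flip: sum_distrib_left)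
      also have "\<dots> \<le> (\<Sum>n\<in>?P. g (n + \<theta>))"
      proof (rule sum_mono)
        fix n
        have "(norm (n + \<theta>))\<^sup>2 = (norm n)\<^sup>2 + 2 * (n \<bullet> \<theta>) + (norm \<theta>)\<^sup>2"
          unfolding power2_norm_eq_inner by (simp add: inner_add_left inner_add_right inner_commute)
        then show "R\<^sup>2 - (norm n)\<^sup>2 - 2 * (n \<bullet> \<theta>) \<le> g (n + \<theta>)"
          using norm_unit_cell[OF elim] by (simp add: g_def S2)
      qed
      also have "\<dots> \<le> (\<Sum>n\<in>?P \<union> ?Q. g (n + \<theta>))"
        using fin finite_shifted_lattice[of \<theta> S] by (intro sum_mono2) (auto simp: g_def)
      also have "\<dots> = (\<Sum>n\<in>?Q. g (n + \<theta>))"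
      proof (rule sum.mono_neutral_right)
        show "\<forall>n\<in>?P \<union> ?Q - ?Q. g (n + \<theta>) = 0"
        proof
          fix n assume "n \<in> ?P \<union> ?Q - ?Q"
          then have "norm (n + \<theta>) > S" by auto
          then have "(norm (n + \<theta>))\<^sup>2 \<ge> S\<^sup>2" using S0 by (intro power_mono) auto
          then show "g (n + \<theta>) = 0" by (simp add: g_def)
        qed
      qed (use fin finite_shifted_lattice[of \<theta> S] in auto)
      finally show ?case by (rule ennreal_leI)
    qed
  qed
  also have "\<dots> = (\<integral>\<^sup>+x. ennreal (indicator (cball (0 :: real ^ 'n) S) x * g x) \<partial>lborel)"
    by (rule nn_integral_cball_lattice[symmetric]) (auto simp: g_def)
  also have "\<dots> = ennreal (LINT x|lborel. indicator (cball (0 :: real ^ 'n) S) x * g x)"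
  proof (rule nn_integral_eq_integral)
    have "integrable lborel (\<lambda>x. indicator (cball (0 :: real ^ 'n) S) x *\<^sub>R g x)"
      unfolding g_def by (intro borel_integrable_compact continuous_intros) auto
    then show "integrable lborel (\<lambda>x. indicator (cball (0 :: real ^ 'n) S) x * g x)" by simp
  qed (auto simp: g_def)
  also have "(LINT x|lborel. indicator (cball (0 :: real ^ 'n) S) x * g x)
    = (LINT x|lborel. indicator (cball (0 :: real ^ 'n) S) x * (S\<^sup>2 - (norm x)\<^sup>2))"
    using S0 by (intro Bochner_Integration.integral_cong) (auto simp: g_def indicator_def power_mono)
  also have "\<dots> = ?d * unit_ball_vol ?d * ((S\<^sup>2 * S ^ ?d / ?d - S ^ (?d + 2) / (?d + 2)) - (S\<^sup>2 * 0 ^ ?d / ?d - 0 ^ (?d + 2) / (?d + 2)))"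
  proof -
    have "((\<lambda>r. S\<^sup>2 * r ^ ?d / ?d - r ^ (?d + 2) / (?d + 2)) has_real_derivative r ^ (?d - 1) * (S\<^sup>2 - r\<^sup>2)) (at r within {0..S})" for r
    proof -
      have a: "((\<lambda>r. r ^ ?d / ?d) has_real_derivative r ^ (?d - 1)) (at r within {0..S})"
        by (auto intro!: derivative_eq_intros)
      have "((\<lambda>r. r ^ (?d + 2) / (?d + 2)) has_real_derivative real (?d + 2) * r ^ (?d + 1) / (?d + 2)) (at r within {0..S})"
        using DERIV_cdivide[OF DERIV_pow[of "?d + 2" r "{0..S}"], of "?d + 2"] by simp
      also have "real (?d + 2) * r ^ (?d + 1) / (?d + 2) = r ^ (?d + 1)"
        by (rule nonzero_mult_div_cancel_left) simp
      also have "r ^ (?d + 1) = r ^ (?d - 1 + 2)" by (rule arg_cong[where f = "\<lambda>k. r ^ k"]) simp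
      also have "\<dots> = r ^ (?d - 1) * r\<^sup>2" by (rule power_add)
      finally have "((\<lambda>r. r ^ (?d + 2) / (?d + 2)) has_real_derivative r ^ (?d - 1) * r\<^sup>2) (at r within {0..S})" .
      from DERIV_diff[OF DERIV_cmult[OF a, of "S\<^sup>2"] this]
      show ?thesis by (simp add: right_diff_distrib mult.commute)
    qed
    then show ?thesis
      using radial_integral_FTC[where 'a = "real ^ 'n" and \<rho> = S and f = "\<lambda>r. S\<^sup>2 - r\<^sup>2"
        and H = "\<lambda>r. S\<^sup>2 * r ^ ?d / ?d - r ^ (?d + 2) / (?d + 2)"] S0
      by (simp add: continuous_intros)
  qed
  also have "\<dots> = unit_ball_vol ?d * S ^ (?d + 2) * (2 / (?d + 2))"
  proof -
    have "(e * V) * ((S\<^sup>2 * T) / e - S\<^sup>2 * T / (e + 2)) = V * (S\<^sup>2 * T) * (2 / (e + 2))" if "e > 0" for e T V :: real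
    proof -
      have "e * (Z / e - Z / (e + 2)) = Z * (2 / (e + 2))" for Z
      proof -
        have "e * (Z / e - Z / (e + 2)) = Z - Z * (e / (e + 2))" using that by (simp add: right_diff_distrib)
        also have "e / (e + 2) = 1 - 2 / (e + 2)" using that by (simp add: divide_simps)
        finally show ?thesis by (simp add: right_diff_distrib)
      qed
      from this[of "S\<^sup>2 * T"] show ?thesis by (metis mult.assoc mult.commute)
    qed
    from this[of "real ?d" "unit_ball_vol ?d" "S ^ ?d"]
    have "?d * unit_ball_vol ?d * (S\<^sup>2 * S ^ ?d / ?d - S\<^sup>2 * S ^ ?d / (real ?d + 2)) = unit_ball_vol ?d * (S\<^sup>2 * S ^ ?d) * (2 / (real ?d + 2))"
      by simp
    moreover have "S ^ (?d + 2) = S\<^sup>2 * S ^ ?d" unfolding power_add by (rule mult.commute)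
    moreover have "S\<^sup>2 * 0 ^ ?d / ?d - 0 ^ (?d + 2) / (?d + 2) = 0" by (simp add: zero_power)
    moreover have "real (?d + 2) = real ?d + 2" by simp
    ultimately show ?thesis by (simp only: diff_zero)
  qed
  finally show ?thesis by (subst (asm) ennreal_le_iff) (auto simp: S0)
qed

text \<open>
  The numerical inequality behind \<open>half_lattice_weight_le\<close>, where \<open>j\<close> is the first zero of \<open>J\<^bsub>d/2-1\<^esub>\<close>. Dimensions 2 and
  3 use \<open>j\<^sup>2 \<ge> 2 d\<close>; from dimension 4 on, \<open>j \<ge> d/2\<close> keeps \<open>d z\<close> at most \<open>4/5\<close> and the exponent below \<open>1.03\<close>.
\<close>
lemma lattice_exponent_bound:
  fixes d :: nat and z j :: real
  assumes d: "d \<ge> 2" and z: "0 < z" "z \<le> 2 / (5 * j)" and j: "j > 0" "j\<^sup>2 \<ge> 2 * real d" "j \<ge> real d / 2"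
  shows "z < 1" "exp ((real d + 2) * z\<^sup>2 / 8 + real d * (z / (1 - z))) \<le> (real d + 2) / 2"
proof -
  have main: "z < 1 \<and> exp ((real d + 2) * z\<^sup>2 / 8 + real d * (z / (1 - z))) \<le> (real d + 2) / 2"
  proof -
    have E: "(real d + 2) * z\<^sup>2 / 8 + real d * (z / (1 - z)) \<le> (real d + 2) * w\<^sup>2 / 8 + real d * (w / (1 - w))"
      if "z \<le> w" "w < 1" for w
    proof -
      have "z\<^sup>2 \<le> w\<^sup>2" using z that by (intro power_mono) auto
      moreover have "z / (1 - z) \<le> w / (1 - w)" using z that by (intro frac_le) auto
      ultimately show ?thesis by (intro add_mono divide_right_mono mult_left_mono) auto
    qed
    consider "d = 2" | "d = 3" | "d \<ge> 4" using d by linarith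
    then show ?thesis
    proof cases
      case 1
      have "2 \<le> j" using j 1 by (intro power2_le_imp_le[of 2 j]) auto
      then have "2 / (5 * j) \<le> 2 / (5 * 2)" by (intro divide_left_mono) auto
      then have w: "z \<le> 1 / 5" using z by simp
      have "(real d + 2) * z\<^sup>2 / 8 + real d * (z / (1 - z)) \<le> 61 / 100"
        using E[OF w] by (simp add: 1 power2_eq_square)
      then have "exp ((real d + 2) * z\<^sup>2 / 8 + real d * (z / (1 - z))) \<le> exp (61 / 100)" by simp
      also have "\<dots> \<le> 1 + 61 / 100 + (61 / 100)\<^sup>2" by (rule exp_bound) auto
      also have "\<dots> \<le> (real d + 2) / 2" by (simp add: 1 power2_eq_square)
      finally show ?thesis using w by simp
    next
      case 2
      have "61 / 25 \<le> j" using j 2 by (intro power2_le_imp_le[of "61 / 25" j]) (auto simp: power2_eq_square)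
      then have "2 / (5 * j) \<le> 2 / (5 * (61 / 25))" by (intro divide_left_mono) auto
      then have w: "z \<le> 10 / 61" using z by simp
      have "(real d + 2) * z\<^sup>2 / 8 + real d * (z / (1 - z)) \<le> 61 / 100"
        using E[OF w] by (simp add: 2 power2_eq_square)
      then have "exp ((real d + 2) * z\<^sup>2 / 8 + real d * (z / (1 - z))) \<le> exp (61 / 100)" by simp
      also have "\<dots> \<le> 1 + 61 / 100 + (61 / 100)\<^sup>2" by (rule exp_bound) auto
      also have "\<dots> \<le> (real d + 2) / 2" by (simp add: 2 power2_eq_square)
      finally show ?thesis using w by simp
    next
      case 3
      then have d4: "real d \<ge> 4" by simp
      have "2 / (5 * j) \<le> 2 / (5 * (real d / 2))" using j d4 by (intro divide_left_mono) auto
      also have "\<dots> = 4 / (5 * real d)" by simp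
      finally have zd: "z \<le> 4 / (5 * real d)" using z by simp
      then have dz: "real d * z \<le> 4 / 5" using d4 by (simp add: le_divide_eq mult_ac)
      have "4 / (5 * real d) \<le> 4 / (5 * 4)" using d4 by (intro divide_left_mono) auto
      then have w: "z \<le> 1 / 5" using zd by simp
      have "real d * (z / (1 - z)) \<le> 1"
      proof -
        have "real d * (z / (1 - z)) = (real d * z) / (1 - z)" by simp
        also have "\<dots> \<le> (4 / 5) / (4 / 5)" using dz w z d4 by (intro frac_le) auto
        finally show ?thesis by simp
      qed
      moreover have "(real d + 2) * z\<^sup>2 / 8 \<le> 3 / 100"
      proof -
        have "(real d + 2) * z \<le> 6 / 5" using dz w by (simp add: distrib_right)
        then have "((real d + 2) * z) * z \<le> (6 / 5) * (1 / 5)" using w z by (intro mult_mono) auto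
        moreover have "(real d + 2) * z\<^sup>2 = (real d + 2) * z * z" by (simp add: power2_eq_square)
        ultimately show ?thesis by linarith
      qed
      ultimately have "exp ((real d + 2) * z\<^sup>2 / 8 + real d * (z / (1 - z))) \<le> exp (1 + 3 / 100)" by simp
      also have "\<dots> = exp 1 * exp (3 / 100)" by (rule exp_add)
      also have "\<dots> \<le> (272 / 100) * (1 + 3 / 100 + (3 / 100)\<^sup>2)"
        using e_less_272 exp_bound[of "3 / 100"] by (intro mult_mono) auto
      also have "\<dots> \<le> 3" by (simp add: power2_eq_square)
      also have "\<dots> \<le> (real d + 2) / 2" using d4 by simp
      finally show ?thesis using w by simp
    qed
  qed
  then show "z < 1" "exp ((real d + 2) * z\<^sup>2 / 8 + real d * (z / (1 - z))) \<le> (real d + 2) / 2" by auto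
qed

text \<open>
  With \<open>z\<close> the quotient of half the diagonal of the unit cell by \<open>R\<close>, the left-hand side exceeds the integral of the weight
  by a factor of at most \<open>exp ((d + 2) z\<^sup>2 / 8)\<close>, and the lattice count falls short of the volume by a factor of at least
  \<open>(1 - z)\<^sup>d\<close>. The mean value \<open>2 / (d + 2)\<close> of the weight compensates for both. The lower bounds for
  the Bessel zero enter through \<open>R \<ge> 4 \<surd>d \<alpha>\<close>, which makes \<open>z\<close> small.
\<close>
lemma half_lattice_weight_le:
  fixes \<alpha> R :: real
  assumes d2: "CARD('n) \<ge> 2" and \<alpha>: "\<alpha> > bessel_zero (real CARD('n) / 2 - 1) 1 / pi"
    and R: "R \<ge> 4 * sqrt CARD('n) * \<alpha>"
  shows "(\<Sum>n\<in>cball (0 :: real ^ 'n) (2 * R) \<inter> integer_points. 1 - (norm n / (2 * R))\<^sup>2)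
    \<le> 2 ^ CARD('n) * vol_star (cball (0 :: real ^ 'n) R)"
proof -
  let ?d = "CARD('n)" and ?j = "bessel_zero (real CARD('n) / 2 - 1) 1"
  define V where "V = unit_ball_vol ?d"
  have V: "V > 0" by (simp add: V_def)
  have j: "?j > 0" using bessel_zero_first(1)[of "real ?d / 2 - 1"] d2 by simp
  have j\<alpha>: "?j < pi * \<alpha>" using \<alpha> by (simp add: divide_less_eq mult.commute)
  have \<alpha>p: "\<alpha> > 0" using order.strict_trans[OF j j\<alpha>] by (simp add: zero_less_mult_iff)
  have D: "sqrt (real ?d) > 0" by simp
  have Rp: "R > 0"
  proof -
    have "4 * sqrt (real ?d) * \<alpha> > 0" using D \<alpha>p by simp
    then show ?thesis using R by linarith
  qed
  define z where "z = sqrt (real ?d) / (2 * R)"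
  have zp: "z > 0" using Rp by (simp add: z_def)
  have zle: "z \<le> 2 / (5 * ?j)"
  proof -
    have "z \<le> sqrt (real ?d) / (2 * (4 * sqrt (real ?d) * \<alpha>))"
      unfolding z_def using R Rp D \<alpha>p by (intro divide_left_mono mult_left_mono mult_pos_pos) auto
    also have "\<dots> = 1 / (8 * \<alpha>)" using D by (simp del: D)
    also have "\<dots> \<le> 2 / (5 * ?j)"
    proof -
      \<comment> \<open>\<open>16/5\<close> is a convenient upper bound for \<open>\<pi>\<close>; it turns \<open>1 / (8 \<alpha>)\<close> into \<open>2 / (5 j)\<close>.\<close>
      have "pi < 16 / 5" using pi_approx by simp
      then have "pi * \<alpha> \<le> 16 / 5 * \<alpha>" using \<alpha>p by (intro mult_right_mono) auto
      then have "?j \<le> 16 / 5 * \<alpha>" using j\<alpha> by linarith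
      then show ?thesis using j \<alpha>p by (simp add: divide_simps)
    qed
    finally show ?thesis .
  qed
  note EB = lattice_exponent_bound[OF d2 zp zle j bessel_zero_lower_sqrt[OF d2] bessel_zero_lower_linear[OF d2]]
  define S where "S = sqrt ((2 * R)\<^sup>2 + ?d / 4)"
  have S0: "S \<ge> 0" by (simp add: S_def)
  have zsq: "z\<^sup>2 = ?d / (4 * R\<^sup>2)" by (simp add: z_def power_divide power_mult_distrib)
  have SS: "S \<le> 2 * R * exp (z\<^sup>2 / 8)"
  proof (rule power2_le_imp_le)
    have "(2 * R)\<^sup>2 * z\<^sup>2 = ?d" using Rp by (simp add: zsq power_mult_distrib)
    then have "S\<^sup>2 = (2 * R)\<^sup>2 * (1 + z\<^sup>2 / 4)" unfolding S_def distrib_left by simp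
    also have "\<dots> \<le> (2 * R)\<^sup>2 * exp (z\<^sup>2 / 4)" by (intro mult_left_mono exp_ge_add_one_self) auto
    also have "exp (z\<^sup>2 / 4) = (exp (z\<^sup>2 / 8))\<^sup>2" by (simp add: exp_double[symmetric])
    finally show "S\<^sup>2 \<le> (2 * R * exp (z\<^sup>2 / 8))\<^sup>2" by (simp only: power_mult_distrib)
  qed (use Rp in simp)
  have "(2 * R)\<^sup>2 * (\<Sum>n\<in>cball (0 :: real ^ 'n) (2 * R) \<inter> integer_points. 1 - (norm n / (2 * R))\<^sup>2)
     = (\<Sum>n\<in>cball (0 :: real ^ 'n) (2 * R) \<inter> integer_points. (2 * R)\<^sup>2 - (norm n)\<^sup>2)"
    using Rp by (simp add: sum_distrib_left right_diff_distrib power_divide)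
  also have "\<dots> \<le> V * S ^ (?d + 2) * (2 / (?d + 2))"
    unfolding V_def S_def by (rule lattice_weight_sum_le) (use Rp in simp)
  also have "\<dots> \<le> V * (2 * R * exp (z\<^sup>2 / 8)) ^ (?d + 2) * (2 / (?d + 2))"
    using V SS S0 by (intro mult_right_mono mult_left_mono power_mono) auto
  also have "\<dots> = (2 * R)\<^sup>2 * (V * (2 * R) ^ ?d * (exp ((real ?d + 2) * z\<^sup>2 / 8) * (2 / (?d + 2))))"
  proof -
    have "exp (z\<^sup>2 / 8) ^ (?d + 2) = exp ((real ?d + 2) * z\<^sup>2 / 8)"
    proof -
      have "(real ?d + 2) * z\<^sup>2 / 8 = real (?d + 2) * (z\<^sup>2 / 8)" by simp
      then show ?thesis by (simp only: exp_of_nat_mult)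
    qed
    then show ?thesis unfolding power_mult_distrib[of "2 * R"] power_add[of "2 * R"] by simp
  qed
  finally have W: "(\<Sum>n\<in>cball (0 :: real ^ 'n) (2 * R) \<inter> integer_points. 1 - (norm n / (2 * R))\<^sup>2)
     \<le> V * (2 * R) ^ ?d * (exp ((real ?d + 2) * z\<^sup>2 / 8) * (2 / (?d + 2)))"
    using Rp by (subst (asm) mult_le_cancel_left_pos) auto
  have "exp ((real ?d + 2) * z\<^sup>2 / 8) * (2 / (?d + 2)) \<le> (1 - z) ^ ?d"
  proof -
    let ?y = "z / (1 - z)"
    have "1 \<le> (1 - z) * exp ?y"
    proof -
      have "(1 - z) * (1 + ?y) \<le> (1 - z) * exp ?y" using EB(1) by (intro mult_left_mono exp_ge_add_one_self) auto
      moreover have "(1 - z) * (1 + ?y) = 1" using EB(1) by (simp add: field_simps)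
      ultimately show ?thesis by simp
    qed
    then have one: "1 \<le> (1 - z) ^ ?d * exp (real ?d * ?y)"
      using one_le_power[of "(1 - z) * exp ?y" ?d] by (simp only: power_mult_distrib exp_of_nat_mult)
    have "exp ((real ?d + 2) * z\<^sup>2 / 8) * 1 \<le> exp ((real ?d + 2) * z\<^sup>2 / 8) * ((1 - z) ^ ?d * exp (real ?d * ?y))"
      using one by (intro mult_left_mono) auto
    also have "\<dots> = exp ((real ?d + 2) * z\<^sup>2 / 8 + real ?d * ?y) * (1 - z) ^ ?d" by (simp only: exp_add mult_ac)
    also have "\<dots> \<le> (real ?d + 2) / 2 * (1 - z) ^ ?d" using EB by (intro mult_right_mono) auto
    finally have "exp ((real ?d + 2) * z\<^sup>2 / 8) * (2 / (?d + 2)) \<le> ((real ?d + 2) / 2 * (1 - z) ^ ?d) * (2 / (?d + 2))"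
      by (intro mult_right_mono) simp_all
    also have "\<dots> = (1 - z) ^ ?d"
    proof -
      have "(e / 2 * w) * (2 / e) = w" if "e > 0" for e w :: real using that by simp
      moreover have "real ?d + 2 > 0" by simp
      ultimately show ?thesis unfolding of_nat_add of_nat_numeral by blast
    qed
    finally show ?thesis .
  qed
  then have "V * (2 * R) ^ ?d * (exp ((real ?d + 2) * z\<^sup>2 / 8) * (2 / (?d + 2))) \<le> V * (2 * R) ^ ?d * (1 - z) ^ ?d"
    using V Rp by (intro mult_left_mono) auto
  also have "\<dots> = 2 ^ ?d * (V * (R - sqrt ?d / 2) ^ ?d)"
  proof -
    have "R - sqrt ?d / 2 = R * (1 - z)" using Rp by (simp add: z_def right_diff_distrib)
    then show ?thesis by (simp add: power_mult_distrib)
  qed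
  also have "\<dots> \<le> 2 ^ ?d * vol_star (cball (0 :: real ^ 'n) R)"
  proof (intro mult_left_mono)
    have "sqrt (real ?d) / 2 = z * R" using Rp by (simp add: z_def)
    also have "\<dots> \<le> 1 * R" using EB(1) Rp by (intro mult_right_mono) auto
    finally have "R \<ge> sqrt (real ?d) / 2" by simp
    from unit_ball_vol_le_lattice_points[OF this]
    show "V * (R - sqrt ?d / 2) ^ ?d \<le> vol_star (cball (0 :: real ^ 'n) R)" by (simp add: V_def)
  qed simp
  finally show ?thesis using W by linarith
qed

section \<open>Lower bounds for the smallest singular values\<close>

lemma local_sparsity_facts:
  fixes x :: "'s::finite \<Rightarrow> real ^ 'n"
  assumes x: "inj x" and N0: "N 0 \<le> \<tau>"
  shows "card {i. N (x i - x j) \<le> \<tau>} \<le> local_sparsity N \<tau> (range x)"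
    and "1 \<le> local_sparsity N \<tau> (range x)" and "local_sparsity N \<tau> (range x) \<le> CARD('s)"
proof -
  have c: "card (neighbourhood N (x j) \<tau> (range x)) = card {i. N (x i - x j) \<le> \<tau>}" for j
  proof -
    have "neighbourhood N (x j) \<tau> (range x) = x ` {i. N (x i - x j) \<le> \<tau>}" by (auto simp: neighbourhood_def)
    then show ?thesis using x by (simp add: card_image inj_on_subset)
  qed
  show le: "card {i. N (x i - x j) \<le> \<tau>} \<le> local_sparsity N \<tau> (range x)" for j
    unfolding local_sparsity_def c[symmetric] by (intro Max_ge) auto
  have "card {i. N (x i - x j) \<le> \<tau>} \<ge> 1" for j
  proof -
    have "j \<in> {i. N (x i - x j) \<le> \<tau>}" using N0 by simp
    then show ?thesis by (metis One_nat_def Suc_leI card_gt_0_iff empty_iff finite_code)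
  qed
  then show "1 \<le> local_sparsity N \<tau> (range x)" using le[of undefined] order.trans by blast
  have "card (neighbourhood N z \<tau> (range x)) \<le> CARD('s)" for z
  proof -
    have "card (neighbourhood N z \<tau> (range x)) \<le> card (range x)"
      by (intro card_mono) (auto simp: neighbourhood_def)
    also have "\<dots> \<le> CARD('s)" by (rule card_image_le) simp
    finally show ?thesis .
  qed
  then show "local_sparsity N \<tau> (range x) \<le> CARD('s)"
    unfolding local_sparsity_def by (intro Max.boundedI) auto
qed

text \<open>
  Bookkeeping that brings the squared estimate into the form with square roots and real powers.
\<close>
lemma powr_form_of_bound:
  fixes a b X p A q s :: real and \<nu> :: nat
  assumes ab: "a > 0" "b > 0" and q: "0 \<le> q" "q * (a * b) \<le> 1" and s: "s > 0" and X: "X \<ge> 0" and p: "p \<ge> 0" and A: "A \<ge> 0"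
    and main: "p\<^sup>2 * X \<le> s * 2 ^ (\<nu> - 1) * q ^ \<nu> * A"
  shows "1 / sqrt (2 ^ (\<nu> - 1) * s) * a powr (real \<nu> / 2) * b powr (real \<nu> / 2) * sqrt X * p \<le> sqrt A"
proof -
  have h: "c powr (real \<nu> / 2) = sqrt (c ^ \<nu>)" if "c > 0" for c :: real
    using that by (simp add: powr_half_sqrt[symmetric] powr_realpow[symmetric] powr_powr)
  have "(p\<^sup>2 * X) * (a * b) ^ \<nu> \<le> (s * 2 ^ (\<nu> - 1) * q ^ \<nu> * A) * (a * b) ^ \<nu>"
    using main ab by (intro mult_right_mono) auto
  also have "\<dots> = s * 2 ^ (\<nu> - 1) * A * (q * (a * b)) ^ \<nu>"
    unfolding power_mult_distrib[of q] by (simp only: mult_ac)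
  also have "\<dots> \<le> s * 2 ^ (\<nu> - 1) * A * 1"
    using q ab s A by (intro mult_left_mono power_le_one) auto
  finally have "(p\<^sup>2 * X) * (a * b) ^ \<nu> \<le> 2 ^ (\<nu> - 1) * s * A" by (simp add: mult_ac)
  then have le: "(p\<^sup>2 * X) * (a * b) ^ \<nu> / (2 ^ (\<nu> - 1) * s) \<le> A"
    using s by (simp add: pos_divide_le_eq mult.commute)
  have "1 / sqrt (2 ^ (\<nu> - 1) * s) * a powr (real \<nu> / 2) * b powr (real \<nu> / 2) * sqrt X * p
    = sqrt ((p\<^sup>2 * X) * (a * b) ^ \<nu> / (2 ^ (\<nu> - 1) * s))"
    unfolding h[OF ab(1)] h[OF ab(2)] using p
    by (simp add: real_sqrt_mult real_sqrt_divide power_mult_distrib)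
  also have "\<dots> \<le> sqrt A" using le by simp
  finally show ?thesis .
qed

lemma torus_norm_0 [simp]: "torus_norm (0 :: real ^ 'n) = 0"
  using torus_norm_local[of 0 "0 :: real ^ 'n"] by simp

lemma exp_wave: "exp (- 2 * of_real pi * \<i> * of_real (w \<bullet> x)) = cnj (wave w x)"
  unfolding wave_minus(2)[symmetric] by (simp add: wave_def cis_conv_exp mult_ac)

lemma Min_prod_pos_le:
  fixes f :: "'s::finite \<Rightarrow> 's \<Rightarrow> real"
  assumes c: "c > 0" and p: "p = (MIN k. \<Prod>j | 0 < f j k \<and> f j k \<le> t. c * f j k)"
  shows "p > 0" "p \<le> (\<Prod>j | 0 < f j k \<and> f j k \<le> t. c * f j k)"
proof -
  let ?g = "\<lambda>k. \<Prod>j | 0 < f j k \<and> f j k \<le> t. c * f j k"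
  have "?g k > 0" for k using c by (intro prod_pos) auto
  then show "p > 0" unfolding p by (subst Min_gr_iff) auto
  show "p \<le> ?g k" unfolding p by (rule Min_le) auto
qed

context
  fixes x :: "'s::finite \<Rightarrow> real ^ 'n" and \<alpha> \<tau> m :: real
  assumes d2: "CARD('n) \<ge> 2" and \<alpha>: "\<alpha> > bessel_zero (real CARD('n) / 2 - 1) 1 / pi"
    and inj_x: "inj x" and cube: "\<And>k i. - 1 / 2 \<le> x k $ i \<and> x k $ i < 1 / 2"
    and m: "m \<ge> 4 * real CARD('s) * sqrt (real CARD('n))"
    and \<tau>: "0 < \<tau>" "\<tau> \<le> 1 / (4 * sqrt (real CARD('n)))"
begin

text \<open>
  The relations between the radii \<open>R = \<alpha> / \<tau>\<close> and \<open>r = m / (2 \<nu>)\<close> that the lattice estimates require. The lower bound on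
  \<open>r\<close> comes from \<open>m \<ge> 4 s \<surd>d\<close> and \<open>\<nu> \<le> s\<close>.
\<close>
lemma scale_facts:
  fixes \<nu> :: nat
  assumes "1 \<le> \<nu>" "\<nu> \<le> CARD('s)" "2 * \<alpha> * real \<nu> / \<tau> \<le> m"
  shows "\<alpha> > 0" "m > 0" "\<alpha> / \<tau> > 0" "m / (2 * real \<nu>) \<ge> 2 * sqrt CARD('n)" "\<alpha> / \<tau> \<le> m / (2 * real \<nu>)"
    "4 * sqrt CARD('n) * \<alpha> \<le> \<alpha> / \<tau>" "\<alpha> / (\<alpha> / \<tau>) = \<tau>"
proof -
  show \<alpha>p: "\<alpha> > 0" using \<alpha> bessel_zero_pi_pos[OF d2] by linarith
  have D: "sqrt (real CARD('n)) > 0" by simp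
  have "4 * real \<nu> * sqrt (real CARD('n)) \<le> 4 * real CARD('s) * sqrt (real CARD('n))"
    using assms(2) by (intro mult_right_mono mult_left_mono) auto
  then have m\<nu>: "4 * real \<nu> * sqrt (real CARD('n)) \<le> m" using m by linarith
  moreover have "4 * real \<nu> * sqrt (real CARD('n)) > 0" using assms(1) D by simp
  ultimately show "m > 0" by linarith
  show "\<alpha> / \<tau> > 0" using \<alpha>p \<tau> by simp
  show "m / (2 * real \<nu>) \<ge> 2 * sqrt CARD('n)" using m\<nu> assms(1) by (simp add: pos_le_divide_eq mult_ac)
  have "\<alpha> / \<tau> * (2 * real \<nu>) \<le> m" using assms(3) by (simp add: mult_ac)
  then show "\<alpha> / \<tau> \<le> m / (2 * real \<nu>)" using assms(1) by (simp add: pos_le_divide_eq)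
  have "\<tau> * (4 * sqrt CARD('n)) \<le> 1" using \<tau> D by (simp add: pos_le_divide_eq)
  then have "\<alpha> * (\<tau> * (4 * sqrt CARD('n))) \<le> \<alpha> * 1" using \<alpha>p by (intro mult_left_mono) auto
  then show "4 * sqrt CARD('n) * \<alpha> \<le> \<alpha> / \<tau>" using \<tau> by (simp add: pos_le_divide_eq mult_ac)
  show "\<alpha> / (\<alpha> / \<tau>) = \<tau>" using \<alpha>p \<tau> by simp
qed

text \<open>
  Differences of points of the cube have coordinates in \<open>(-1, 1)\<close>, and the only integer point among them is \<open>0\<close>.
\<close>
lemma torus_distinct: "j \<noteq> k \<Longrightarrow> torus_norm (x j - x k) > 0"
proof (rule ccontr)
  assume jk: "j \<noteq> k" and "\<not> torus_norm (x j - x k) > 0"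
  then have "torus_norm (x j - x k) = 0" using torus_norm_nonneg[of "x j - x k"] by linarith
  then have e: "x j - x k = nearest_int (x j - x k)" by (simp add: torus_norm_nearest)
  have "x j $ i = x k $ i" for i
  proof -
    have "(x j - x k) $ i \<in> \<int>" by (subst e) (use nearest_int_integer in \<open>auto simp: integer_points_def\<close>)
    then obtain z :: int where z: "x j $ i - x k $ i = of_int z" by (auto simp: Ints_def)
    have "\<bar>real_of_int z\<bar> < 1" unfolding z[symmetric] using cube[of j i] cube[of k i] by linarith
    then have "z = 0" by linarith
    then show ?thesis using z by simp
  qed
  then have "x j = x k" by (simp add: vec_eq_iff)
  then show False using jk inj_x by (simp add: inj_eq)
qed

lemma volume_ratio:
  fixes R :: real
  assumes "R > 0"
  shows "vol_star (cball (0 :: real ^ 'n) R) > 0" "vol (cball (0 :: real ^ 'n) 1) > 0"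
    "vol (cball (0 :: real ^ 'n) R) = vol (cball (0 :: real ^ 'n) 1) * R ^ CARD('n)"
proof -
  have v: "vol (cball (0 :: real ^ 'n) r) = unit_ball_vol CARD('n) * r ^ CARD('n)" if "r \<ge> 0" for r
    using content_cball[OF that, of "0 :: real ^ 'n"] by (simp add: vol_def measure_completion)
  then show "vol (cball (0 :: real ^ 'n) 1) > 0" "vol (cball (0 :: real ^ 'n) R) = vol (cball (0 :: real ^ 'n) 1) * R ^ CARD('n)"
    using assms by simp_all
  have "0 \<in> cball 0 R \<inter> (integer_points :: (real ^ 'n) set)" using assms by simp
  moreover have "finite (cball 0 R \<inter> (integer_points :: (real ^ 'n) set))" by (rule finite_integer_points_bounded) simp
  ultimately have "card (cball 0 R \<inter> (integer_points :: (real ^ 'n) set)) > 0" using card_gt_0_iff by blast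
  then show "vol_star (cball (0 :: real ^ 'n) R) > 0" by (simp add: vol_star_def)
qed

lemma c_pos: "c_const TYPE('n) \<alpha> > 0"
proof (rule c_const_pos_and_frame_bound(1)[where Y = "{} :: 's set" and y = x, OF d2 \<alpha>])
  have "\<alpha> > 0" using \<alpha> bessel_zero_pi_pos[OF d2] by linarith
  then show "2 * \<alpha> > 0" "\<alpha> / (2 * \<alpha>) < 1" by simp_all
qed simp_all

text \<open>
  The estimate on the unshifted lattice. The weights \<open>1 - \<bar>n\<bar>\<^sup>2/R\<^sup>2\<close> are at most \<open>1\<close>, so their sum is at most the number
  of lattice points in the ball of radius \<open>R\<close>.
\<close>
lemma sigma_min_Phi_bound:
  assumes \<nu>: "\<nu> = local_sparsity torus_norm \<tau> (range x)" and m\<nu>: "2 * \<alpha> * real \<nu> / \<tau> \<le> m"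
  shows "sigma_min_Phi (cball 0 m) x \<ge>
        1 / sqrt (2 ^ (\<nu> - 1) * real CARD('s))
        * (c_const TYPE('n) \<alpha> / vol (cball 0 1 :: (real ^ 'n) set)) powr (real \<nu> / 2)
        * (vol (cball 0 (\<alpha> / \<tau>) :: (real ^ 'n) set)
           / vol_star (cball 0 (\<alpha> / \<tau>) :: (real ^ 'n) set)) powr (real \<nu> / 2)
        * sqrt (vol_star (cball 0 (m / (2 * real \<nu>)) :: (real ^ 'n) set))
        * (MIN k. \<Prod>j | 0 < torus_norm (x j - x k) \<and> torus_norm (x j - x k) \<le> real \<nu> / m.
                    m / real \<nu> * torus_norm (x j - x k))"
    (is "_ \<ge> ?B")
  unfolding sigma_min_Phi_def
proof (rule cINF_greatest)
  show "{u :: complex ^ 's. norm u = 1} \<noteq> {}"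
  proof -
    have "axis undefined 1 \<in> {u :: complex ^ 's. norm u = 1}" by simp
    then show ?thesis by blast
  qed
  fix u :: "complex ^ 's" assume "u \<in> {u. norm u = 1}"
  then have u1: "(\<Sum>k\<in>UNIV. (norm (u $ k))\<^sup>2) = 1" by (simp add: norm_vec_def L2_set_def real_sqrt_eq_1_iff)
  have N0: "torus_norm (0 :: real ^ 'n) \<le> \<tau>" using \<tau> by simp
  note ls = local_sparsity_facts[where N = torus_norm and x = x, OF inj_x N0, folded \<nu>]
  note sc = scale_facts[OF ls(2,3) m\<nu>]
  define R where "R = \<alpha> / \<tau>"
  define r where "r = m / (2 * real \<nu>)"
  have \<nu>p: "real \<nu> > 0" using ls(2) by simp
  have r: "2 * r = m / real \<nu>" "1 / (2 * r) = real \<nu> / m" "2 * real \<nu> * r = m" using \<nu>p by (simp_all add: r_def)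
  define p where "p = (MIN k. \<Prod>j | 0 < torus_norm (x j - x k) \<and> torus_norm (x j - x k) \<le> real \<nu> / m.
                    m / real \<nu> * torus_norm (x j - x k))"
  note p = Min_prod_pos_le[where f = "\<lambda>j k. torus_norm (x j - x k)", OF _ p_def]
  have mp: "m / real \<nu> > 0" using sc(2) \<nu>p by simp
  let ?c = "c_const TYPE('n) \<alpha> * R ^ CARD('n)"
  let ?W = "\<Sum>n\<in>cball (0 :: real ^ 'n) R \<inter> integer_points. 1 - (norm n / R)\<^sup>2"
  let ?A = "\<Sum>n\<in>cball 0 m \<inter> integer_points. (norm (\<Sum>j\<in>UNIV. u $ j * cnj (wave n (x j))))\<^sup>2"
  have Rp: "R > 0" using sc(3) by (simp add: R_def)
  have "p\<^sup>2 * real (card {n \<in> integer_points. n + 0 \<in> cball (0 :: real ^ 'n) r}) * (\<Sum>k\<in>UNIV. (norm (u $ k))\<^sup>2)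
    \<le> real CARD('s) * 2 ^ (\<nu> - 1) * (?W / ?c) ^ \<nu>
      * (\<Sum>n\<in>{n \<in> integer_points. n + 0 \<in> cball 0 (2 * real \<nu> * r)}. (norm (\<Sum>j\<in>UNIV. u $ j * cnj (wave (n + 0) (x j))))\<^sup>2)"
    by (rule shifted_lattice_lower_bound[OF d2 \<alpha>])
       (use Rp sc \<tau> torus_distinct ls(1) p[OF mp] in \<open>simp_all add: R_def r_def[symmetric] r\<close>)
  moreover have "{n \<in> integer_points. n + 0 \<in> cball 0 t} = cball (0 :: real ^ 'n) t \<inter> integer_points" for t by auto
  ultimately have main: "p\<^sup>2 * vol_star (cball (0 :: real ^ 'n) r) \<le> real CARD('s) * 2 ^ (\<nu> - 1) * (?W / ?c) ^ \<nu> * ?A"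
    by (simp add: u1 r vol_star_def)
  have "1 / sqrt (2 ^ (\<nu> - 1) * real CARD('s))
        * (c_const TYPE('n) \<alpha> / vol (cball 0 1 :: (real ^ 'n) set)) powr (real \<nu> / 2)
        * (vol (cball 0 R :: (real ^ 'n) set) / vol_star (cball 0 R :: (real ^ 'n) set)) powr (real \<nu> / 2)
        * sqrt (vol_star (cball 0 r :: (real ^ 'n) set)) * p \<le> sqrt ?A"
  proof (rule powr_form_of_bound[OF _ _ _ _ _ _ _ _ main])
    show "c_const TYPE('n) \<alpha> / vol (cball 0 1 :: (real ^ 'n) set) > 0"
      using c_pos volume_ratio(2)[OF Rp] by simp
    show "vol (cball 0 R :: (real ^ 'n) set) / vol_star (cball 0 R :: (real ^ 'n) set) > 0"
      using volume_ratio[OF Rp] Rp by simp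
    have W0: "?W \<ge> 0" using ball_weight_nonneg[OF Rp] by (intro sum_nonneg) auto
    then show "?W / ?c \<ge> 0" using c_pos Rp by simp
    have "?W \<le> (\<Sum>n\<in>cball (0 :: real ^ 'n) R \<inter> integer_points. 1)" by (intro sum_mono) simp
    then have "?W \<le> vol_star (cball (0 :: real ^ 'n) R)" by (simp add: vol_star_def)
    then show "?W / ?c * (c_const TYPE('n) \<alpha> / vol (cball 0 1 :: (real ^ 'n) set) * (vol (cball 0 R :: (real ^ 'n) set) / vol_star (cball 0 R :: (real ^ 'n) set))) \<le> 1"
      using volume_ratio[OF Rp] c_pos Rp by (simp add: divide_le_eq)
  qed (use p[OF mp] in \<open>auto simp: vol_star_def intro!: sum_nonneg\<close>)
  also have "sqrt ?A = Phi_norm (cball 0 m) x u"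
    unfolding Phi_norm_def Phi_def exp_wave by (simp add: mult.commute)
  finally show "?B \<le> Phi_norm (cball 0 m) x u"
    unfolding R_def r_def p_def .
qed

text \<open>
  The estimate for the halved points \<open>y = x / 2\<close>, with all radii doubled, on every shifted lattice, integrated over the shifts.
  Coordinates of differences of halved points are at most \<open>1/2\<close> in absolute value, so their torus norm is the Euclidean norm. Undoing
  the scaling produces a factor \<open>2\<^sup>d\<close> on both sides, and \<open>half_lattice_weight_le\<close> compares the weights with
  the lattice points in the ball of radius \<open>R\<close>.
\<close>
lemma sigma_min_F_bound:
  assumes \<nu>: "\<nu> = local_sparsity norm \<tau> (range x)" and m\<nu>: "2 * \<alpha> * real \<nu> / \<tau> \<le> m"
  shows "sigma_min_F (cball 0 m) x \<ge>
        1 / sqrt (2 ^ (\<nu> - 1) * real CARD('s))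
        * (c_const TYPE('n) \<alpha> / vol (cball 0 1 :: (real ^ 'n) set)) powr (real \<nu> / 2)
        * (vol (cball 0 (\<alpha> / \<tau>) :: (real ^ 'n) set)
           / vol_star (cball 0 (\<alpha> / \<tau>) :: (real ^ 'n) set)) powr (real \<nu> / 2)
        * sqrt (vol (cball 0 (m / (2 * real \<nu>)) :: (real ^ 'n) set))
        * (MIN k. \<Prod>j | 0 < norm (x j - x k) \<and> norm (x j - x k) \<le> real \<nu> / m.
                    m / real \<nu> * norm (x j - x k))"
    (is "_ \<ge> ?B")
  unfolding sigma_min_F_def
proof (rule cINF_greatest)
  show "{u :: complex ^ 's. norm u = 1} \<noteq> {}"
  proof -
    have "axis undefined 1 \<in> {u :: complex ^ 's. norm u = 1}" by simp
    then show ?thesis by blast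
  qed
  fix u :: "complex ^ 's" assume "u \<in> {u. norm u = 1}"
  then have u1: "(\<Sum>k\<in>UNIV. (norm (u $ k))\<^sup>2) = 1" by (simp add: norm_vec_def L2_set_def real_sqrt_eq_1_iff)
  have N0: "norm (0 :: real ^ 'n) \<le> \<tau>" using \<tau> by simp
  note ls = local_sparsity_facts[where N = norm and x = x, OF inj_x N0, folded \<nu>]
  note sc = scale_facts[OF ls(2,3) m\<nu>]
  define R where "R = \<alpha> / \<tau>"
  define r where "r = m / (2 * real \<nu>)"
  have \<nu>p: "real \<nu> > 0" using ls(2) by simp
  have r: "2 * r = m / real \<nu>" "2 * real \<nu> * (2 * r) = 2 * m" using \<nu>p by (simp_all add: r_def)
  have rp: "r > 0" using sc(2) \<nu>p by (simp add: r_def)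
  define y where "y k = (1 / 2) *\<^sub>R x k" for k
  have ty: "torus_norm (y j - y k) = norm (x j - x k) / 2" for j k
  proof -
    have "torus_norm (y j - y k) = norm (y j - y k - 0)"
    proof (rule torus_norm_eqI)
      fix i show "\<bar>(y j - y k) $ i - 0 $ i\<bar> \<le> 1 / 2"
      proof -
        have "\<bar>x j $ i - x k $ i\<bar> \<le> 1" using cube[of j i] cube[of k i] by arith
        moreover have e: "(y j - y k) $ i - 0 $ i = (x j $ i - x k $ i) / 2" by (simp add: y_def diff_divide_distrib)
        ultimately show ?thesis unfolding e by simp
      qed
    qed simp
    also have "y j - y k - 0 = (1 / 2) *\<^sub>R (x j - x k)" by (simp add: y_def scaleR_diff_right)
    finally show ?thesis by simp
  qed
  define p where "p = (MIN k. \<Prod>j | 0 < norm (x j - x k) \<and> norm (x j - x k) \<le> real \<nu> / m.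
                    m / real \<nu> * norm (x j - x k))"
  have mp: "m / real \<nu> > 0" using sc(2) \<nu>p by simp
  note p = Min_prod_pos_le[where f = "\<lambda>j k. norm (x j - x k)", OF mp p_def]
  have p_y: "p \<le> (\<Prod>j | 0 < torus_norm (y j - y k) \<and> torus_norm (y j - y k) \<le> 1 / (2 * (2 * r)). 2 * (2 * r) * torus_norm (y j - y k))" for k
  proof -
    have "1 / (2 * (2 * r)) = real \<nu> / m / 2" using sc(2) \<nu>p by (simp add: r_def)
    then have "{j. 0 < torus_norm (y j - y k) \<and> torus_norm (y j - y k) \<le> 1 / (2 * (2 * r))}
      = {j. 0 < norm (x j - x k) \<and> norm (x j - x k) \<le> real \<nu> / m}" by (simp add: ty)
    then show ?thesis using p(2)[of k] by (simp add: ty r)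
  qed
  define W where "W = (\<Sum>n\<in>cball (0 :: real ^ 'n) (2 * R) \<inter> integer_points. 1 - (norm n / (2 * R))\<^sup>2)"
  define q where "q = W / (c_const TYPE('n) \<alpha> * (2 * R) ^ CARD('n))"
  define K where "K = real CARD('s) * 2 ^ (\<nu> - 1) * q ^ \<nu>"
  have Rp: "R > 0" using sc(3) by (simp add: R_def)
  have W0: "W \<ge> 0" unfolding W_def using ball_weight_nonneg[of "2 * R"] Rp by (intro sum_nonneg) auto
  have q0: "q \<ge> 0" using W0 c_pos Rp by (simp add: q_def)
  have K0: "K \<ge> 0" using q0 by (simp add: K_def)
  define A where "A w = (norm (\<Sum>j\<in>UNIV. u $ j * cnj (wave w (y j))))\<^sup>2" for w
  have [measurable]: "A \<in> borel_measurable borel"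
    unfolding A_def wave_def by (intro borel_measurable_continuous_onI continuous_intros continuous_on_id)
  have A0: "A w \<ge> 0" for w by (simp add: A_def)
  have A2: "A (2 *\<^sub>R w) = (norm (fourier_op x u w))\<^sup>2" for w
    unfolding A_def fourier_op_def exp_wave by (simp add: wave_def y_def)
  have lattice: "p\<^sup>2 * real (card {n \<in> integer_points. n + \<theta> \<in> cball (0 :: real ^ 'n) (2 * r)})
    \<le> K * (\<Sum>n\<in>{n \<in> integer_points. n + \<theta> \<in> cball 0 (2 * m)}. A (n + \<theta>))" for \<theta>
  proof -
    have D: "sqrt (real CARD('n)) \<ge> 0" by simp
    have "p\<^sup>2 * real (card {n \<in> integer_points. n + \<theta> \<in> cball (0 :: real ^ 'n) (2 * r)}) * (\<Sum>k\<in>UNIV. (norm (u $ k))\<^sup>2)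
      \<le> real CARD('s) * 2 ^ (\<nu> - 1) * ((\<Sum>n\<in>cball (0 :: real ^ 'n) (2 * R) \<inter> integer_points. 1 - (norm n / (2 * R))\<^sup>2)
          / (c_const TYPE('n) \<alpha> * (2 * R) ^ CARD('n))) ^ \<nu>
        * (\<Sum>n\<in>{n \<in> integer_points. n + \<theta> \<in> cball 0 (2 * real \<nu> * (2 * r))}. (norm (\<Sum>j\<in>UNIV. u $ j * cnj (wave (n + \<theta>) (y j))))\<^sup>2)"
    proof (rule shifted_lattice_lower_bound[OF d2 \<alpha>])
      have half: "\<alpha> / (2 * R) = \<tau> / 2" using sc(1) \<tau> by (simp add: R_def)
      show "2 * R > 0" using Rp by simp
      show "\<alpha> / (2 * R) \<le> 1 / (4 * sqrt CARD('n))" using half \<tau> by linarith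
      show "2 * sqrt CARD('n) \<le> 2 * r" using sc(4) D unfolding r_def by linarith
      show "2 * R \<le> 2 * r" using sc(5) unfolding r_def R_def by linarith
      show "0 < torus_norm (y j - y k)" if "j \<noteq> k" for j k
        using inj_x that by (simp add: ty inj_eq)
      show "card {i. torus_norm (y i - y j) \<le> \<alpha> / (2 * R)} \<le> \<nu>" for j
        using ls(1)[of j] by (simp add: ty half)
    qed (use p(1) p_y in auto)
    then show ?thesis unfolding u1 r(2) W_def[symmetric] q_def[symmetric] K_def[symmetric] A_def[symmetric] mult_1_right .
  qed
  define J where "J = (LINT w:cball 0 m|lebesgue. (norm (fourier_op x u w))\<^sup>2)"
  have cont: "continuous_on S (\<lambda>w. (norm (fourier_op x u w))\<^sup>2)" for S
    unfolding fourier_op_def by (intro continuous_intros)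
  have int: "integrable lborel (\<lambda>w. indicator (cball 0 m) w *\<^sub>R (norm (fourier_op x u w))\<^sup>2)"
    by (rule borel_integrable_compact[OF compact_cball cont])
  have J: "J = (LINT w|lborel. indicator (cball 0 m) w *\<^sub>R (norm (fourier_op x u w))\<^sup>2)"
    unfolding J_def set_lebesgue_integral_def
    by (rule integral_completion) (use borel_measurable_integrable[OF int] in simp)
  have J0: "J \<ge> 0" unfolding J by (intro integral_nonneg_AE) auto
  have v: "vol (cball (0 :: real ^ 'n) t) = unit_ball_vol CARD('n) * t ^ CARD('n)" if "t \<ge> 0" for t
    using content_cball[OF that, of "0 :: real ^ 'n"] by (simp add: vol_def measure_completion)
  have "ennreal (p\<^sup>2 * (2 ^ CARD('n) * vol (cball (0 :: real ^ 'n) r))) = ennreal (p\<^sup>2) * emeasure lborel (cball (0 :: real ^ 'n) (2 * r))"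
  proof -
    have "emeasure lborel (cball (0 :: real ^ 'n) (2 * r)) = ennreal (unit_ball_vol CARD('n) * (2 * r) ^ CARD('n))"
      using emeasure_cball[of "2 * r" "0 :: real ^ 'n"] rp by simp
    also have "unit_ball_vol CARD('n) * (2 * r) ^ CARD('n) = 2 ^ CARD('n) * vol (cball (0 :: real ^ 'n) r)"
      using rp by (simp add: v power_mult_distrib)
    finally show ?thesis using rp by (simp only: ennreal_mult' zero_le_power2)
  qed
  also have "\<dots> = (\<integral>\<^sup>+w. ennreal (indicator (cball (0 :: real ^ 'n) (2 * r)) w * p\<^sup>2) \<partial>lborel)"
    by (subst nn_integral_cmult_indicator[symmetric]) (auto intro!: nn_integral_cong simp: indicator_def)
  also have "\<dots> = (\<integral>\<^sup>+\<theta>. ennreal (\<Sum>n\<in>{n \<in> integer_points. n + \<theta> \<in> cball (0 :: real ^ 'n) (2 * r)}. p\<^sup>2) \<partial>cell_measure)"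
    by (rule nn_integral_cball_lattice) auto
  also have "\<dots> \<le> (\<integral>\<^sup>+\<theta>. ennreal (\<Sum>n\<in>{n \<in> integer_points. n + \<theta> \<in> cball 0 (2 * m)}. K * A (n + \<theta>)) \<partial>cell_measure)"
    using lattice by (intro nn_integral_mono ennreal_leI) (simp add: mult.commute flip: sum_distrib_left)
  also have "\<dots> = (\<integral>\<^sup>+w. ennreal (indicator (cball 0 (2 * m)) w * (K * A w)) \<partial>lborel)"
    by (rule nn_integral_cball_lattice[symmetric]) (auto simp: A0 K0)
  also have "\<dots> = (\<integral>\<^sup>+w. ennreal K * ennreal (indicator (cball 0 (2 * m)) w * A w) \<partial>lborel)"
    using K0 A0 by (intro nn_integral_cong) (simp add: mult.left_commute flip: ennreal_mult)
  also have "\<dots> = ennreal K * (\<integral>\<^sup>+w. ennreal (indicator (cball 0 (2 * m)) w * A w) \<partial>lborel)"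
  proof (rule nn_integral_cmult)
    have [measurable]: "cball (0 :: real ^ 'n) (2 * m) \<in> sets borel" by simp
    show "(\<lambda>w :: real ^ 'n. ennreal (indicator (cball 0 (2 * m)) w * A w)) \<in> borel_measurable lborel" by measurable
  qed
  also have "(\<integral>\<^sup>+w. ennreal (indicator (cball 0 (2 * m)) w * A w) \<partial>lborel)
    = ennreal (2 ^ CARD('n)) * (\<integral>\<^sup>+w. ennreal (indicator (cball 0 (2 * m)) (2 *\<^sub>R w) * A (2 *\<^sub>R w)) \<partial>(lborel :: (real ^ 'n) measure))"
  proof (rule nn_integral_scale)
    have [measurable]: "cball (0 :: real ^ 'n) (2 * m) \<in> sets borel" by simp
    show "(\<lambda>w :: real ^ 'n. ennreal (indicator (cball 0 (2 * m)) w * A w)) \<in> borel_measurable borel" by measurable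
  qed simp
  also have "(\<integral>\<^sup>+w. ennreal (indicator (cball 0 (2 * m)) (2 *\<^sub>R w) * A (2 *\<^sub>R w)) \<partial>(lborel :: (real ^ 'n) measure))
    = (\<integral>\<^sup>+w. ennreal (indicator (cball 0 m) w *\<^sub>R (norm (fourier_op x u w))\<^sup>2) \<partial>lborel)"
    by (intro nn_integral_cong) (auto simp: A2 indicator_def)
  also have "\<dots> = ennreal J"
    unfolding J by (rule nn_integral_eq_integral[OF int]) auto
  also have "ennreal K * (ennreal (2 ^ CARD('n)) * ennreal J) = ennreal (K * (2 ^ CARD('n) * J))"
    using K0 J0 by (simp add: ennreal_mult)
  finally have "p\<^sup>2 * (2 ^ CARD('n) * vol (cball (0 :: real ^ 'n) r)) \<le> K * (2 ^ CARD('n) * J)"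
    using K0 J0 by (subst (asm) ennreal_le_iff) auto
  then have "2 ^ CARD('n) * (p\<^sup>2 * vol (cball (0 :: real ^ 'n) r)) \<le> 2 ^ CARD('n) * (K * J)" by (simp only: mult_ac)
  then have main: "p\<^sup>2 * vol (cball (0 :: real ^ 'n) r) \<le> real CARD('s) * 2 ^ (\<nu> - 1) * q ^ \<nu> * J"
    unfolding K_def[symmetric] by simp
  have "1 / sqrt (2 ^ (\<nu> - 1) * real CARD('s))
        * (c_const TYPE('n) \<alpha> / vol (cball 0 1 :: (real ^ 'n) set)) powr (real \<nu> / 2)
        * (vol (cball 0 R :: (real ^ 'n) set) / vol_star (cball 0 R :: (real ^ 'n) set)) powr (real \<nu> / 2)
        * sqrt (vol (cball 0 r :: (real ^ 'n) set)) * p \<le> sqrt J"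
  proof (rule powr_form_of_bound[OF _ _ q0 _ _ _ _ J0 main])
    show "c_const TYPE('n) \<alpha> / vol (cball 0 1 :: (real ^ 'n) set) > 0"
      using c_pos volume_ratio(2)[OF Rp] by simp
    show "vol (cball 0 R :: (real ^ 'n) set) / vol_star (cball 0 R :: (real ^ 'n) set) > 0"
      using volume_ratio[OF Rp] Rp by simp
    have "W \<le> 2 ^ CARD('n) * vol_star (cball (0 :: real ^ 'n) R)"
      unfolding W_def by (rule half_lattice_weight_le[OF d2 \<alpha>]) (use sc(6) in \<open>simp add: R_def\<close>)
    then show "q * (c_const TYPE('n) \<alpha> / vol (cball 0 1 :: (real ^ 'n) set) * (vol (cball 0 R :: (real ^ 'n) set) / vol_star (cball 0 R :: (real ^ 'n) set))) \<le> 1"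
      using volume_ratio[OF Rp] c_pos Rp by (simp add: q_def divide_le_eq power_mult_distrib mult_ac)
  qed (use p(1) in \<open>auto simp: vol_def\<close>)
  also have "sqrt J = L2_norm_on (cball 0 m) (fourier_op x u)"
    by (simp add: J_def L2_norm_on_def)
  finally show "?B \<le> L2_norm_on (cball 0 m) (fourier_op x u)"
    unfolding R_def r_def p_def .
qed

end

theorem theorem3p9:
  fixes x :: "'s::finite \<Rightarrow> real ^ 'n"
    and \<alpha> \<tau> m :: real
    and \<nu> \<nu>T :: nat
  assumes "CARD('n) \<ge> 2"
    and "\<alpha> > bessel_zero (real CARD('n) / 2 - 1) 1 / pi"
    and "inj x"
    and "\<And>k i. - 1 / 2 \<le> x k $ i \<and> x k $ i < 1 / 2"
    and "m \<ge> 4 * real CARD('s) * sqrt (real CARD('n))"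
    and "0 < \<tau>" and "\<tau> \<le> 1 / (4 * sqrt (real CARD('n)))"
    and "\<nu> = local_sparsity norm \<tau> (range x)"
    and "\<nu>T = local_sparsity torus_norm \<tau> (range x)"
  shows "(2 * \<alpha> * real \<nu> / \<tau> \<le> m \<longrightarrow>
      sigma_min_F (cball 0 m) x \<ge>
        1 / sqrt (2 ^ (\<nu> - 1) * real CARD('s))
        * (c_const TYPE('n) \<alpha> / vol (cball 0 1 :: (real ^ 'n) set)) powr (real \<nu> / 2)
        * (vol (cball 0 (\<alpha> / \<tau>) :: (real ^ 'n) set)
           / vol_star (cball 0 (\<alpha> / \<tau>) :: (real ^ 'n) set)) powr (real \<nu> / 2)
        * sqrt (vol (cball 0 (m / (2 * real \<nu>)) :: (real ^ 'n) set))
        * (MIN k. \<Prod>j | 0 < norm (x j - x k) \<and> norm (x j - x k) \<le> real \<nu> / m.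
                    m / real \<nu> * norm (x j - x k)))
    \<and> (2 * \<alpha> * real \<nu>T / \<tau> \<le> m \<longrightarrow>
      sigma_min_Phi (cball 0 m) x \<ge>
        1 / sqrt (2 ^ (\<nu>T - 1) * real CARD('s))
        * (c_const TYPE('n) \<alpha> / vol (cball 0 1 :: (real ^ 'n) set)) powr (real \<nu>T / 2)
        * (vol (cball 0 (\<alpha> / \<tau>) :: (real ^ 'n) set)
           / vol_star (cball 0 (\<alpha> / \<tau>) :: (real ^ 'n) set)) powr (real \<nu>T / 2)
        * sqrt (vol_star (cball 0 (m / (2 * real \<nu>T)) :: (real ^ 'n) set))
        * (MIN k. \<Prod>j | 0 < torus_norm (x j - x k) \<and> torus_norm (x j - x k) \<le> real \<nu>T / m.
                    m / real \<nu>T * torus_norm (x j - x k)))"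
proof (intro conjI impI)
  assume "2 * \<alpha> * real \<nu> / \<tau> \<le> m"
  from sigma_min_F_bound[OF assms(1-8) this]
  show "sigma_min_F (cball 0 m) x \<ge>
        1 / sqrt (2 ^ (\<nu> - 1) * real CARD('s))
        * (c_const TYPE('n) \<alpha> / vol (cball 0 1 :: (real ^ 'n) set)) powr (real \<nu> / 2)
        * (vol (cball 0 (\<alpha> / \<tau>) :: (real ^ 'n) set)
           / vol_star (cball 0 (\<alpha> / \<tau>) :: (real ^ 'n) set)) powr (real \<nu> / 2)
        * sqrt (vol (cball 0 (m / (2 * real \<nu>)) :: (real ^ 'n) set))
        * (MIN k. \<Prod>j | 0 < norm (x j - x k) \<and> norm (x j - x k) \<le> real \<nu> / m.
                    m / real \<nu> * norm (x j - x k))" .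
next
  assume "2 * \<alpha> * real \<nu>T / \<tau> \<le> m"
  from sigma_min_Phi_bound[OF assms(1-7,9) this]
  show "sigma_min_Phi (cball 0 m) x \<ge>
        1 / sqrt (2 ^ (\<nu>T - 1) * real CARD('s))
        * (c_const TYPE('n) \<alpha> / vol (cball 0 1 :: (real ^ 'n) set)) powr (real \<nu>T / 2)
        * (vol (cball 0 (\<alpha> / \<tau>) :: (real ^ 'n) set)
           / vol_star (cball 0 (\<alpha> / \<tau>) :: (real ^ 'n) set)) powr (real \<nu>T / 2)
        * sqrt (vol_star (cball 0 (m / (2 * real \<nu>T)) :: (real ^ 'n) set))
        * (MIN k. \<Prod>j | 0 < torus_norm (x j - x k) \<and> torus_norm (x j - x k) \<le> real \<nu>T / m.
                    m / real \<nu>T * torus_norm (x j - x k))" .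
qed

end
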